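(* Let $H$ be a quasi-bialgebra, $A$ a left $H$-module algebra and $B$ a right $H$-module algebra. Then the categories ${}_{A\#H\#B}\mathcal M$ (left modules over the two-sided smash product $A\#H\#B$) and ${}_{A,H,B}\mathcal M$ are isomorphic, the isomorphism being given as follows: • if $M\in{}_{A\#H\#B}\mathcal M$, define $a\cdot m=(a\#1\#1)\cdot m$, $h\triangleright m=(1\#h\#1)\cdot m$, $b\cdot m=(1\#1\#b)\cdot m$; • conversely, if $M\in{}_{A,H,B}\mathcal M$, define $(a\#h\#b)\cdot m=a\cdot(h\triangleright(b\cdot m))$, for all $a\in A$, $h\in H$, $b\in B$, $m\in M$.
   Context: All algebras and spaces are over a field $k$, $\otimes=\otimes_k$; summation is understood. A quasi-bialgebra $(H,\Delta,\varepsilon,\Phi)$: a unital associative algebra $H$, algebra maps $\Delta:H\to H\otimes H$ ($\Delta(h)=h_1\otimes h_2$), $\varepsilon:H\to k$, and an invertible $\Phi=X^1\otimes X^2\otimes X^3\in H^{\otimes3}$, $\Phi^{-1}=x^1\otimes x^2\otimes x^3=y^1\otimes y^2\otimes y^3=z^1\otimes z^2\otimes z^3$, with $(id\otimes\Delta)(\Delta(h))=\Phi(\Delta\otimes id)(\Delta(h))\Phi^{-1}$, $(id\otimes\varepsilon)\Delta=id=(\varepsilon\otimes id)\Delta$, $(1\otimes\Phi)(id\otimes\Delta\otimes id)(\Phi)(\Phi\otimes1)=(id\otimes id\otimes\Delta)(\Phi)(\Delta\otimes id\otimes id)(\Phi)$, $(id\otimes\varepsilon\otimes id)(\Phi)=1\otimes1$.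 A left $H$-module algebra: a left $H$-module $A$ with bilinear multiplication and two-sided unit $1_A$ with $(aa')a''=(X^1\cdot a)[(X^2\cdot a')(X^3\cdot a'')]$, $h\cdot(aa')=(h_1\cdot a)(h_2\cdot a')$, $h\cdot1_A=\varepsilon(h)1_A$. A right $H$-module algebra: a right $H$-module $B$ with bilinear multiplication and two-sided unit $1_B$ with $(bb')b''=(b\cdot x^1)[(b'\cdot x^2)(b''\cdot x^3)]$, $(bb')\cdot h=(b\cdot h_1)(b'\cdot h_2)$, $1_B\cdot h=\varepsilon(h)1_B$. Two-sided smash product $A\#H\#B$: the space $A\otimes H\otimes B$ with the (associative, unital) multiplication $(a\#h\#b)(a'\#h'\#b')=(x^1\cdot a)(x^2h_1y^1\cdot a')\#x^3h_2y^2h'_1z^1\#(b\cdot y^3h'_2z^2)(b'\cdot z^3)$. Category ${}_{A,H,B}\mathcal M$: objects are left $H$-modules $M$ (action $h\triangleright m$) with linear maps $A\otimes M\to M$, $a\otimes m\mapsto a\cdot m$, and $B\otimes M\to M$, $b\otimes m\mapsto b\cdot m$ (weak actions, with $1_A\cdot m=m$, $1_B\cdot m=m$) such that $a\cdot(a'\cdot m)=[(x^1\cdot a)(x^2\cdot a')]\cdot(x^3\triangleright m)$, $h\triangleright(a\cdot m)=(h_1\cdot a)\cdot(h_2\triangleright m)$, $b\cdot(b'\cdot m)=x^1\triangleright([(b\cdot x^2)(b'\cdot x^3)]\cdot m)$, $b\cdot(h\triangleright m)=h_1\triangleright[(b\cdot h_2)\cdot m]$, $b\cdot(a\cdot m)=(y^1\cdot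 a)\cdot[y^2\triangleright((b\cdot y^3)\cdot m)]$, for all $a,a'\in A$, $b,b'\in B$, $h\in H$, $m\in M$. Morphisms are the $H$-linear maps compatible with the two weak actions. *)

theory Defs
  imports "HOL-Algebra.Module" "HOL-Algebra.AbelCoset"
begin

section \<open>Linear and bilinear maps\<close>

definition linear_map ::
    "('k, 'r) ring_scheme \<Rightarrow> ('k, 'v, 'x) module_scheme \<Rightarrow> ('k, 'w, 'y) module_scheme \<Rightarrow>
     ('v \<Rightarrow> 'w) \<Rightarrow> bool"
  where "linear_map K V W f \<longleftrightarrow>
    f \<in> carrier V \<rightarrow> carrier W \<and>
    (\<forall>x\<in>carrier V. \<forall>y\<in>carrier V. f (x \<oplus>\<^bsub>V\<^esub> y) = f x \<oplus>\<^bsub>W\<^esub> f y) \<and>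
    (\<forall>c\<in>carrier K. \<forall>x\<in>carrier V. f (c \<odot>\<^bsub>V\<^esub> x) = c \<odot>\<^bsub>W\<^esub> f x)"

definition bilinear_map ::
    "('k, 'r) ring_scheme \<Rightarrow> ('k, 'u, 'x) module_scheme \<Rightarrow> ('k, 'v, 'y) module_scheme \<Rightarrow>
     ('k, 'w, 'z) module_scheme \<Rightarrow> ('u \<Rightarrow> 'v \<Rightarrow> 'w) \<Rightarrow> bool"
  where "bilinear_map K U V W f \<longleftrightarrow>
    (\<forall>u\<in>carrier U. linear_map K V W (f u)) \<and>
    (\<forall>v\<in>carrier V. linear_map K U W (\<lambda>u. f u v))"


section \<open>Tensor products over \<open>K\<close>\<close>

text \<open>
  \<open>A \<otimes> B\<close> is the quotient of the free module on \<open>carrier A \<times> carrier B\<close> by the submodule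
  generated by the bilinearity relations; its elements are cosets.  Only the \<open>K\<close>-module part of
  the records \<open>A\<close>, \<open>B\<close> is used.  The \<open>mult\<close> and \<open>one\<close> fields are left unspecified here.
\<close>

definition free_module :: "('k, 'r) ring_scheme \<Rightarrow> 'i set \<Rightarrow> ('k, 'i \<Rightarrow> 'k) module"
  where "free_module K X =
    \<lparr>carrier = {p. (\<forall>i. p i \<in> carrier K) \<and> finite {i. p i \<noteq> \<zero>\<^bsub>K\<^esub>} \<and> {i. p i \<noteq> \<zero>\<^bsub>K\<^esub>} \<subseteq> X},
     mult = undefined,
     one = undefined,
     zero = (\<lambda>i. \<zero>\<^bsub>K\<^esub>),
     add = (\<lambda>p q i. p i \<oplus>\<^bsub>K\<^esub> q i),
     smult = (\<lambda>c p i. c \<otimes>\<^bsub>K\<^esub> p i)\<rparr>"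

definition free_gen :: "('k, 'r) ring_scheme \<Rightarrow> 'i \<Rightarrow> ('i \<Rightarrow> 'k)"
  where "free_gen K i = (\<lambda>j. if j = i then \<one>\<^bsub>K\<^esub> else \<zero>\<^bsub>K\<^esub>)"

definition tensor_relators ::
    "('k, 'r) ring_scheme \<Rightarrow> ('k, 'a, 'x) module_scheme \<Rightarrow> ('k, 'b, 'y) module_scheme \<Rightarrow>
     ('a \<times> 'b \<Rightarrow> 'k) set"
  where "tensor_relators K A B =
    (let F = free_module K (carrier A \<times> carrier B); g = (\<lambda>a b. free_gen K (a, b)) in
      {g (a \<oplus>\<^bsub>A\<^esub> a') b \<ominus>\<^bsub>F\<^esub> (g a b \<oplus>\<^bsub>F\<^esub> g a' b) | a a' b.
          a \<in> carrier A \<and> a' \<in> carrier A \<and> b \<in> carrier B} \<union>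
      {g a (b \<oplus>\<^bsub>B\<^esub> b') \<ominus>\<^bsub>F\<^esub> (g a b \<oplus>\<^bsub>F\<^esub> g a b') | a b b'.
          a \<in> carrier A \<and> b \<in> carrier B \<and> b' \<in> carrier B} \<union>
      {g (c \<odot>\<^bsub>A\<^esub> a) b \<ominus>\<^bsub>F\<^esub> (c \<odot>\<^bsub>F\<^esub> g a b) | c a b.
          c \<in> carrier K \<and> a \<in> carrier A \<and> b \<in> carrier B} \<union>
      {g a (c \<odot>\<^bsub>B\<^esub> b) \<ominus>\<^bsub>F\<^esub> (c \<odot>\<^bsub>F\<^esub> g a b) | c a b.
          c \<in> carrier K \<and> a \<in> carrier A \<and> b \<in> carrier B})"

definition tensor_null ::
    "('k, 'r) ring_scheme \<Rightarrow> ('k, 'a, 'x) module_scheme \<Rightarrow> ('k, 'b, 'y) module_scheme \<Rightarrow>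
     ('a \<times> 'b \<Rightarrow> 'k) set"
  where "tensor_null K A B =
    \<Inter>{N. submodule N K (free_module K (carrier A \<times> carrier B)) \<and> tensor_relators K A B \<subseteq> N}"

definition tensor_space ::
    "('k, 'r) ring_scheme \<Rightarrow> ('k, 'a, 'x) module_scheme \<Rightarrow> ('k, 'b, 'y) module_scheme \<Rightarrow>
     ('k, ('a \<times> 'b \<Rightarrow> 'k) set) module"
  where "tensor_space K A B =
    (let F = free_module K (carrier A \<times> carrier B); N = tensor_null K A B in
      \<lparr>carrier = a_rcosets\<^bsub>F\<^esub> N,
       mult = undefined,
       one = undefined,
       zero = N,
       add = (\<lambda>X Y. X <+>\<^bsub>F\<^esub> Y),
       smult = (\<lambda>c X. \<Union>p\<in>X. N +>\<^bsub>F\<^esub> (c \<odot>\<^bsub>F\<^esub> p))\<rparr>)"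

definition tens ::
    "('k, 'r) ring_scheme \<Rightarrow> ('k, 'a, 'x) module_scheme \<Rightarrow> ('k, 'b, 'y) module_scheme \<Rightarrow>
     'a \<Rightarrow> 'b \<Rightarrow> ('a \<times> 'b \<Rightarrow> 'k) set"
  where "tens K A B a b =
    tensor_null K A B +>\<^bsub>free_module K (carrier A \<times> carrier B)\<^esub> free_gen K (a, b)"

text \<open>
  Sweedler-type summation: for bilinear \<open>f\<close> into \<open>V\<close>, \<open>tlift K V f t\<close> is \<open>\<Sum> f t\<^sub>1 t\<^sub>2\<close>, where
  \<open>t = \<Sum> t\<^sub>1 \<otimes> t\<^sub>2\<close>.  It is the common value of the corresponding sum over all representatives
  of \<open>t\<close>.
\<close>

definition tlift ::
    "('k, 'r) ring_scheme \<Rightarrow> ('k, 'v, 'x) module_scheme \<Rightarrow> ('a \<Rightarrow> 'b \<Rightarrow> 'v) \<Rightarrow>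
     ('a \<times> 'b \<Rightarrow> 'k) set \<Rightarrow> 'v"
  where "tlift K V f t =
    the_elem ((\<lambda>p. \<Oplus>\<^bsub>V\<^esub>i\<in>{i. p i \<noteq> \<zero>\<^bsub>K\<^esub>}. p i \<odot>\<^bsub>V\<^esub> f (fst i) (snd i)) ` t)"

text \<open>Iterated tensor products are bracketed to the right: \<open>A \<otimes> (B \<otimes> C)\<close>.\<close>

definition tens3 ::
    "('k, 'r) ring_scheme \<Rightarrow> ('k, 'a, 'x) module_scheme \<Rightarrow> ('k, 'b, 'y) module_scheme \<Rightarrow>
     ('k, 'c, 'z) module_scheme \<Rightarrow> 'a \<Rightarrow> 'b \<Rightarrow> 'c \<Rightarrow>
     ('a \<times> ('b \<times> 'c \<Rightarrow> 'k) set \<Rightarrow> 'k) set"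
  where "tens3 K A B C a b c = tens K A (tensor_space K B C) a (tens K B C b c)"

definition tlift3 ::
    "('k, 'r) ring_scheme \<Rightarrow> ('k, 'v, 'x) module_scheme \<Rightarrow> ('a \<Rightarrow> 'b \<Rightarrow> 'c \<Rightarrow> 'v) \<Rightarrow>
     ('a \<times> ('b \<times> 'c \<Rightarrow> 'k) set \<Rightarrow> 'k) set \<Rightarrow> 'v"
  where "tlift3 K V f t = tlift K V (\<lambda>a u. tlift K V (\<lambda>b c. f a b c) u) t"

text \<open>The tensor product of algebras, with \<open>(a \<otimes> b)(a' \<otimes> b') = aa' \<otimes> bb'\<close>.\<close>

definition tensor_algebra ::
    "('k, 'r) ring_scheme \<Rightarrow> ('k, 'a, 'x) module_scheme \<Rightarrow> ('k, 'b, 'y) module_scheme \<Rightarrow>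
     ('k, ('a \<times> 'b \<Rightarrow> 'k) set) module"
  where "tensor_algebra K A B =
    (tensor_space K A B)
      \<lparr>mult := (\<lambda>s t.
         tlift K (tensor_space K A B) (\<lambda>a b.
           tlift K (tensor_space K A B) (\<lambda>a' b'.
             tens K A B (a \<otimes>\<^bsub>A\<^esub> a') (b \<otimes>\<^bsub>B\<^esub> b')) t) s),
       one := tens K A B \<one>\<^bsub>A\<^esub> \<one>\<^bsub>B\<^esub>\<rparr>"

abbreviation tensor_algebra3 :: "('k, 'r) ring_scheme \<Rightarrow> ('k, 'h, 'x) module_scheme \<Rightarrow> _"
  where "tensor_algebra3 K H \<equiv> tensor_algebra K H (tensor_algebra K H H)"

abbreviation tensor_algebra4 :: "('k, 'r) ring_scheme \<Rightarrow> ('k, 'h, 'x) module_scheme \<Rightarrow> _"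
  where "tensor_algebra4 K H \<equiv> tensor_algebra K H (tensor_algebra3 K H)"

definition tens4 ::
    "('k, 'r) ring_scheme \<Rightarrow> ('k, 'h, 'x) module_scheme \<Rightarrow> 'h \<Rightarrow> 'h \<Rightarrow> 'h \<Rightarrow> 'h \<Rightarrow>
     ('h \<times> ('h \<times> ('h \<times> 'h \<Rightarrow> 'k) set \<Rightarrow> 'k) set \<Rightarrow> 'k) set"
  where "tens4 K H a b c d =
    tens K H (tensor_space K H (tensor_space K H H)) a (tens3 K H H H b c d)"


section \<open>Quasi-bialgebras\<close>

text \<open>The library's locale \<open>algebra\<close> is restricted to commutative algebras.\<close>

locale assoc_algebra = module K H + ring H for K (structure) and H (structure) +
  assumes mult_bilinear: "bilinear_map K H H H (\<lambda>x y. x \<otimes>\<^bsub>H\<^esub> y)"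

record ('k, 'h) quasi_bialg = "('k, 'h) module" +
  comul :: "'h \<Rightarrow> ('h \<times> 'h \<Rightarrow> 'k) set"
  counit :: "'h \<Rightarrow> 'k"
  reassoc :: "('h \<times> ('h \<times> 'h \<Rightarrow> 'k) set \<Rightarrow> 'k) set"

definition reassoc_inv ::
    "('k, 'r) ring_scheme \<Rightarrow> ('k, 'h, 'x) quasi_bialg_scheme \<Rightarrow>
     ('h \<times> ('h \<times> 'h \<Rightarrow> 'k) set \<Rightarrow> 'k) set"
  where "reassoc_inv K H = inv\<^bsub>tensor_algebra3 K H\<^esub> (reassoc H)"

locale quasi_bialgebra = assoc_algebra K H
  for K :: "('k, 'r) ring_scheme" (structure)
    and H :: "('k, 'h, 'x) quasi_bialg_scheme" (structure) +
  assumes comul_linear: "linear_map K H (tensor_space K H H) (comul H)"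
    and comul_hom: "comul H \<in> ring_hom H (tensor_algebra K H H)"
    and counit_linear:
      "\<And>c h. \<lbrakk>c \<in> carrier K; h \<in> carrier H\<rbrakk> \<Longrightarrow> counit H (c \<odot>\<^bsub>H\<^esub> h) = c \<otimes>\<^bsub>K\<^esub> counit H h"
    and counit_hom: "counit H \<in> ring_hom H K"
    and reassoc_unit: "reassoc H \<in> Units (tensor_algebra3 K H)"
    and quasi_coassoc: "\<And>h. h \<in> carrier H \<Longrightarrow>
      tlift K (tensor_algebra3 K H)
        (\<lambda>h1 h2. tlift K (tensor_algebra3 K H) (\<lambda>h21 h22. tens3 K H H H h1 h21 h22) (comul H h2))
        (comul H h) =
      reassoc H \<otimes>\<^bsub>tensor_algebra3 K H\<^esub>
      tlift K (tensor_algebra3 K H)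
        (\<lambda>h1 h2. tlift K (tensor_algebra3 K H) (\<lambda>h11 h12. tens3 K H H H h11 h12 h2) (comul H h1))
        (comul H h) \<otimes>\<^bsub>tensor_algebra3 K H\<^esub>
      reassoc_inv K H"
    and counit_right: "\<And>h. h \<in> carrier H \<Longrightarrow>
      tlift K H (\<lambda>h1 h2. counit H h2 \<odot>\<^bsub>H\<^esub> h1) (comul H h) = h"
    and counit_left: "\<And>h. h \<in> carrier H \<Longrightarrow>
      tlift K H (\<lambda>h1 h2. counit H h1 \<odot>\<^bsub>H\<^esub> h2) (comul H h) = h"
    and pentagon: \<comment> \<open>\<open>(1 \<otimes> \<Phi>) (id \<otimes> \<Delta> \<otimes> id)(\<Phi>) (\<Phi> \<otimes> 1) = (id \<otimes> id \<otimes> \<Delta>)(\<Phi>) (\<Delta> \<otimes> id \<otimes> id)(\<Phi>)\<close>\<close>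
      "tens K H (tensor_algebra3 K H) \<one>\<^bsub>H\<^esub> (reassoc H) \<otimes>\<^bsub>tensor_algebra4 K H\<^esub>
       tlift3 K (tensor_algebra4 K H)
         (\<lambda>X1 X2 X3. tlift K (tensor_algebra4 K H) (\<lambda>u v. tens4 K H X1 u v X3) (comul H X2))
         (reassoc H) \<otimes>\<^bsub>tensor_algebra4 K H\<^esub>
       tlift3 K (tensor_algebra4 K H) (\<lambda>X1 X2 X3. tens4 K H X1 X2 X3 \<one>\<^bsub>H\<^esub>) (reassoc H) =
       tlift3 K (tensor_algebra4 K H)
         (\<lambda>X1 X2 X3. tlift K (tensor_algebra4 K H) (\<lambda>u v. tens4 K H X1 X2 u v) (comul H X3))
         (reassoc H) \<otimes>\<^bsub>tensor_algebra4 K H\<^esub>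
       tlift3 K (tensor_algebra4 K H)
         (\<lambda>X1 X2 X3. tlift K (tensor_algebra4 K H) (\<lambda>u v. tens4 K H u v X2 X3) (comul H X1))
         (reassoc H)"
    and reassoc_counit: \<comment> \<open>\<open>(id \<otimes> \<epsilon> \<otimes> id)(\<Phi>) = 1 \<otimes> 1\<close>, with \<open>H \<otimes> k \<otimes> H = H \<otimes> H\<close>\<close>
      "tlift3 K (tensor_algebra K H H) (\<lambda>X1 X2 X3. tens K H H X1 (counit H X2 \<odot>\<^bsub>H\<^esub> X3)) (reassoc H) =
       tens K H H \<one>\<^bsub>H\<^esub> \<one>\<^bsub>H\<^esub>"


section \<open>Modules and module algebras\<close>

definition left_module ::
    "('k, 'r) ring_scheme \<Rightarrow> ('k, 's, 'x) module_scheme \<Rightarrow> ('k, 'v, 'y) module_scheme \<Rightarrow>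
     ('s \<Rightarrow> 'v \<Rightarrow> 'v) \<Rightarrow> bool"
  where "left_module K S V f \<longleftrightarrow>
    module K V \<and> bilinear_map K S V V f \<and>
    (\<forall>v\<in>carrier V. f \<one>\<^bsub>S\<^esub> v = v) \<and>
    (\<forall>s\<in>carrier S. \<forall>t\<in>carrier S. \<forall>v\<in>carrier V. f (s \<otimes>\<^bsub>S\<^esub> t) v = f s (f t v))"

definition right_module ::
    "('k, 'r) ring_scheme \<Rightarrow> ('k, 's, 'x) module_scheme \<Rightarrow> ('k, 'v, 'y) module_scheme \<Rightarrow>
     ('v \<Rightarrow> 's \<Rightarrow> 'v) \<Rightarrow> bool"
  where "right_module K S V f \<longleftrightarrow>
    module K V \<and> bilinear_map K V S V f \<and>
    (\<forall>v\<in>carrier V. f v \<one>\<^bsub>S\<^esub> = v) \<and>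
    (\<forall>s\<in>carrier S. \<forall>t\<in>carrier S. \<forall>v\<in>carrier V. f v (s \<otimes>\<^bsub>S\<^esub> t) = f (f v s) t)"

text \<open>
  Module algebras over a quasi-bialgebra need not be associative, so their underlying records are
  only required to be \<open>K\<close>-modules with a bilinear multiplication and a two-sided unit.
\<close>

definition unital_mult :: "('k, 'r) ring_scheme \<Rightarrow> ('k, 'a, 'x) module_scheme \<Rightarrow> bool"
  where "unital_mult K A \<longleftrightarrow>
    bilinear_map K A A A (\<lambda>x y. x \<otimes>\<^bsub>A\<^esub> y) \<and> \<one>\<^bsub>A\<^esub> \<in> carrier A \<and>
    (\<forall>a\<in>carrier A. \<one>\<^bsub>A\<^esub> \<otimes>\<^bsub>A\<^esub> a = a \<and> a \<otimes>\<^bsub>A\<^esub> \<one>\<^bsub>A\<^esub> = a)"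

record ('k, 'h, 'a) left_mod_alg = "('k, 'a) module" +
  lact :: "'h \<Rightarrow> 'a \<Rightarrow> 'a"

record ('k, 'h, 'b) right_mod_alg = "('k, 'b) module" +
  ract :: "'b \<Rightarrow> 'h \<Rightarrow> 'b"

definition left_module_algebra ::
    "('k, 'r) ring_scheme \<Rightarrow> ('k, 'h, 'x) quasi_bialg_scheme \<Rightarrow>
     ('k, 'h, 'a, 'y) left_mod_alg_scheme \<Rightarrow> bool"
  where "left_module_algebra K H A \<longleftrightarrow>
    left_module K H A (lact A) \<and> unital_mult K A \<and>
    (\<forall>a\<in>carrier A. \<forall>a'\<in>carrier A. \<forall>a''\<in>carrier A.
      (a \<otimes>\<^bsub>A\<^esub> a') \<otimes>\<^bsub>A\<^esub> a'' =
      tlift3 K A (\<lambda>X1 X2 X3. lact A X1 a \<otimes>\<^bsub>A\<^esub> (lact A X2 a' \<otimes>\<^bsub>A\<^esub> lact A X3 a'')) (reassoc H)) \<and>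
    (\<forall>h\<in>carrier H. \<forall>a\<in>carrier A. \<forall>a'\<in>carrier A.
      lact A h (a \<otimes>\<^bsub>A\<^esub> a') = tlift K A (\<lambda>h1 h2. lact A h1 a \<otimes>\<^bsub>A\<^esub> lact A h2 a') (comul H h)) \<and>
    (\<forall>h\<in>carrier H. lact A h \<one>\<^bsub>A\<^esub> = counit H h \<odot>\<^bsub>A\<^esub> \<one>\<^bsub>A\<^esub>)"

definition right_module_algebra ::
    "('k, 'r) ring_scheme \<Rightarrow> ('k, 'h, 'x) quasi_bialg_scheme \<Rightarrow>
     ('k, 'h, 'b, 'y) right_mod_alg_scheme \<Rightarrow> bool"
  where "right_module_algebra K H B \<longleftrightarrow>
    right_module K H B (ract B) \<and> unital_mult K B \<and>
    (\<forall>b\<in>carrier B. \<forall>b'\<in>carrier B. \<forall>b''\<in>carrier B.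
      (b \<otimes>\<^bsub>B\<^esub> b') \<otimes>\<^bsub>B\<^esub> b'' =
      tlift3 K B (\<lambda>x1 x2 x3. ract B b x1 \<otimes>\<^bsub>B\<^esub> (ract B b' x2 \<otimes>\<^bsub>B\<^esub> ract B b'' x3))
        (reassoc_inv K H)) \<and>
    (\<forall>h\<in>carrier H. \<forall>b\<in>carrier B. \<forall>b'\<in>carrier B.
      ract B (b \<otimes>\<^bsub>B\<^esub> b') h = tlift K B (\<lambda>h1 h2. ract B b h1 \<otimes>\<^bsub>B\<^esub> ract B b' h2) (comul H h)) \<and>
    (\<forall>h\<in>carrier H. ract B \<one>\<^bsub>B\<^esub> h = counit H h \<odot>\<^bsub>B\<^esub> \<one>\<^bsub>B\<^esub>)"


section \<open>The two-sided smash product\<close>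

abbreviation smash_space ::
    "('k, 'r) ring_scheme \<Rightarrow> ('k, 'h, 'x) quasi_bialg_scheme \<Rightarrow>
     ('k, 'h, 'a, 'y) left_mod_alg_scheme \<Rightarrow> ('k, 'h, 'b, 'z) right_mod_alg_scheme \<Rightarrow> _"
  where "smash_space K H A B \<equiv> tensor_space K A (tensor_space K H B)"

text \<open>
  \<open>(a # h # b)(a' # h' # b') =
   (x\<^sup>1 \<cdot> a)(x\<^sup>2 h\<^sub>1 y\<^sup>1 \<cdot> a') # x\<^sup>3 h\<^sub>2 y\<^sup>2 h'\<^sub>1 z\<^sup>1 # (b \<cdot> y\<^sup>3 h'\<^sub>2 z\<^sup>2)(b' \<cdot> z\<^sup>3)\<close>
\<close>

definition smash_mult_pure ::
    "('k, 'r) ring_scheme \<Rightarrow> ('k, 'h, 'x) quasi_bialg_scheme \<Rightarrow>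
     ('k, 'h, 'a, 'y) left_mod_alg_scheme \<Rightarrow> ('k, 'h, 'b, 'z) right_mod_alg_scheme \<Rightarrow>
     'a \<Rightarrow> 'h \<Rightarrow> 'b \<Rightarrow> 'a \<Rightarrow> 'h \<Rightarrow> 'b \<Rightarrow> ('a \<times> ('h \<times> 'b \<Rightarrow> 'k) set \<Rightarrow> 'k) set"
  where "smash_mult_pure K H A B a h b a' h' b' =
    tlift3 K (smash_space K H A B) (\<lambda>x1 x2 x3.
    tlift3 K (smash_space K H A B) (\<lambda>y1 y2 y3.
    tlift3 K (smash_space K H A B) (\<lambda>z1 z2 z3.
    tlift K (smash_space K H A B) (\<lambda>h1 h2.
    tlift K (smash_space K H A B) (\<lambda>h1' h2'.
      tens3 K A H B
        (lact A x1 a \<otimes>\<^bsub>A\<^esub> lact A (x2 \<otimes>\<^bsub>H\<^esub> h1 \<otimes>\<^bsub>H\<^esub> y1) a')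
        (x3 \<otimes>\<^bsub>H\<^esub> h2 \<otimes>\<^bsub>H\<^esub> y2 \<otimes>\<^bsub>H\<^esub> h1' \<otimes>\<^bsub>H\<^esub> z1)
        (ract B b (y3 \<otimes>\<^bsub>H\<^esub> h2' \<otimes>\<^bsub>H\<^esub> z2) \<otimes>\<^bsub>B\<^esub> ract B b' z3))
      (comul H h')) (comul H h))
      (reassoc_inv K H)) (reassoc_inv K H)) (reassoc_inv K H)"

definition smash ::
    "('k, 'r) ring_scheme \<Rightarrow> ('k, 'h, 'x) quasi_bialg_scheme \<Rightarrow>
     ('k, 'h, 'a, 'y) left_mod_alg_scheme \<Rightarrow> ('k, 'h, 'b, 'z) right_mod_alg_scheme \<Rightarrow>
     ('k, ('a \<times> ('h \<times> 'b \<Rightarrow> 'k) set \<Rightarrow> 'k) set) module"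
  where "smash K H A B =
    (smash_space K H A B)
      \<lparr>mult := (\<lambda>s t.
         tlift3 K (smash_space K H A B) (\<lambda>a h b.
           tlift3 K (smash_space K H A B) (\<lambda>a' h' b'.
             smash_mult_pure K H A B a h b a' h' b') t) s),
       one := tens3 K A H B \<one>\<^bsub>A\<^esub> \<one>\<^bsub>H\<^esub> \<one>\<^bsub>B\<^esub>\<rparr>"


section \<open>Categories\<close>

record ('o, 'f) cat =
  Ob :: "'o set"
  Hom :: "'o \<Rightarrow> 'o \<Rightarrow> 'f set"
  Ident :: "'o \<Rightarrow> 'f"
  Comp :: "'o \<Rightarrow> 'o \<Rightarrow> 'o \<Rightarrow> 'f \<Rightarrow> 'f \<Rightarrow> 'f"
    \<comment> \<open>\<open>Comp C X Y Z g f\<close> is the composite of \<open>f : X \<rightarrow> Y\<close> and \<open>g : Y \<rightarrow> Z\<close>\<close>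

definition category :: "('o, 'f) cat \<Rightarrow> bool"
  where "category C \<longleftrightarrow>
    (\<forall>X\<in>Ob C. Ident C X \<in> Hom C X X) \<and>
    (\<forall>X\<in>Ob C. \<forall>Y\<in>Ob C. \<forall>Z\<in>Ob C. \<forall>f\<in>Hom C X Y. \<forall>g\<in>Hom C Y Z. Comp C X Y Z g f \<in> Hom C X Z) \<and>
    (\<forall>X\<in>Ob C. \<forall>Y\<in>Ob C. \<forall>f\<in>Hom C X Y.
      Comp C X Y Y (Ident C Y) f = f \<and> Comp C X X Y f (Ident C X) = f) \<and>
    (\<forall>W\<in>Ob C. \<forall>X\<in>Ob C. \<forall>Y\<in>Ob C. \<forall>Z\<in>Ob C. \<forall>f\<in>Hom C W X. \<forall>g\<in>Hom C X Y. \<forall>h\<in>Hom C Y Z.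
      Comp C W X Z (Comp C X Y Z h g) f = Comp C W Y Z h (Comp C W X Y g f))"

definition is_functor ::
    "('o, 'f) cat \<Rightarrow> ('p, 'g) cat \<Rightarrow> ('o \<Rightarrow> 'p) \<Rightarrow> ('o \<Rightarrow> 'o \<Rightarrow> 'f \<Rightarrow> 'g) \<Rightarrow> bool"
  where "is_functor C D F Fm \<longleftrightarrow>
    (\<forall>X\<in>Ob C. F X \<in> Ob D) \<and>
    (\<forall>X\<in>Ob C. \<forall>Y\<in>Ob C. \<forall>f\<in>Hom C X Y. Fm X Y f \<in> Hom D (F X) (F Y)) \<and>
    (\<forall>X\<in>Ob C. Fm X X (Ident C X) = Ident D (F X)) \<and>
    (\<forall>X\<in>Ob C. \<forall>Y\<in>Ob C. \<forall>Z\<in>Ob C. \<forall>f\<in>Hom C X Y. \<forall>g\<in>Hom C Y Z.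
      Fm X Z (Comp C X Y Z g f) = Comp D (F X) (F Y) (F Z) (Fm Y Z g) (Fm X Y f))"

definition inverse_functors ::
    "('o, 'f) cat \<Rightarrow> ('p, 'g) cat \<Rightarrow>
     ('o \<Rightarrow> 'p) \<Rightarrow> ('o \<Rightarrow> 'o \<Rightarrow> 'f \<Rightarrow> 'g) \<Rightarrow> ('p \<Rightarrow> 'o) \<Rightarrow> ('p \<Rightarrow> 'p \<Rightarrow> 'g \<Rightarrow> 'f) \<Rightarrow> bool"
  where "inverse_functors C D F Fm G Gm \<longleftrightarrow>
    is_functor C D F Fm \<and> is_functor D C G Gm \<and>
    (\<forall>X\<in>Ob C. G (F X) = X) \<and>
    (\<forall>X\<in>Ob C. \<forall>Y\<in>Ob C. \<forall>f\<in>Hom C X Y. Gm (F X) (F Y) (Fm X Y f) = f) \<and>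
    (\<forall>X\<in>Ob D. F (G X) = X) \<and>
    (\<forall>X\<in>Ob D. \<forall>Y\<in>Ob D. \<forall>f\<in>Hom D X Y. Fm (G X) (G Y) (Gm X Y f) = f)"


section \<open>The two module categories\<close>

text \<open>
  Equality of objects must mean equality of the mathematical structures.  HOL functions are total,
  so all operations that are part of an object are fixed to be \<open>undefined\<close> outside the relevant
  carriers, and so are the \<open>mult\<close> and \<open>one\<close> fields that the record type \<open>module\<close> inherits from
  rings.  The underlying sets are arbitrary subsets of an arbitrary type \<open>'m\<close>, which plays the role
  of the universe.
\<close>

definition extensional2 :: "'a set \<Rightarrow> 'b set \<Rightarrow> ('a \<Rightarrow> 'b \<Rightarrow> 'c) set"
  where "extensional2 X Y = {f. f = (\<lambda>x\<in>X. \<lambda>y\<in>Y. f x y)}"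

definition vector_space_object :: "('k, 'r) ring_scheme \<Rightarrow> ('k, 'm) module \<Rightarrow> bool"
  where "vector_space_object K V \<longleftrightarrow>
    module K V \<and>
    add V \<in> extensional2 (carrier V) (carrier V) \<and>
    smult V \<in> extensional2 (carrier K) (carrier V) \<and>
    mult V = undefined \<and> one V = undefined"

record ('k, 's, 'm) lmod =
  lm_space :: "('k, 'm) module"
  lm_act :: "'s \<Rightarrow> 'm \<Rightarrow> 'm"

definition lmod_object ::
    "('k, 'r) ring_scheme \<Rightarrow> ('k, 's, 'x) module_scheme \<Rightarrow> ('k, 's, 'm) lmod \<Rightarrow> bool"
  where "lmod_object K S M \<longleftrightarrow>
    vector_space_object K (lm_space M) \<and>
    lm_act M \<in> extensional2 (carrier S) (carrier (lm_space M)) \<and>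
    left_module K S (lm_space M) (lm_act M)"

definition lmod_hom ::
    "('k, 'r) ring_scheme \<Rightarrow> ('k, 's, 'x) module_scheme \<Rightarrow>
     ('k, 's, 'm) lmod \<Rightarrow> ('k, 's, 'm) lmod \<Rightarrow> ('m \<Rightarrow> 'm) set"
  where "lmod_hom K S M N =
    {f \<in> extensional (carrier (lm_space M)).
      linear_map K (lm_space M) (lm_space N) f \<and>
      (\<forall>s\<in>carrier S. \<forall>m\<in>carrier (lm_space M). f (lm_act M s m) = lm_act N s (f m))}"

text \<open>The category of left modules over the algebra \<open>S\<close>.\<close>

definition lmod_cat ::
    "('k, 'r) ring_scheme \<Rightarrow> ('k, 's, 'x) module_scheme \<Rightarrow> (('k, 's, 'm) lmod, 'm \<Rightarrow> 'm) cat"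
  where "lmod_cat K S =
    \<lparr>Ob = {M. lmod_object K S M},
     Hom = lmod_hom K S,
     Ident = (\<lambda>M. \<lambda>m\<in>carrier (lm_space M). m),
     Comp = (\<lambda>L M N g f. compose (carrier (lm_space L)) g f)\<rparr>"

record ('k, 'h, 'a, 'b, 'm) ahb_mod =
  ahb_space :: "('k, 'm) module"
  ahb_A :: "'a \<Rightarrow> 'm \<Rightarrow> 'm"
  ahb_H :: "'h \<Rightarrow> 'm \<Rightarrow> 'm"
  ahb_B :: "'b \<Rightarrow> 'm \<Rightarrow> 'm"

definition ahb_object ::
    "('k, 'r) ring_scheme \<Rightarrow> ('k, 'h, 'x) quasi_bialg_scheme \<Rightarrow>
     ('k, 'h, 'a, 'y) left_mod_alg_scheme \<Rightarrow> ('k, 'h, 'b, 'z) right_mod_alg_scheme \<Rightarrow>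
     ('k, 'h, 'a, 'b, 'm) ahb_mod \<Rightarrow> bool"
  where "ahb_object K H A B M \<longleftrightarrow>
    (let V = ahb_space M; \<alpha> = ahb_A M; \<eta> = ahb_H M; \<beta> = ahb_B M in
      vector_space_object K V \<and>
      \<alpha> \<in> extensional2 (carrier A) (carrier V) \<and>
      \<eta> \<in> extensional2 (carrier H) (carrier V) \<and>
      \<beta> \<in> extensional2 (carrier B) (carrier V) \<and>
      left_module K H V \<eta> \<and> bilinear_map K A V V \<alpha> \<and> bilinear_map K B V V \<beta> \<and>
      (\<forall>m\<in>carrier V. \<alpha> \<one>\<^bsub>A\<^esub> m = m \<and> \<beta> \<one>\<^bsub>B\<^esub> m = m) \<and>
      (\<forall>a\<in>carrier A. \<forall>a'\<in>carrier A. \<forall>m\<in>carrier V.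
        \<alpha> a (\<alpha> a' m) =
        tlift3 K V (\<lambda>x1 x2 x3. \<alpha> (lact A x1 a \<otimes>\<^bsub>A\<^esub> lact A x2 a') (\<eta> x3 m)) (reassoc_inv K H)) \<and>
      (\<forall>h\<in>carrier H. \<forall>a\<in>carrier A. \<forall>m\<in>carrier V.
        \<eta> h (\<alpha> a m) = tlift K V (\<lambda>h1 h2. \<alpha> (lact A h1 a) (\<eta> h2 m)) (comul H h)) \<and>
      (\<forall>b\<in>carrier B. \<forall>b'\<in>carrier B. \<forall>m\<in>carrier V.
        \<beta> b (\<beta> b' m) =
        tlift3 K V (\<lambda>x1 x2 x3. \<eta> x1 (\<beta> (ract B b x2 \<otimes>\<^bsub>B\<^esub> ract B b' x3) m)) (reassoc_inv K H)) \<and>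
      (\<forall>b\<in>carrier B. \<forall>h\<in>carrier H. \<forall>m\<in>carrier V.
        \<beta> b (\<eta> h m) = tlift K V (\<lambda>h1 h2. \<eta> h1 (\<beta> (ract B b h2) m)) (comul H h)) \<and>
      (\<forall>b\<in>carrier B. \<forall>a\<in>carrier A. \<forall>m\<in>carrier V.
        \<beta> b (\<alpha> a m) =
        tlift3 K V (\<lambda>y1 y2 y3. \<alpha> (lact A y1 a) (\<eta> y2 (\<beta> (ract B b y3) m))) (reassoc_inv K H)))"

definition ahb_hom ::
    "('k, 'r) ring_scheme \<Rightarrow> ('k, 'h, 'x) quasi_bialg_scheme \<Rightarrow>
     ('k, 'h, 'a, 'y) left_mod_alg_scheme \<Rightarrow> ('k, 'h, 'b, 'z) right_mod_alg_scheme \<Rightarrow>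
     ('k, 'h, 'a, 'b, 'm) ahb_mod \<Rightarrow> ('k, 'h, 'a, 'b, 'm) ahb_mod \<Rightarrow> ('m \<Rightarrow> 'm) set"
  where "ahb_hom K H A B M N =
    {f \<in> extensional (carrier (ahb_space M)).
      linear_map K (ahb_space M) (ahb_space N) f \<and>
      (\<forall>h\<in>carrier H. \<forall>m\<in>carrier (ahb_space M). f (ahb_H M h m) = ahb_H N h (f m)) \<and>
      (\<forall>a\<in>carrier A. \<forall>m\<in>carrier (ahb_space M). f (ahb_A M a m) = ahb_A N a (f m)) \<and>
      (\<forall>b\<in>carrier B. \<forall>m\<in>carrier (ahb_space M). f (ahb_B M b m) = ahb_B N b (f m))}"

definition ahb_cat ::
    "('k, 'r) ring_scheme \<Rightarrow> ('k, 'h, 'x) quasi_bialg_scheme \<Rightarrow>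
     ('k, 'h, 'a, 'y) left_mod_alg_scheme \<Rightarrow> ('k, 'h, 'b, 'z) right_mod_alg_scheme \<Rightarrow>
     (('k, 'h, 'a, 'b, 'm) ahb_mod, 'm \<Rightarrow> 'm) cat"
  where "ahb_cat K H A B =
    \<lparr>Ob = {M. ahb_object K H A B M},
     Hom = ahb_hom K H A B,
     Ident = (\<lambda>M. \<lambda>m\<in>carrier (ahb_space M). m),
     Comp = (\<lambda>L M N g f. compose (carrier (ahb_space L)) g f)\<rparr>"


section \<open>The two constructions on objects\<close>

definition smash_to_ahb ::
    "('k, 'r) ring_scheme \<Rightarrow> ('k, 'h, 'x) quasi_bialg_scheme \<Rightarrow>
     ('k, 'h, 'a, 'y) left_mod_alg_scheme \<Rightarrow> ('k, 'h, 'b, 'z) right_mod_alg_scheme \<Rightarrow>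
     ('k, ('a \<times> ('h \<times> 'b \<Rightarrow> 'k) set \<Rightarrow> 'k) set, 'm) lmod \<Rightarrow> ('k, 'h, 'a, 'b, 'm) ahb_mod"
  where "smash_to_ahb K H A B M =
    \<lparr>ahb_space = lm_space M,
     ahb_A = (\<lambda>a\<in>carrier A. \<lambda>m\<in>carrier (lm_space M). lm_act M (tens3 K A H B a \<one>\<^bsub>H\<^esub> \<one>\<^bsub>B\<^esub>) m),
     ahb_H = (\<lambda>h\<in>carrier H. \<lambda>m\<in>carrier (lm_space M). lm_act M (tens3 K A H B \<one>\<^bsub>A\<^esub> h \<one>\<^bsub>B\<^esub>) m),
     ahb_B = (\<lambda>b\<in>carrier B. \<lambda>m\<in>carrier (lm_space M). lm_act M (tens3 K A H B \<one>\<^bsub>A\<^esub> \<one>\<^bsub>H\<^esub> b) m)\<rparr>"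

definition ahb_to_smash ::
    "('k, 'r) ring_scheme \<Rightarrow> ('k, 'h, 'x) quasi_bialg_scheme \<Rightarrow>
     ('k, 'h, 'a, 'y) left_mod_alg_scheme \<Rightarrow> ('k, 'h, 'b, 'z) right_mod_alg_scheme \<Rightarrow>
     ('k, 'h, 'a, 'b, 'm) ahb_mod \<Rightarrow> ('k, ('a \<times> ('h \<times> 'b \<Rightarrow> 'k) set \<Rightarrow> 'k) set, 'm) lmod"
  where "ahb_to_smash K H A B M =
    \<lparr>lm_space = ahb_space M,
     lm_act = (\<lambda>s\<in>carrier (smash K H A B). \<lambda>m\<in>carrier (ahb_space M).
       tlift3 K (ahb_space M) (\<lambda>a h b. ahb_A M a (ahb_H M h (ahb_B M b m))) s)\<rparr>"

end

theory Submission
  imports Defs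
begin

text \<open>
  A module over the smash product is recovered from the three partial actions because
  \<open>a # h # b = (a # 1 # 1) (1 # h # 1) (1 # 1 # b)\<close>.  Given compatible weak actions, rewriting
  \<open>a \<cdot> (h \<triangleright> (b \<cdot> (a' \<cdot> (h' \<triangleright> (b' \<cdot> m)))))\<close> from left to right with the five relations produces
  exactly the product formula of \<open>A # H # B\<close>.  Conversely each relation is the value of a product
  such as \<open>(1 # 1 # b) (a # 1 # 1)\<close>; these are computed by letting the counit act on the legs of
  \<open>\<Phi>\<^sup>-\<^sup>1\<close>, which is trivial on all three legs as a consequence of the pentagon.
\<close>


section \<open>Linear maps\<close>

text \<open>Sweedler notation hides the main burden: \<open>tlift\<close> has its intended value
  only for a bilinear summand, so each exchange of sums and each linear map pulled through a sum
  carries a multilinearity condition on everything inside. Most equalities of sums are reduced to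
  pure tensors by linearity. The product is written once, with a parameter \<tau> for what is done
  with its three resulting components. Tensoring them gives the algebra, letting them act on m gives
  the module, and a linear map carries the first sum to the second; both directions of the theorem
  share this one sum. The counit enters because H acts on the units of A and B through \<epsilon>: a
  unit in an argument of the product puts \<epsilon> on a leg of a copy of \<open>\<Psi>\<close>.
  The axiom covers the middle leg only. For an outer leg, \<epsilon> is applied to an inner factor
  of the pentagon; the axioms evaluate every factor except one, and invertibility of \<Phi> forces
  that one to be 1.\<close>

lemma linear_mapI:
  assumes "\<And>x. x \<in> carrier V \<Longrightarrow> f x \<in> carrier W"
    and "\<And>x y. x \<in> carrier V \<Longrightarrow> y \<in> carrier V \<Longrightarrow> f (x \<oplus>\<^bsub>V\<^esub> y) = f x \<oplus>\<^bsub>W\<^esub> f y"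
    and "\<And>c x. c \<in> carrier K \<Longrightarrow> x \<in> carrier V \<Longrightarrow> f (c \<odot>\<^bsub>V\<^esub> x) = c \<odot>\<^bsub>W\<^esub> f x"
  shows "linear_map K V W f"
  using assms by (auto simp: linear_map_def)

lemma
  assumes "linear_map K V W f"
  shows linear_map_closed: "x \<in> carrier V \<Longrightarrow> f x \<in> carrier W"
    and linear_map_add: "x \<in> carrier V \<Longrightarrow> y \<in> carrier V \<Longrightarrow> f (x \<oplus>\<^bsub>V\<^esub> y) = f x \<oplus>\<^bsub>W\<^esub> f y"
    and linear_map_smult: "c \<in> carrier K \<Longrightarrow> x \<in> carrier V \<Longrightarrow> f (c \<odot>\<^bsub>V\<^esub> x) = c \<odot>\<^bsub>W\<^esub> f x"
  using assms by (auto simp: linear_map_def)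

lemma linear_map_zero:
  assumes "module K V" "module K W" "linear_map K V W f"
  shows "f \<zero>\<^bsub>V\<^esub> = \<zero>\<^bsub>W\<^esub>"
proof -
  interpret V: module K V by fact
  interpret W: module K W by fact
  have "f (\<zero>\<^bsub>K\<^esub> \<odot>\<^bsub>V\<^esub> \<zero>\<^bsub>V\<^esub>) = \<zero>\<^bsub>K\<^esub> \<odot>\<^bsub>W\<^esub> f \<zero>\<^bsub>V\<^esub>"
    by (rule linear_map_smult[OF assms(3)]) auto
  then show ?thesis using linear_map_closed[OF assms(3), of "\<zero>\<^bsub>V\<^esub>"] by simp
qed

lemma linear_map_cong:
  assumes "linear_map K V W f" "module K V" "\<And>x. x \<in> carrier V \<Longrightarrow> f x = g x"
  shows "linear_map K V W g"
proof -
  interpret V: module K V by fact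
  show ?thesis
    by (rule linear_mapI)
      (use linear_map_closed[OF assms(1)] linear_map_add[OF assms(1)] linear_map_smult[OF assms(1)] assms(3)
        in auto)
qed

lemma linear_map_comp:
  assumes "linear_map K V W f" "linear_map K U V g"
  shows "linear_map K U W (\<lambda>u. f (g u))"
  using assms by (auto simp: linear_map_def Pi_iff)

lemma linear_map_ident: "linear_map K V V (\<lambda>x. x)"
  by (simp add: linear_map_def)

lemma bilinear_mapI:
  assumes "\<And>u. u \<in> carrier U \<Longrightarrow> linear_map K V W (f u)"
    and "\<And>v. v \<in> carrier V \<Longrightarrow> linear_map K U W (\<lambda>u. f u v)"
  shows "bilinear_map K U V W f"
  using assms by (auto simp: bilinear_map_def)

lemma
  assumes "bilinear_map K U V W f"
  shows bilinear_map_right: "u \<in> carrier U \<Longrightarrow> linear_map K V W (f u)"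
    and bilinear_map_left: "v \<in> carrier V \<Longrightarrow> linear_map K U W (\<lambda>u. f u v)"
    and bilinear_map_closed: "u \<in> carrier U \<Longrightarrow> v \<in> carrier V \<Longrightarrow> f u v \<in> carrier W"
  using assms by (auto simp: bilinear_map_def linear_map_def)

lemma bilinear_map_comp:
  assumes "linear_map K W W' g" "bilinear_map K U V W f"
  shows "bilinear_map K U V W' (\<lambda>u v. g (f u v))"
  using assms by (auto simp: bilinear_map_def intro: linear_map_comp)

lemma bilinear_map_cong:
  assumes "bilinear_map K U V W f" "module K U" "module K V"
    "\<And>u v. u \<in> carrier U \<Longrightarrow> v \<in> carrier V \<Longrightarrow> f u v = g u v"
  shows "bilinear_map K U V W g"
  using assms by (auto simp: bilinear_map_def intro: linear_map_cong)


section \<open>Free modules\<close>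

lemma module_free_module:
  assumes "cring K"
  shows "module K (free_module K X)"
proof -
  interpret K: cring K by fact
  have fin: "finite {i. p i \<oplus>\<^bsub>K\<^esub> q i \<noteq> \<zero>\<^bsub>K\<^esub>}"
    if "\<forall>i. p i \<in> carrier K" "finite {i. p i \<noteq> \<zero>\<^bsub>K\<^esub>}"
      "\<forall>i. q i \<in> carrier K" "finite {i. q i \<noteq> \<zero>\<^bsub>K\<^esub>}" for p q :: "_ \<Rightarrow> _"
    by (rule finite_subset[of _ "{i. p i \<noteq> \<zero>\<^bsub>K\<^esub>} \<union> {i. q i \<noteq> \<zero>\<^bsub>K\<^esub>}"]) (use that in auto)
  have fin': "finite {i. c \<otimes>\<^bsub>K\<^esub> p i \<noteq> \<zero>\<^bsub>K\<^esub>}"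
    if "c \<in> carrier K" "\<forall>i. p i \<in> carrier K" "finite {i. p i \<noteq> \<zero>\<^bsub>K\<^esub>}" for c and p :: "_ \<Rightarrow> _"
    by (rule finite_subset[of _ "{i. p i \<noteq> \<zero>\<^bsub>K\<^esub>}"]) (use that in auto)
  have supp: "i \<in> X"
    if "p i \<oplus>\<^bsub>K\<^esub> q i \<noteq> \<zero>\<^bsub>K\<^esub>" "\<forall>i. p i \<noteq> \<zero>\<^bsub>K\<^esub> \<longrightarrow> i \<in> X" "\<forall>i. q i \<noteq> \<zero>\<^bsub>K\<^esub> \<longrightarrow> i \<in> X" for p q i
    using that by (metis K.l_zero K.zero_closed)
  have supp': "i \<in> X"
    if "c \<otimes>\<^bsub>K\<^esub> p i \<noteq> \<zero>\<^bsub>K\<^esub>" "c \<in> carrier K" "\<forall>i. p i \<noteq> \<zero>\<^bsub>K\<^esub> \<longrightarrow> i \<in> X" for c p i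
    using that by (metis K.r_null)
  show ?thesis
  proof (rule moduleI)
    show "abelian_group (free_module K X)"
    proof (rule abelian_groupI)
      fix p assume p: "p \<in> carrier (free_module K X)"
      have "(\<lambda>i. \<ominus>\<^bsub>K\<^esub> p i) \<in> carrier (free_module K X)"
      proof -
        have "{i. \<ominus>\<^bsub>K\<^esub> p i \<noteq> \<zero>\<^bsub>K\<^esub>} \<subseteq> {i. p i \<noteq> \<zero>\<^bsub>K\<^esub>}" by auto
        then show ?thesis using p by (auto simp: free_module_def intro: finite_subset)
      qed
      then show "\<exists>q\<in>carrier (free_module K X). q \<oplus>\<^bsub>free_module K X\<^esub> p = \<zero>\<^bsub>free_module K X\<^esub>"
        by (rule bexI[rotated]) (use p in \<open>auto simp: free_module_def K.l_neg\<close>)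
    qed (auto simp: free_module_def K.a_ac fin subset_iff dest: supp)
  qed (use assms in \<open>auto simp: free_module_def fin' K.l_distr K.r_distr K.m_assoc subset_iff dest: supp'\<close>)
qed

lemma free_gen_closed: "cring K \<Longrightarrow> i \<in> X \<Longrightarrow> free_gen K i \<in> carrier (free_module K X)"
proof -
  assume K: "cring K" and i: "i \<in> X"
  interpret K: cring K by fact
  have "{j. free_gen K i j \<noteq> \<zero>\<^bsub>K\<^esub>} \<subseteq> {i}" by (auto simp: free_gen_def)
  then show ?thesis using i finite_subset by (fastforce simp: free_module_def free_gen_def)
qed

text \<open>Induction on the finite support: setting one coordinate to zero splits off a multiple of
  a basis vector and leaves a vector with smaller support.\<close>

lemma free_module_induct [consumes 2, case_names zero add]:
  assumes K: "cring K" and p: "p \<in> carrier (free_module K X)"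
    and z: "P \<zero>\<^bsub>free_module K X\<^esub>"
    and a: "\<And>c i q. c \<in> carrier K \<Longrightarrow> i \<in> X \<Longrightarrow> q \<in> carrier (free_module K X) \<Longrightarrow> P q \<Longrightarrow>
      P ((c \<odot>\<^bsub>free_module K X\<^esub> free_gen K i) \<oplus>\<^bsub>free_module K X\<^esub> q)"
  shows "P p"
proof -
  interpret K: cring K by fact
  have "finite S \<Longrightarrow> p \<in> carrier (free_module K X) \<Longrightarrow> {i. p i \<noteq> \<zero>\<^bsub>K\<^esub>} = S \<Longrightarrow> P p" for S p
  proof (induction S arbitrary: p rule: finite_induct)
    case empty
    then have "p = \<zero>\<^bsub>free_module K X\<^esub>" by (auto simp: free_module_def)
    then show ?case using z by simp
  next
    case (insert i S)
    define q where "q = p(i := \<zero>\<^bsub>K\<^esub>)"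
    have supp: "{j. q j \<noteq> \<zero>\<^bsub>K\<^esub>} = S" using insert by (auto simp: q_def)
    have q: "q \<in> carrier (free_module K X)"
      using insert.prems insert.hyps supp by (auto simp: free_module_def q_def split: if_splits)
    have "p = (p i \<odot>\<^bsub>free_module K X\<^esub> free_gen K i) \<oplus>\<^bsub>free_module K X\<^esub> q"
      using insert.prems(1) by (auto simp: free_module_def free_gen_def q_def)
    moreover have "p i \<in> carrier K" "i \<in> X" using insert.prems by (auto simp: free_module_def)
    ultimately show ?case using a[OF _ _ q insert.IH[OF q supp]] by metis
  qed
  then show ?thesis using p by (auto simp: free_module_def)
qed

text \<open>The linear extension of \<open>f\<close> from the basis. It is the sum inside
  \<open>tlift\<close> for a single representative \<open>p\<close>, isolated so that the universal
  property of free modules applies to it.\<close>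

definition free_lift ::
    "('k, 'r) ring_scheme \<Rightarrow> ('k, 'v, 'x) module_scheme \<Rightarrow> ('i \<Rightarrow> 'v) \<Rightarrow> ('i \<Rightarrow> 'k) \<Rightarrow> 'v"
  where "free_lift K V f p = (\<Oplus>\<^bsub>V\<^esub>i\<in>{i. p i \<noteq> \<zero>\<^bsub>K\<^esub>}. p i \<odot>\<^bsub>V\<^esub> f i)"

text \<open>Coefficients outside the support are zero. A common larger index set serves additivity,
  since cancellation can make the support of a sum smaller than the union of the supports.\<close>

lemma free_lift_superset:
  assumes "module K V" "p \<in> carrier (free_module K X)" "f \<in> X \<rightarrow> carrier V"
    "finite S" "{i. p i \<noteq> \<zero>\<^bsub>K\<^esub>} \<subseteq> S" "S \<subseteq> X"
  shows "free_lift K V f p = (\<Oplus>\<^bsub>V\<^esub>i\<in>S. p i \<odot>\<^bsub>V\<^esub> f i)"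
proof -
  interpret V: module K V by fact
  show ?thesis unfolding free_lift_def
    by (rule V.add.finprod_mono_neutral_cong_left)
      (use assms in \<open>auto simp: free_module_def subset_iff Pi_iff\<close>)
qed

lemma free_lift_linear:
  assumes V: "module K V" and f: "f \<in> X \<rightarrow> carrier V"
  shows "linear_map K (free_module K X) V (free_lift K V f)"
proof -
  interpret V: module K V by fact
  interpret F: module K "free_module K X" by (rule module_free_module) (rule V.is_cring)
  show ?thesis
  proof (rule linear_mapI)
    fix p assume p: "p \<in> carrier (free_module K X)"
    then show "free_lift K V f p \<in> carrier V"
      unfolding free_lift_def using f
      by (intro V.finsum_closed) (auto simp: free_module_def subset_iff Pi_iff)
    fix q assume q: "q \<in> carrier (free_module K X)"
    define S where "S = {i. p i \<noteq> \<zero>\<^bsub>K\<^esub>} \<union> {i. q i \<noteq> \<zero>\<^bsub>K\<^esub>}"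
    have S: "finite S" "S \<subseteq> X" "{i. p i \<noteq> \<zero>\<^bsub>K\<^esub>} \<subseteq> S" "{i. q i \<noteq> \<zero>\<^bsub>K\<^esub>} \<subseteq> S"
      using p q by (auto simp: S_def free_module_def)
    have S': "{i. (p \<oplus>\<^bsub>free_module K X\<^esub> q) i \<noteq> \<zero>\<^bsub>K\<^esub>} \<subseteq> S"
      by (auto simp: S_def free_module_def)
    have "free_lift K V f (p \<oplus>\<^bsub>free_module K X\<^esub> q) =
        (\<Oplus>\<^bsub>V\<^esub>i\<in>S. (p \<oplus>\<^bsub>free_module K X\<^esub> q) i \<odot>\<^bsub>V\<^esub> f i)"
      by (rule free_lift_superset) (use p q f V S S' in auto)
    also have "\<dots> = (\<Oplus>\<^bsub>V\<^esub>i\<in>S. p i \<odot>\<^bsub>V\<^esub> f i \<oplus>\<^bsub>V\<^esub> q i \<odot>\<^bsub>V\<^esub> f i)"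
      by (rule V.finsum_cong')
        (use p q f S in \<open>auto simp: free_module_def V.smult_l_distr subset_iff Pi_iff\<close>)
    also have "\<dots> = (\<Oplus>\<^bsub>V\<^esub>i\<in>S. p i \<odot>\<^bsub>V\<^esub> f i) \<oplus>\<^bsub>V\<^esub> (\<Oplus>\<^bsub>V\<^esub>i\<in>S. q i \<odot>\<^bsub>V\<^esub> f i)"
      by (rule V.finsum_addf) (use p q f S in \<open>auto simp: free_module_def subset_iff Pi_iff\<close>)
    also have "\<dots> = free_lift K V f p \<oplus>\<^bsub>V\<^esub> free_lift K V f q"
      using p q f V S by (simp add: free_lift_superset)
    finally show "free_lift K V f (p \<oplus>\<^bsub>free_module K X\<^esub> q) = free_lift K V f p \<oplus>\<^bsub>V\<^esub> free_lift K V f q" .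
  next
    fix c p assume c: "c \<in> carrier K" and p: "p \<in> carrier (free_module K X)"
    define S where "S = {i. p i \<noteq> \<zero>\<^bsub>K\<^esub>}"
    have S: "finite S" "S \<subseteq> X" using p by (auto simp: S_def free_module_def)
    have S': "{i. (c \<odot>\<^bsub>free_module K X\<^esub> p) i \<noteq> \<zero>\<^bsub>K\<^esub>} \<subseteq> S"
      using c by (auto simp: S_def free_module_def)
    have "free_lift K V f (c \<odot>\<^bsub>free_module K X\<^esub> p) =
        (\<Oplus>\<^bsub>V\<^esub>i\<in>S. (c \<odot>\<^bsub>free_module K X\<^esub> p) i \<odot>\<^bsub>V\<^esub> f i)"
      by (rule free_lift_superset) (use p c f V S S' in auto)
    also have "\<dots> = (\<Oplus>\<^bsub>V\<^esub>i\<in>S. c \<odot>\<^bsub>V\<^esub> (p i \<odot>\<^bsub>V\<^esub> f i))"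
      by (rule V.finsum_cong')
        (use p c f S in \<open>auto simp: free_module_def V.smult_assoc1 subset_iff Pi_iff\<close>)
    also have "\<dots> = c \<odot>\<^bsub>V\<^esub> (\<Oplus>\<^bsub>V\<^esub>i\<in>S. p i \<odot>\<^bsub>V\<^esub> f i)"
      by (rule V.finsum_smult_ldistr[symmetric])
        (use p c f S in \<open>auto simp: free_module_def subset_iff Pi_iff\<close>)
    also have "\<dots> = c \<odot>\<^bsub>V\<^esub> free_lift K V f p" by (simp add: S_def free_lift_def)
    finally show "free_lift K V f (c \<odot>\<^bsub>free_module K X\<^esub> p) = c \<odot>\<^bsub>V\<^esub> free_lift K V f p" .
  qed
qed

lemma free_lift_gen:
  assumes V: "module K V" and f: "f \<in> X \<rightarrow> carrier V" and i: "i \<in> X"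
  shows "free_lift K V f (free_gen K i) = f i"
proof -
  interpret V: module K V by fact
  have "free_lift K V f (free_gen K i) = (\<Oplus>\<^bsub>V\<^esub>j\<in>{i}. free_gen K i j \<odot>\<^bsub>V\<^esub> f j)"
    by (rule free_lift_superset[OF V free_gen_closed[OF V.is_cring i] f])
      (use i in \<open>auto simp: free_gen_def\<close>)
  also have "\<dots> = f i" using f i by (auto simp: free_gen_def Pi_iff)
  finally show ?thesis .
qed


section \<open>The tensor product space\<close>

locale tensor_pair = A: module K A + B: module K B
  for K :: "('k, 'r) ring_scheme" (structure) and A :: "('k, 'a, 'x) module_scheme"
    and B :: "('k, 'b, 'y) module_scheme"
begin

abbreviation "F \<equiv> free_module K (carrier A \<times> carrier B)"
abbreviation "N \<equiv> tensor_null K A B"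
abbreviation "T \<equiv> tensor_space K A B"

sublocale F: module K F
  by (rule module_free_module) (rule A.is_cring)

lemma free_gen_in [simp]: "a \<in> carrier A \<Longrightarrow> b \<in> carrier B \<Longrightarrow> free_gen K (a, b) \<in> carrier F"
  by (rule free_gen_closed) (use A.is_cring in auto)

lemma relators_closed: "tensor_relators K A B \<subseteq> carrier F"
  unfolding tensor_relators_def Let_def by auto

lemma null_submodule: "submodule N K F"
proof (rule F.submoduleI)
  \<comment> \<open>The whole free module is one of the submodules intersected in
    \<open>tensor_null\<close>, which confines the intersection to \<open>carrier F\<close>.\<close>
  have *: "submodule (carrier F) K F \<and> tensor_relators K A B \<subseteq> carrier F"
    using F.carrier_is_submodule relators_closed by blast
  then show "N \<subseteq> carrier F" unfolding tensor_null_def by blast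
  have Z: "\<zero>\<^bsub>F\<^esub> \<in> M" if "submodule M K F" for M
    using that unfolding submodule_def by (metis subgroup.one_closed monoid.select_convs(2))
  show "\<zero>\<^bsub>F\<^esub> \<in> N" unfolding tensor_null_def using Z by blast
qed (unfold tensor_null_def, (blast dest: F.submoduleE)+)

sublocale N: abelian_subgroup N F
proof (rule abelian_subgroupI3)
  show "additive_subgroup N F"
    using null_submodule by (simp add: additive_subgroup_def submodule_def)
qed (rule F.abelian_group_axioms)

lemma relators_null: "tensor_relators K A B \<subseteq> N"
  unfolding tensor_null_def by blast

lemma null_smult: "c \<in> carrier K \<Longrightarrow> n \<in> N \<Longrightarrow> c \<odot>\<^bsub>F\<^esub> n \<in> N"
  using F.submoduleE(4)[OF null_submodule] by blast

lemma carrier_T: "carrier T = a_rcosets\<^bsub>F\<^esub> N"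
  by (simp add: tensor_space_def Let_def)

lemma carrier_T_cases:
  assumes "t \<in> carrier T" obtains p where "p \<in> carrier F" "t = N +>\<^bsub>F\<^esub> p"
  using assms by (auto simp: carrier_T A_RCOSETS_def' )

lemma coset_closed [simp]: "p \<in> carrier F \<Longrightarrow> N +>\<^bsub>F\<^esub> p \<in> carrier T"
  by (simp add: carrier_T F.a_rcosetsI N.a_subset)

lemma coset_mem_closed: "t \<in> carrier T \<Longrightarrow> p \<in> t \<Longrightarrow> p \<in> carrier F"
  using N.a_rcosets_carrier by (auto simp: carrier_T)

lemma coset_add: "p \<in> carrier F \<Longrightarrow> q \<in> carrier F \<Longrightarrow>
    (N +>\<^bsub>F\<^esub> p) \<oplus>\<^bsub>T\<^esub> (N +>\<^bsub>F\<^esub> q) = N +>\<^bsub>F\<^esub> (p \<oplus>\<^bsub>F\<^esub> q)"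
  by (simp add: tensor_space_def Let_def N.a_rcos_sum)

lemma coset_eqI:
  assumes "p \<in> carrier F" "q \<in> carrier F" "p \<ominus>\<^bsub>F\<^esub> q \<in> N"
  shows "N +>\<^bsub>F\<^esub> p = N +>\<^bsub>F\<^esub> q"
proof -
  have "p \<in> N +>\<^bsub>F\<^esub> q" using assms by (intro N.a_rcos_module_rev) (auto simp: a_minus_def)
  then show ?thesis using assms F.a_repr_independence'[of p N q] N.additive_subgroup_axioms
    by (metis F.a_repr_independence additive_subgroup_def)
qed

text \<open>The scalar action is encoded as a union over all representatives. Two representatives
  differ by an element of \<open>N\<close>, which scalars preserve, so all cosets in the union
  coincide.\<close>

lemma coset_smult:
  assumes c: "c \<in> carrier K" and p: "p \<in> carrier F"
  shows "c \<odot>\<^bsub>T\<^esub> (N +>\<^bsub>F\<^esub> p) = N +>\<^bsub>F\<^esub> (c \<odot>\<^bsub>F\<^esub> p)"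
proof -
  have "N +>\<^bsub>F\<^esub> (c \<odot>\<^bsub>F\<^esub> q) = N +>\<^bsub>F\<^esub> (c \<odot>\<^bsub>F\<^esub> p)" if q: "q \<in> N +>\<^bsub>F\<^esub> p" for q
  proof (rule coset_eqI)
    obtain n where n: "n \<in> N" "q = n \<oplus>\<^bsub>F\<^esub> p" using q by (auto simp: a_r_coset_def')
    then have nF: "n \<in> carrier F" by simp
    have "c \<odot>\<^bsub>F\<^esub> q \<ominus>\<^bsub>F\<^esub> c \<odot>\<^bsub>F\<^esub> p = c \<odot>\<^bsub>F\<^esub> n"
      using n nF c p by (simp add: F.smult_r_distr a_minus_def F.a_assoc F.r_neg)
    then show "c \<odot>\<^bsub>F\<^esub> q \<ominus>\<^bsub>F\<^esub> c \<odot>\<^bsub>F\<^esub> p \<in> N" using null_smult[OF c n(1)] by simp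
    show "c \<odot>\<^bsub>F\<^esub> q \<in> carrier F" using n nF c p by simp
  qed (use c p in auto)
  moreover have "p \<in> N +>\<^bsub>F\<^esub> p" using p by (rule N.a_rcos_self)
  ultimately have "(\<Union>q\<in>N +>\<^bsub>F\<^esub> p. N +>\<^bsub>F\<^esub> (c \<odot>\<^bsub>F\<^esub> q)) = N +>\<^bsub>F\<^esub> (c \<odot>\<^bsub>F\<^esub> p)" by blast
  then show ?thesis by (simp add: tensor_space_def Let_def)
qed

lemma coset_zero: "\<zero>\<^bsub>T\<^esub> = N +>\<^bsub>F\<^esub> \<zero>\<^bsub>F\<^esub>"
proof -
  have "N +>\<^bsub>F\<^esub> \<zero>\<^bsub>F\<^esub> = N" by (rule F.a_coset_add_zero) (rule N.a_subset)
  then show ?thesis by (simp add: tensor_space_def Let_def)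
qed

lemma module_T: "module K T"
proof (rule moduleI)
  show "abelian_group T"
  proof (rule abelian_groupI)
    show "\<zero>\<^bsub>T\<^esub> \<in> carrier T" by (simp add: coset_zero)
    fix s assume "s \<in> carrier T"
    then obtain p where p: "p \<in> carrier F" "s = N +>\<^bsub>F\<^esub> p" by (rule carrier_T_cases)
    show "\<zero>\<^bsub>T\<^esub> \<oplus>\<^bsub>T\<^esub> s = s" using p by (simp add: coset_zero coset_add)
    show "\<exists>u\<in>carrier T. u \<oplus>\<^bsub>T\<^esub> s = \<zero>\<^bsub>T\<^esub>"
      by (rule bexI[of _ "N +>\<^bsub>F\<^esub> (\<ominus>\<^bsub>F\<^esub> p)"]) (use p in \<open>auto simp: coset_zero coset_add F.l_neg\<close>)
    fix t assume "t \<in> carrier T"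
    then obtain q where q: "q \<in> carrier F" "t = N +>\<^bsub>F\<^esub> q" by (rule carrier_T_cases)
    show "s \<oplus>\<^bsub>T\<^esub> t \<in> carrier T" using p q by (simp add: coset_add)
    show "s \<oplus>\<^bsub>T\<^esub> t = t \<oplus>\<^bsub>T\<^esub> s" using p q by (simp add: coset_add F.a_comm)
    fix u assume "u \<in> carrier T"
    then obtain r where r: "r \<in> carrier F" "u = N +>\<^bsub>F\<^esub> r" by (rule carrier_T_cases)
    show "s \<oplus>\<^bsub>T\<^esub> t \<oplus>\<^bsub>T\<^esub> u = s \<oplus>\<^bsub>T\<^esub> (t \<oplus>\<^bsub>T\<^esub> u)" using p q r by (simp add: coset_add F.a_assoc)
  qed
  fix s assume "s \<in> carrier T"
  then obtain p where p: "p \<in> carrier F" "s = N +>\<^bsub>F\<^esub> p" by (rule carrier_T_cases)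
  show "\<one> \<odot>\<^bsub>T\<^esub> s = s" using p by (simp add: coset_smult)
  fix c assume c: "c \<in> carrier K"
  show "c \<odot>\<^bsub>T\<^esub> s \<in> carrier T" using c p by (simp add: coset_smult)
  { fix t assume "t \<in> carrier T"
    then obtain q where q: "q \<in> carrier F" "t = N +>\<^bsub>F\<^esub> q" by (rule carrier_T_cases)
    show "c \<odot>\<^bsub>T\<^esub> (s \<oplus>\<^bsub>T\<^esub> t) = c \<odot>\<^bsub>T\<^esub> s \<oplus>\<^bsub>T\<^esub> c \<odot>\<^bsub>T\<^esub> t"
      using c p q by (simp add: coset_smult coset_add F.smult_r_distr) }
  fix d assume d: "d \<in> carrier K"
  show "(c \<oplus> d) \<odot>\<^bsub>T\<^esub> s = c \<odot>\<^bsub>T\<^esub> s \<oplus>\<^bsub>T\<^esub> d \<odot>\<^bsub>T\<^esub> s"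
    using c d p by (simp add: coset_smult coset_add F.smult_l_distr)
  show "c \<otimes> d \<odot>\<^bsub>T\<^esub> s = c \<odot>\<^bsub>T\<^esub> (d \<odot>\<^bsub>T\<^esub> s)"
    using c d p by (simp add: coset_smult coset_add F.smult_assoc1)
qed (rule A.is_cring)

sublocale T: module K T by (rule module_T)

lemma tens_coset: "tens K A B a b = N +>\<^bsub>F\<^esub> free_gen K (a, b)"
  by (simp add: tens_def)

lemma tens_bilinear: "bilinear_map K A B T (tens K A B)"
proof (intro bilinear_mapI linear_mapI)
  fix a b assume a: "a \<in> carrier A" and b: "b \<in> carrier B"
  then show "tens K A B a b \<in> carrier T" "tens K A B a b \<in> carrier T" by (simp_all add: tens_coset)
  { fix b' assume b': "b' \<in> carrier B"
    have "free_gen K (a, b \<oplus>\<^bsub>B\<^esub> b') \<ominus>\<^bsub>F\<^esub> (free_gen K (a, b) \<oplus>\<^bsub>F\<^esub> free_gen K (a, b')) \<in> N"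
      by (rule subsetD[OF relators_null], unfold tensor_relators_def Let_def) (use a b b' in blast)
    then show "tens K A B a (b \<oplus>\<^bsub>B\<^esub> b') = tens K A B a b \<oplus>\<^bsub>T\<^esub> tens K A B a b'"
      using a b b' by (simp add: tens_coset coset_add coset_eqI) }
  { fix a' assume a': "a' \<in> carrier A"
    have "free_gen K (a \<oplus>\<^bsub>A\<^esub> a', b) \<ominus>\<^bsub>F\<^esub> (free_gen K (a, b) \<oplus>\<^bsub>F\<^esub> free_gen K (a', b)) \<in> N"
      by (rule subsetD[OF relators_null], unfold tensor_relators_def Let_def) (use a b a' in blast)
    then show "tens K A B (a \<oplus>\<^bsub>A\<^esub> a') b = tens K A B a b \<oplus>\<^bsub>T\<^esub> tens K A B a' b"
      using a b a' by (simp add: tens_coset coset_add coset_eqI) }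
  fix c assume c: "c \<in> carrier K"
  have "free_gen K (a, c \<odot>\<^bsub>B\<^esub> b) \<ominus>\<^bsub>F\<^esub> (c \<odot>\<^bsub>F\<^esub> free_gen K (a, b)) \<in> N"
    by (rule subsetD[OF relators_null], unfold tensor_relators_def Let_def) (use a b c in blast)
  then show "tens K A B a (c \<odot>\<^bsub>B\<^esub> b) = c \<odot>\<^bsub>T\<^esub> tens K A B a b"
    using a b c by (simp add: tens_coset coset_smult coset_eqI)
  have "free_gen K (c \<odot>\<^bsub>A\<^esub> a, b) \<ominus>\<^bsub>F\<^esub> (c \<odot>\<^bsub>F\<^esub> free_gen K (a, b)) \<in> N"
    by (rule subsetD[OF relators_null], unfold tensor_relators_def Let_def) (use a b c in blast)
  then show "tens K A B (c \<odot>\<^bsub>A\<^esub> a) b = c \<odot>\<^bsub>T\<^esub> tens K A B a b"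
    using a b c by (simp add: tens_coset coset_smult coset_eqI)
qed

text \<open>Two cases suffice: a scalar is absorbed into the first factor, and zero is itself the
  pure tensor 0 \<otimes> 0.\<close>

lemma tensor_space_induct [consumes 1, case_names tens add]:
  assumes t: "t \<in> carrier T"
    and P: "\<And>a b. a \<in> carrier A \<Longrightarrow> b \<in> carrier B \<Longrightarrow> P (tens K A B a b)"
    and add: "\<And>s t. s \<in> carrier T \<Longrightarrow> t \<in> carrier T \<Longrightarrow> P s \<Longrightarrow> P t \<Longrightarrow> P (s \<oplus>\<^bsub>T\<^esub> t)"
  shows "P t"
proof -
  have "P (N +>\<^bsub>F\<^esub> p)" if "p \<in> carrier F" for p
    using A.is_cring that
  proof (induction rule: free_module_induct)
    case zero
    have "\<zero> \<odot>\<^bsub>T\<^esub> tens K A B \<zero>\<^bsub>A\<^esub> \<zero>\<^bsub>B\<^esub> = tens K A B (\<zero> \<odot>\<^bsub>A\<^esub> \<zero>\<^bsub>A\<^esub>) \<zero>\<^bsub>B\<^esub>"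
      using linear_map_smult[OF bilinear_map_left[OF tens_bilinear], of "\<zero>\<^bsub>B\<^esub>" \<zero> "\<zero>\<^bsub>A\<^esub>"] by simp
    then have "\<zero>\<^bsub>T\<^esub> = tens K A B \<zero>\<^bsub>A\<^esub> \<zero>\<^bsub>B\<^esub>" using bilinear_map_closed[OF tens_bilinear] by simp
    then show ?case using P by (simp add: coset_zero[symmetric])
  next
    case (add c i q)
    obtain a b where i: "i = (a, b)" "a \<in> carrier A" "b \<in> carrier B" using add.hyps by blast
    have "N +>\<^bsub>F\<^esub> (c \<odot>\<^bsub>F\<^esub> free_gen K i) = tens K A B (c \<odot>\<^bsub>A\<^esub> a) b"
      using linear_map_smult[OF bilinear_map_left[OF tens_bilinear], of b c a] i add.hyps
      by (simp add: tens_coset coset_smult)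
    then have "P (N +>\<^bsub>F\<^esub> (c \<odot>\<^bsub>F\<^esub> free_gen K i))" using P i add.hyps by simp
    then have "P ((N +>\<^bsub>F\<^esub> (c \<odot>\<^bsub>F\<^esub> free_gen K i)) \<oplus>\<^bsub>T\<^esub> (N +>\<^bsub>F\<^esub> q))"
      using i add.hyps add.IH by (intro assms(3)) auto
    then show ?case using i add.hyps by (simp add: coset_add)
  qed
  then show ?thesis using t by (metis carrier_T_cases)
qed

text \<open>Well-definedness of Sweedler sums. The kernel of the linear extension is a submodule,
  and bilinearity of \<open>f\<close> puts every relator into it, hence also \<open>N\<close>; the
  set under \<open>the_elem\<close> is then a singleton.\<close>

lemma tlift_coset:
  assumes V: "module K V" and f: "bilinear_map K A B V f" and p: "p \<in> carrier F"
  shows "tlift K V f (N +>\<^bsub>F\<^esub> p) = free_lift K V (\<lambda>i. f (fst i) (snd i)) p"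
proof -
  interpret V: module K V by fact
  let ?L = "free_lift K V (\<lambda>i. f (fst i) (snd i))"
  have Pi: "(\<lambda>i. f (fst i) (snd i)) \<in> carrier A \<times> carrier B \<rightarrow> carrier V"
    using bilinear_map_closed[OF f] by auto
  note L = free_lift_linear[OF V Pi]
  have gen: "?L (free_gen K (a, b)) = f a b" if "a \<in> carrier A" "b \<in> carrier B" for a b
    using free_lift_gen[OF V Pi, of "(a, b)"] that by simp
  have minus: "?L (p \<ominus>\<^bsub>F\<^esub> q) = ?L p \<ominus>\<^bsub>V\<^esub> ?L q" if p: "p \<in> carrier F" and q: "q \<in> carrier F" for p q
  proof -
    have "?L (\<ominus>\<^bsub>F\<^esub> q) \<oplus>\<^bsub>V\<^esub> ?L q = \<zero>\<^bsub>V\<^esub>"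
      using linear_map_add[OF L, of "\<ominus>\<^bsub>F\<^esub> q" q] linear_map_zero[OF F.module_axioms V L] q
      by (simp add: F.l_neg)
    then have "?L (\<ominus>\<^bsub>F\<^esub> q) = \<ominus>\<^bsub>V\<^esub> ?L q" using q linear_map_closed[OF L] by (simp add: V.minus_equality)
    then show ?thesis using linear_map_add[OF L, of p "\<ominus>\<^bsub>F\<^esub> q"] p q by (simp add: a_minus_def)
  qed
  have minus_self: "v \<ominus>\<^bsub>V\<^esub> v = \<zero>\<^bsub>V\<^esub>" if "v \<in> carrier V" for v
    using that by (simp add: a_minus_def V.r_neg)
  define Z where "Z = {p \<in> carrier F. ?L p = \<zero>\<^bsub>V\<^esub>}"
  have "submodule Z K F"
  proof (rule F.submoduleI)
    fix p assume p: "p \<in> Z"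
    then have "?L (\<zero>\<^bsub>F\<^esub> \<ominus>\<^bsub>F\<^esub> p) = \<zero>\<^bsub>V\<^esub>"
      using minus[of "\<zero>\<^bsub>F\<^esub>" p] linear_map_zero[OF F.module_axioms V L] by (auto simp: Z_def a_minus_def)
    then show "\<ominus>\<^bsub>F\<^esub> p \<in> Z" using p by (auto simp: Z_def a_minus_def)
  qed (auto simp: Z_def linear_map_add[OF L] linear_map_smult[OF L] linear_map_zero[OF F.module_axioms V L])
  moreover have "tensor_relators K A B \<subseteq> Z"
    unfolding tensor_relators_def Let_def Z_def
    by (auto simp: minus minus_self linear_map_add[OF L] linear_map_smult[OF L] gen
        linear_map_closed[OF L] bilinear_map_closed[OF f]
        linear_map_add[OF bilinear_map_left[OF f]] linear_map_add[OF bilinear_map_right[OF f]]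
        linear_map_smult[OF bilinear_map_left[OF f]] linear_map_smult[OF bilinear_map_right[OF f]])
  ultimately have "N \<subseteq> Z" unfolding tensor_null_def by blast
  then have "?L q = ?L p" if "q \<in> N +>\<^bsub>F\<^esub> p" for q
    using that p by (auto simp: a_r_coset_def' linear_map_add[OF L] Z_def linear_map_closed[OF L])
  then have "?L ` (N +>\<^bsub>F\<^esub> p) = {?L p}" using N.a_rcos_self[OF p] by blast
  then show ?thesis unfolding tlift_def free_lift_def by simp
qed

lemma tlift_tens:
  assumes "module K V" "bilinear_map K A B V f" "a \<in> carrier A" "b \<in> carrier B"
  shows "tlift K V f (tens K A B a b) = f a b"
proof -
  have "(\<lambda>i. f (fst i) (snd i)) \<in> carrier A \<times> carrier B \<rightarrow> carrier V"
    using bilinear_map_closed[OF assms(2)] by auto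
  then show ?thesis using assms free_lift_gen[OF assms(1), of "\<lambda>i. f (fst i) (snd i)" "carrier A \<times> carrier B" "(a, b)"]
    by (simp add: tens_coset tlift_coset)
qed

lemma tlift_linear:
  assumes V: "module K V" and f: "bilinear_map K A B V f"
  shows "linear_map K T V (tlift K V f)"
proof -
  have "(\<lambda>i. f (fst i) (snd i)) \<in> carrier A \<times> carrier B \<rightarrow> carrier V"
    using bilinear_map_closed[OF f] by auto
  note L = free_lift_linear[OF V this]
  show ?thesis
  proof (rule linear_mapI)
    fix s assume "s \<in> carrier T"
    then obtain p where p: "p \<in> carrier F" "s = N +>\<^bsub>F\<^esub> p" by (rule carrier_T_cases)
    show "tlift K V f s \<in> carrier V" using p by (simp add: tlift_coset V f linear_map_closed[OF L])
    { fix t assume "t \<in> carrier T"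
      then obtain q where q: "q \<in> carrier F" "t = N +>\<^bsub>F\<^esub> q" by (rule carrier_T_cases)
      show "tlift K V f (s \<oplus>\<^bsub>T\<^esub> t) = tlift K V f s \<oplus>\<^bsub>V\<^esub> tlift K V f t"
        using p q by (simp add: coset_add tlift_coset V f linear_map_add[OF L]) }
    fix c assume "c \<in> carrier K"
    then show "tlift K V f (c \<odot>\<^bsub>T\<^esub> s) = c \<odot>\<^bsub>V\<^esub> tlift K V f s"
      using p by (simp add: coset_smult tlift_coset V f linear_map_smult[OF L])
  qed
qed

text \<open>The sums are compared representative by representative: each one is supported on pairs
  from the two carriers, where the summands agree.\<close>

lemma tlift_cong:
  assumes V: "module K V" and f: "bilinear_map K A B V f" and t: "t \<in> carrier T"
    and fg: "\<And>a b. a \<in> carrier A \<Longrightarrow> b \<in> carrier B \<Longrightarrow> f a b = g a b"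
  shows "tlift K V f t = tlift K V g t"
proof -
  interpret V: module K V by fact
  have "(\<lambda>p. \<Oplus>\<^bsub>V\<^esub>i\<in>{i. p i \<noteq> \<zero>\<^bsub>K\<^esub>}. p i \<odot>\<^bsub>V\<^esub> f (fst i) (snd i)) ` t =
      (\<lambda>p. \<Oplus>\<^bsub>V\<^esub>i\<in>{i. p i \<noteq> \<zero>\<^bsub>K\<^esub>}. p i \<odot>\<^bsub>V\<^esub> g (fst i) (snd i)) ` t"
  proof (intro image_cong refl V.finsum_cong')
    fix p i assume p: "p \<in> t" and i: "i \<in> {i. p i \<noteq> \<zero>\<^bsub>K\<^esub>}"
    have "p \<in> carrier F" using coset_mem_closed[OF t p] .
    then have "fst i \<in> carrier A" "snd i \<in> carrier B" using i by (auto simp: free_module_def)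
    then show "p i \<odot>\<^bsub>V\<^esub> f (fst i) (snd i) = p i \<odot>\<^bsub>V\<^esub> g (fst i) (snd i)" using fg by simp
  next
    fix p assume p: "p \<in> t"
    have p: "p \<in> carrier F" using coset_mem_closed[OF t p] .
    show "(\<lambda>i. p i \<odot>\<^bsub>V\<^esub> g (fst i) (snd i)) \<in> {i. p i \<noteq> \<zero>\<^bsub>K\<^esub>} \<rightarrow> carrier V"
    proof
      fix i assume i: "i \<in> {i. p i \<noteq> \<zero>\<^bsub>K\<^esub>}"
      then have "fst i \<in> carrier A" "snd i \<in> carrier B" "p i \<in> carrier K"
        using p by (auto simp: free_module_def)
      then show "p i \<odot>\<^bsub>V\<^esub> g (fst i) (snd i) \<in> carrier V"
        using bilinear_map_closed[OF f, of "fst i" "snd i"] fg by simp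
    qed
  qed
  then show ?thesis by (simp add: tlift_def)
qed

lemma linear_map_eqI:
  assumes g: "linear_map K T V g" and h: "linear_map K T V h" and t: "t \<in> carrier T"
    and gh: "\<And>a b. a \<in> carrier A \<Longrightarrow> b \<in> carrier B \<Longrightarrow> g (tens K A B a b) = h (tens K A B a b)"
  shows "g t = h t"
  using t by (induction rule: tensor_space_induct) (simp_all add: gh linear_map_add[OF g] linear_map_add[OF h])

lemma linear_map_tlift:
  assumes V: "module K V" and W: "module K W" and g: "linear_map K V W g"
    and f: "bilinear_map K A B V f" and t: "t \<in> carrier T"
  shows "g (tlift K V f t) = tlift K W (\<lambda>a b. g (f a b)) t"
  by (rule linear_map_eqI[OF linear_map_comp[OF g tlift_linear[OF V f]]
        tlift_linear[OF W bilinear_map_comp[OF g f]] t])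
    (simp add: tlift_tens V W f bilinear_map_comp[OF g f])

end


section \<open>Linearity of sums over tensors\<close>

text \<open>The module axioms read neither \<open>mult\<close> nor \<open>one\<close>, so the
  structure passes from \<open>tensor_space\<close> to \<open>tensor_algebra\<close>, which changes
  just these two fields.\<close>

lemma module_cong:
  assumes "module K V" "carrier W = carrier V" "add W = add V" "zero W = zero V" "smult W = smult V"
  shows "module K W"
proof -
  interpret V: module K V by fact
  note W = assms(2-)
  have "abelian_group W"
    by (rule abelian_groupI) (auto simp: W V.a_ac intro: bexI[of _ "\<ominus>\<^bsub>V\<^esub> _"] V.l_neg)
  then show ?thesis
    by (rule moduleI[OF V.is_cring])
      (auto simp: W V.smult_l_distr V.smult_r_distr V.smult_assoc1)
qed

lemma module_tensor_space: "module K A \<Longrightarrow> module K B \<Longrightarrow> module K (tensor_space K A B)"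
  by (rule tensor_pair.module_T) (rule tensor_pair.intro)

lemma linear_map_tens_left:
  assumes "module K A" "module K B" "linear_map K U A f" "b \<in> carrier B"
  shows "linear_map K U (tensor_space K A B) (\<lambda>u. tens K A B (f u) b)"
  using assms tensor_pair.tens_bilinear[of K A B]
  by (auto intro: linear_map_comp bilinear_map_left simp: tensor_pair_def)

lemma linear_map_tens_right:
  assumes "module K A" "module K B" "linear_map K U B f" "a \<in> carrier A"
  shows "linear_map K U (tensor_space K A B) (\<lambda>u. tens K A B a (f u))"
  using assms tensor_pair.tens_bilinear[of K A B]
  by (auto intro: linear_map_comp bilinear_map_right simp: tensor_pair_def)

lemma tens_closed:
  "module K A \<Longrightarrow> module K B \<Longrightarrow> a \<in> carrier A \<Longrightarrow> b \<in> carrier B \<Longrightarrow>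
    tens K A B a b \<in> carrier (tensor_space K A B)"
  by (rule bilinear_map_closed[OF tensor_pair.tens_bilinear]) (auto simp: tensor_pair_def)

lemma tlift_tens:
  "module K A \<Longrightarrow> module K B \<Longrightarrow> module K V \<Longrightarrow> bilinear_map K A B V f \<Longrightarrow>
    a \<in> carrier A \<Longrightarrow> b \<in> carrier B \<Longrightarrow> tlift K V f (tens K A B a b) = f a b"
  by (rule tensor_pair.tlift_tens) (auto simp: tensor_pair_def)

lemma tlift_cong:
  "t \<in> carrier (tensor_space K A B) \<Longrightarrow> module K A \<Longrightarrow> module K B \<Longrightarrow> module K V \<Longrightarrow>
    bilinear_map K A B V f \<Longrightarrow>
    (\<And>a b. a \<in> carrier A \<Longrightarrow> b \<in> carrier B \<Longrightarrow> f a b = g a b) \<Longrightarrow> tlift K V f t = tlift K V g t"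
  by (rule tensor_pair.tlift_cong) (auto simp: tensor_pair_def)

lemma linear_map_tlift_arg:
  assumes "linear_map K U (tensor_space K A B) g" "module K A" "module K B" "module K V"
    "bilinear_map K A B V f"
  shows "linear_map K U V (\<lambda>u. tlift K V f (g u))"
  by (rule linear_map_comp[OF tensor_pair.tlift_linear[OF tensor_pair.intro[OF assms(2,3)] assms(4,5)] assms(1)])

lemma tlift_closed:
  assumes "t \<in> carrier (tensor_space K A B)" "module K A" "module K B" "module K V"
    "bilinear_map K A B V f"
  shows "tlift K V f t \<in> carrier V"
  using linear_map_closed[OF tensor_pair.tlift_linear[of K A B V f]] assms by (simp add: tensor_pair_def)

lemma linear_map_tlift:
  assumes "t \<in> carrier (tensor_space K A B)" "module K A" "module K B" "module K V" "module K W"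
    "linear_map K V W g" "bilinear_map K A B V f"
  shows "g (tlift K V f t) = tlift K W (\<lambda>a b. g (f a b)) t"
  by (rule tensor_pair.linear_map_tlift[OF tensor_pair.intro[OF assms(2,3)] assms(4,5,6,7,1)])

lemma tensor_eqI:
  assumes "t \<in> carrier (tensor_space K A B)" "module K A" "module K B"
    "linear_map K (tensor_space K A B) V g" "linear_map K (tensor_space K A B) V h"
    "\<And>a b. a \<in> carrier A \<Longrightarrow> b \<in> carrier B \<Longrightarrow> g (tens K A B a b) = h (tens K A B a b)"
  shows "g t = h t"
  by (rule tensor_pair.linear_map_eqI[OF tensor_pair.intro[OF assms(2,3)] assms(4,5,1,6)])

lemma linear_map_add_fun:
  assumes "module K V" "linear_map K U V f" "linear_map K U V g"
  shows "linear_map K U V (\<lambda>u. f u \<oplus>\<^bsub>V\<^esub> g u)"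
proof -
  interpret V: module K V by fact
  note f = assms(2) and g = assms(3)
  show ?thesis
  proof (rule linear_mapI)
    fix x assume x: "x \<in> carrier U"
    have fx: "f x \<in> carrier V" "g x \<in> carrier V"
      using linear_map_closed[OF f x] linear_map_closed[OF g x] .
    then show "f x \<oplus>\<^bsub>V\<^esub> g x \<in> carrier V" by (rule V.a_closed)
    { fix y assume y: "y \<in> carrier U"
      have fy: "f y \<in> carrier V" "g y \<in> carrier V"
        using linear_map_closed[OF f y] linear_map_closed[OF g y] .
      show "f (x \<oplus>\<^bsub>U\<^esub> y) \<oplus>\<^bsub>V\<^esub> g (x \<oplus>\<^bsub>U\<^esub> y) = f x \<oplus>\<^bsub>V\<^esub> g x \<oplus>\<^bsub>V\<^esub> (f y \<oplus>\<^bsub>V\<^esub> g y)"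
        unfolding linear_map_add[OF f x y] linear_map_add[OF g x y]
        using fx fy by (simp add: V.a_ac) }
    fix c assume c: "c \<in> carrier K"
    show "f (c \<odot>\<^bsub>U\<^esub> x) \<oplus>\<^bsub>V\<^esub> g (c \<odot>\<^bsub>U\<^esub> x) = c \<odot>\<^bsub>V\<^esub> (f x \<oplus>\<^bsub>V\<^esub> g x)"
      unfolding linear_map_smult[OF f c x] linear_map_smult[OF g c x]
      using fx c by (simp add: V.smult_r_distr)
  qed
qed

lemma linear_map_smult_fun:
  assumes "module K V" "linear_map K U V f" "c \<in> carrier K"
  shows "linear_map K U V (\<lambda>u. c \<odot>\<^bsub>V\<^esub> f u)"
proof -
  interpret V: module K V by fact
  show ?thesis
    by (rule linear_mapI)
      (use assms(3) in \<open>simp_all add: linear_map_closed[OF assms(2)] linear_map_add[OF assms(2)]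
        linear_map_smult[OF assms(2)] V.smult_r_distr V.smult_assoc1[symmetric] V.m_comm\<close>)
qed

text \<open>Both sides of additivity and of homogeneity in \<open>u\<close> are linear in
  \<open>t\<close>, so pure tensors decide. Repeated use yields the multilinearity of nested
  sums.\<close>

lemma linear_map_tlift_body:
  assumes t: "t \<in> carrier (tensor_space K A B)" and m: "module K A" "module K B" "module K V" "module K U"
    and F: "\<And>u. u \<in> carrier U \<Longrightarrow> bilinear_map K A B V (F u)"
    and L: "\<And>a b. a \<in> carrier A \<Longrightarrow> b \<in> carrier B \<Longrightarrow> linear_map K U V (\<lambda>u. F u a b)"
  shows "linear_map K U V (\<lambda>u. tlift K V (F u) t)"
proof -
  interpret U: module K U by fact
  interpret V: module K V by fact
  note ident = linear_map_ident[of K "tensor_space K A B"]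
  note lin = linear_map_tlift_arg[OF ident m(1-3)]
  show ?thesis
  proof (rule linear_mapI)
    fix u assume u: "u \<in> carrier U"
    show "tlift K V (F u) t \<in> carrier V" by (rule tlift_closed[OF t m(1-3) F[OF u]])
    show "tlift K V (F (u \<oplus>\<^bsub>U\<^esub> u')) t = tlift K V (F u) t \<oplus>\<^bsub>V\<^esub> tlift K V (F u') t"
      if u': "u' \<in> carrier U" for u'
      by (rule tensor_eqI[OF t m(1,2) lin linear_map_add_fun[OF m(3) lin lin]])
        (use u u' in \<open>simp_all add: F tlift_tens m linear_map_add[OF L]\<close>)
    show "tlift K V (F (c \<odot>\<^bsub>U\<^esub> u)) t = c \<odot>\<^bsub>V\<^esub> tlift K V (F u) t" if c: "c \<in> carrier K" for c
      by (rule tensor_eqI[OF t m(1,2) lin linear_map_smult_fun[OF m(3) lin]])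
        (use u c in \<open>simp_all add: F tlift_tens m linear_map_smult[OF L]\<close>)
  qed
qed

text \<open>Fubini for Sweedler sums: both sides are linear in \<open>s\<close>, and for a pure
  tensor the sum over \<open>s\<close> is a single evaluation on either side.\<close>

lemma tlift_swap:
  assumes s: "s \<in> carrier (tensor_space K A B)" and t: "t \<in> carrier (tensor_space K C D)"
    and m: "module K A" "module K B" "module K C" "module K D" "module K V"
    and F: "\<And>a b. a \<in> carrier A \<Longrightarrow> b \<in> carrier B \<Longrightarrow> bilinear_map K C D V (F a b)"
    and G: "\<And>c d. c \<in> carrier C \<Longrightarrow> d \<in> carrier D \<Longrightarrow> bilinear_map K A B V (\<lambda>a b. F a b c d)"
  shows "tlift K V (\<lambda>a b. tlift K V (F a b) t) s = tlift K V (\<lambda>c d. tlift K V (\<lambda>a b. F a b c d) s) t"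
proof (rule tensor_eqI[OF s m(1,2)])
  have inner: "bilinear_map K A B V (\<lambda>a b. tlift K V (F a b) t)"
    by (intro bilinear_mapI linear_map_tlift_body[OF t m(3-5)] m F)
      (auto intro: bilinear_map_left[OF G] bilinear_map_right[OF G])
  have outer: "bilinear_map K C D V (\<lambda>c d. tlift K V (\<lambda>a b. F a b c d) s)" if "s \<in> carrier (tensor_space K A B)" for s
    by (intro bilinear_mapI linear_map_tlift_body[OF that m(1,2,5)] m G)
      (auto intro: bilinear_map_left[OF F] bilinear_map_right[OF F])
  show "linear_map K (tensor_space K A B) V (tlift K V (\<lambda>a b. tlift K V (F a b) t))"
    by (rule linear_map_tlift_arg[OF linear_map_ident m(1,2,5) inner])
  show "linear_map K (tensor_space K A B) V (\<lambda>s. tlift K V (\<lambda>c d. tlift K V (\<lambda>a b. F a b c d) s) t)"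
    by (intro linear_map_tlift_body[OF t m(3-5)] outer linear_map_tlift_arg[OF linear_map_ident m(1,2,5)]
        module_tensor_space m G)
  fix a b assume a: "a \<in> carrier A" and b: "b \<in> carrier B"
  have "tlift K V (F a b) t = tlift K V (\<lambda>c d. tlift K V (\<lambda>a b. F a b c d) (tens K A B a b)) t"
    using a b by (intro tlift_cong[OF t m(3-5)] F) (simp_all add: tlift_tens m G)
  then show "tlift K V (\<lambda>a b. tlift K V (F a b) t) (tens K A B a b) =
      tlift K V (\<lambda>c d. tlift K V (\<lambda>a b. F a b c d) (tens K A B a b)) t"
    using a b by (simp add: tlift_tens m inner)
qed


section \<open>Threefold tensor products\<close>

definition trilinear_map ::
    "('k, 'r) ring_scheme \<Rightarrow> ('k, 'u, 'x) module_scheme \<Rightarrow> ('k, 'v, 'y) module_scheme \<Rightarrow>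
     ('k, 'w, 'z) module_scheme \<Rightarrow> ('k, 's, 't) module_scheme \<Rightarrow> ('u \<Rightarrow> 'v \<Rightarrow> 'w \<Rightarrow> 's) \<Rightarrow> bool"
  where "trilinear_map K U V W X f \<longleftrightarrow>
    (\<forall>u\<in>carrier U. bilinear_map K V W X (f u)) \<and>
    (\<forall>v\<in>carrier V. \<forall>w\<in>carrier W. linear_map K U X (\<lambda>u. f u v w))"

lemma trilinear_mapI:
  assumes "\<And>v w. v \<in> carrier V \<Longrightarrow> w \<in> carrier W \<Longrightarrow> linear_map K U X (\<lambda>u. f u v w)"
    and "\<And>u w. u \<in> carrier U \<Longrightarrow> w \<in> carrier W \<Longrightarrow> linear_map K V X (\<lambda>v. f u v w)"
    and "\<And>u v. u \<in> carrier U \<Longrightarrow> v \<in> carrier V \<Longrightarrow> linear_map K W X (\<lambda>w. f u v w)"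
  shows "trilinear_map K U V W X f"
  using assms by (auto simp: trilinear_map_def intro: bilinear_mapI)

lemma
  assumes "trilinear_map K U V W X f"
  shows trilinear_map_1: "v \<in> carrier V \<Longrightarrow> w \<in> carrier W \<Longrightarrow> linear_map K U X (\<lambda>u. f u v w)"
    and trilinear_map_2: "u \<in> carrier U \<Longrightarrow> w \<in> carrier W \<Longrightarrow> linear_map K V X (\<lambda>v. f u v w)"
    and trilinear_map_3: "u \<in> carrier U \<Longrightarrow> v \<in> carrier V \<Longrightarrow> linear_map K W X (\<lambda>w. f u v w)"
    and trilinear_map_23: "u \<in> carrier U \<Longrightarrow> bilinear_map K V W X (f u)"
    and trilinear_map_closed: "u \<in> carrier U \<Longrightarrow> v \<in> carrier V \<Longrightarrow> w \<in> carrier W \<Longrightarrow> f u v w \<in> carrier X"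
  using assms by (auto simp: trilinear_map_def intro: bilinear_map_left bilinear_map_right bilinear_map_closed)

lemma trilinear_map_comp:
  "linear_map K X Y g \<Longrightarrow> trilinear_map K U V W X f \<Longrightarrow> trilinear_map K U V W Y (\<lambda>u v w. g (f u v w))"
  by (intro trilinear_mapI)
    (auto intro: linear_map_comp trilinear_map_1 trilinear_map_2 trilinear_map_3)

locale tensor_triple = A: module K A + B: module K B + C: module K C
  for K :: "('k, 'r) ring_scheme" (structure) and A :: "('k, 'a, 'x) module_scheme"
    and B :: "('k, 'b, 'y) module_scheme" and C :: "('k, 'c, 'z) module_scheme"
begin

abbreviation "T3 \<equiv> tensor_space K A (tensor_space K B C)"

lemmas modules = A.module_axioms B.module_axioms C.module_axioms
  module_tensor_space[OF B.module_axioms C.module_axioms]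

text \<open>\<open>tlift3\<close> is an outer sum whose summand is an inner sum. Bilinearity of that
  summand is what reduces statements on three factors to the case of two.\<close>

lemma inner_bilinear:
  assumes V: "module K V" and f: "trilinear_map K A B C V f"
  shows "bilinear_map K A (tensor_space K B C) V (\<lambda>a u. tlift K V (f a) u)"
  by (rule bilinear_mapI)
    (auto intro!: linear_map_tlift_arg[OF linear_map_ident modules(2,3) V] linear_map_tlift_body[OF _ modules(2,3) V modules(1)]
      trilinear_map_23[OF f] trilinear_map_1[OF f])

lemma tens3_trilinear: "trilinear_map K A B C T3 (tens3 K A B C)"
  unfolding tens3_def
  by (intro trilinear_mapI linear_map_tens_left linear_map_tens_right linear_map_ident modules)
    (auto intro: tens_closed modules)

lemma tlift3_tens3:
  assumes V: "module K V" and f: "trilinear_map K A B C V f"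
    and "a \<in> carrier A" "b \<in> carrier B" "c \<in> carrier C"
  shows "tlift3 K V f (tens3 K A B C a b c) = f a b c"
  using assms trilinear_map_23[OF f]
  by (simp add: tlift3_def tens3_def tlift_tens modules tens_closed inner_bilinear)

lemma tlift3_linear:
  assumes "module K V" "trilinear_map K A B C V f"
  shows "linear_map K T3 V (tlift3 K V f)"
  unfolding tlift3_def[abs_def]
  by (rule linear_map_tlift_arg[OF linear_map_ident modules(1,4) assms(1) inner_bilinear[OF assms]])

lemma tensor3_eqI:
  assumes t: "t \<in> carrier T3" and g: "linear_map K T3 V g" and h: "linear_map K T3 V h"
    and gh: "\<And>a b c. a \<in> carrier A \<Longrightarrow> b \<in> carrier B \<Longrightarrow> c \<in> carrier C \<Longrightarrow>
      g (tens3 K A B C a b c) = h (tens3 K A B C a b c)"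
  shows "g t = h t"
proof (rule tensor_eqI[OF t modules(1,4) g h])
  fix a u assume a: "a \<in> carrier A" and u: "u \<in> carrier (tensor_space K B C)"
  note tens = linear_map_tens_right[OF modules(1,4) linear_map_ident a]
  show "g (tens K A (tensor_space K B C) a u) = h (tens K A (tensor_space K B C) a u)"
    by (rule tensor_eqI[OF u modules(2,3) linear_map_comp[OF g tens] linear_map_comp[OF h tens]])
      (use a gh in \<open>simp add: tens3_def\<close>)
qed

lemma tlift3_cong:
  assumes t: "t \<in> carrier T3" and V: "module K V" and f: "trilinear_map K A B C V f"
    and fg: "\<And>a b c. a \<in> carrier A \<Longrightarrow> b \<in> carrier B \<Longrightarrow> c \<in> carrier C \<Longrightarrow> f a b c = g a b c"
  shows "tlift3 K V f t = tlift3 K V g t"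
  unfolding tlift3_def
  by (rule tlift_cong[OF t modules(1,4) V inner_bilinear[OF V f]],
      rule tlift_cong[OF _ modules(2,3) V trilinear_map_23[OF f]])
    (simp_all add: fg)

lemma linear_map_tlift3:
  assumes t: "t \<in> carrier T3" and V: "module K V" and W: "module K W" and g: "linear_map K V W g"
    and f: "trilinear_map K A B C V f"
  shows "g (tlift3 K V f t) = tlift3 K W (\<lambda>a b c. g (f a b c)) t"
  by (rule tensor3_eqI[OF t linear_map_comp[OF g tlift3_linear[OF V f]]
        tlift3_linear[OF W trilinear_map_comp[OF g f]]])
    (simp add: tlift3_tens3 V W f trilinear_map_comp[OF g f])

lemma linear_map_tlift3_body:
  assumes t: "t \<in> carrier T3" and V: "module K V" and U: "module K U"
    and F: "\<And>u. u \<in> carrier U \<Longrightarrow> trilinear_map K A B C V (F u)"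
    and L: "\<And>a b c. a \<in> carrier A \<Longrightarrow> b \<in> carrier B \<Longrightarrow> c \<in> carrier C \<Longrightarrow> linear_map K U V (\<lambda>u. F u a b c)"
  shows "linear_map K U V (\<lambda>u. tlift3 K V (F u) t)"
  unfolding tlift3_def
  by (intro linear_map_tlift_body[OF t modules(1,4) V U] inner_bilinear[OF V F]
      linear_map_tlift_body[OF _ modules(2,3) V U] trilinear_map_23[OF F] L)

lemma tlift3_swap:
  assumes s: "s \<in> carrier T3" and t: "t \<in> carrier (tensor_space K D E)"
    and D: "module K D" and E: "module K E" and V: "module K V"
    and F: "\<And>a b c. a \<in> carrier A \<Longrightarrow> b \<in> carrier B \<Longrightarrow> c \<in> carrier C \<Longrightarrow> bilinear_map K D E V (F a b c)"
    and G: "\<And>d e. d \<in> carrier D \<Longrightarrow> e \<in> carrier E \<Longrightarrow> trilinear_map K A B C V (\<lambda>a b c. F a b c d e)"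
  shows "tlift3 K V (\<lambda>a b c. tlift K V (F a b c) t) s = tlift K V (\<lambda>d e. tlift3 K V (\<lambda>a b c. F a b c d e) s) t"
proof -
  have "tlift K V (\<lambda>a u. tlift K V (\<lambda>b c. tlift K V (F a b c) t) u) s =
      tlift K V (\<lambda>a u. tlift K V (\<lambda>d e. tlift K V (\<lambda>b c. F a b c d e) u) t) s"
  proof (rule tlift_cong[OF s modules(1,4) V])
    show "bilinear_map K A (tensor_space K B C) V (\<lambda>a u. tlift K V (\<lambda>b c. tlift K V (F a b c) t) u)"
      by (rule inner_bilinear[OF V])
        (intro trilinear_mapI linear_map_tlift_body[OF t D E V] modules F trilinear_map_1[OF G]
          trilinear_map_2[OF G] trilinear_map_3[OF G])
  qed (intro tlift_swap[OF _ t modules(2,3) D E V] F trilinear_map_23[OF G])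
  also have "\<dots> = tlift K V (\<lambda>d e. tlift K V (\<lambda>a u. tlift K V (\<lambda>b c. F a b c d e) u) s) t"
    by (rule tlift_swap[OF s t modules(1,4) D E V _ inner_bilinear[OF V G]])
      (auto intro!: bilinear_mapI linear_map_tlift_body[OF _ modules(2,3) V] D E trilinear_map_23[OF G]
        trilinear_map_2[OF G] trilinear_map_3[OF G] bilinear_map_left[OF F] bilinear_map_right[OF F])
  finally show ?thesis by (simp add: tlift3_def)
qed

text \<open>The second tensor is unpacked one level at a time: its outer sum passes the whole sum
  over \<open>s\<close>, then its inner sum does the same underneath.\<close>

lemma tlift3_swap3:
  assumes s: "s \<in> carrier T3" and t: "t \<in> carrier (tensor_space K D (tensor_space K E G))"
    and m': "module K D" "module K E" "module K G" and V: "module K V"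
    and F: "\<And>a b c. a \<in> carrier A \<Longrightarrow> b \<in> carrier B \<Longrightarrow> c \<in> carrier C \<Longrightarrow> trilinear_map K D E G V (F a b c)"
    and F': "\<And>d e g. d \<in> carrier D \<Longrightarrow> e \<in> carrier E \<Longrightarrow> g \<in> carrier G \<Longrightarrow>
      trilinear_map K A B C V (\<lambda>a b c. F a b c d e g)"
  shows "tlift3 K V (\<lambda>a b c. tlift3 K V (F a b c) t) s =
    tlift3 K V (\<lambda>d e g. tlift3 K V (\<lambda>a b c. F a b c d e g) s) t"
proof -
  interpret DEG: tensor_triple K D E G using m' by (simp add: tensor_triple_def)
  have mEG: "module K (tensor_space K E G)" by (intro module_tensor_space m')
  have tri: "trilinear_map K A B C V (\<lambda>a b c. tlift K V (F a b c d) u)"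
    if "d \<in> carrier D" "u \<in> carrier (tensor_space K E G)" for d u
    using that
    by (intro trilinear_mapI linear_map_tlift_body[OF _ m'(2,3) V] modules)
      (auto intro: trilinear_map_23[OF F] trilinear_map_1[OF F'] trilinear_map_2[OF F'] trilinear_map_3[OF F'])
  have "tlift3 K V (\<lambda>a b c. tlift K V (\<lambda>d u. tlift K V (F a b c d) u) t) s =
      tlift K V (\<lambda>d u. tlift3 K V (\<lambda>a b c. tlift K V (F a b c d) u) s) t"
    by (rule tlift3_swap[OF s t m'(1) mEG V DEG.inner_bilinear[OF V F] tri])
  also have "\<dots> = tlift K V (\<lambda>d u. tlift K V (\<lambda>e g. tlift3 K V (\<lambda>a b c. F a b c d e g) s) u) t"
  proof (rule tlift_cong[OF t m'(1) mEG V])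
    show "bilinear_map K D (tensor_space K E G) V (\<lambda>d u. tlift3 K V (\<lambda>a b c. tlift K V (F a b c d) u) s)"
      by (intro bilinear_mapI linear_map_tlift3_body[OF s V] tri mEG m'
          bilinear_map_right[OF DEG.inner_bilinear[OF V F]] bilinear_map_left[OF DEG.inner_bilinear[OF V F]])
  qed (intro tlift3_swap[OF s _ m'(2,3) V] trilinear_map_23[OF F] F')
  finally show ?thesis by (simp add: tlift3_def)
qed

end


section \<open>The tensor product of algebras\<close>

lemma tensor_algebra_simps [simp]:
  "carrier (tensor_algebra K A B) = carrier (tensor_space K A B)"
  "add (tensor_algebra K A B) = add (tensor_space K A B)"
  "zero (tensor_algebra K A B) = zero (tensor_space K A B)"
  "smult (tensor_algebra K A B) = smult (tensor_space K A B)"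
  "one (tensor_algebra K A B) = tens K A B \<one>\<^bsub>A\<^esub> \<one>\<^bsub>B\<^esub>"
  by (simp_all add: tensor_algebra_def)

text \<open>The tensor product space reads only the module part of a factor. This lets iterated
  tensor algebras share the carrier and the pure tensors of the iterated tensor spaces.\<close>

lemma tensor_space_tensor_algebra [simp]:
  "tensor_space K C (tensor_algebra K A B) = tensor_space K C (tensor_space K A B)"
  "tens K C (tensor_algebra K A B) = tens K C (tensor_space K A B)"
proof -
  show "tensor_space K C (tensor_algebra K A B) = tensor_space K C (tensor_space K A B)"
    by (simp only: tensor_space_def tensor_null_def tensor_relators_def tensor_algebra_simps)
  show "tens K C (tensor_algebra K A B) = tens K C (tensor_space K A B)"
    by (intro ext) (simp only: tens_def tensor_null_def tensor_relators_def tensor_algebra_simps)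
qed

lemma linear_map_tensor_algebra [simp]:
  "linear_map K V (tensor_algebra K A B) = linear_map K V (tensor_space K A B)"
  "linear_map K (tensor_algebra K A B) V = linear_map K (tensor_space K A B) V"
  by (simp_all add: fun_eq_iff linear_map_def)

lemma tlift_tensor_algebra [simp]:
  "tlift K (tensor_algebra K A B) = tlift K (tensor_space K A B)"
  "tlift3 K (tensor_algebra K A B) = tlift3 K (tensor_space K A B)"
  by (simp_all add: fun_eq_iff tlift_def tlift3_def finsum_def finprod_def)

lemma module_tensor_algebra: "module K A \<Longrightarrow> module K B \<Longrightarrow> module K (tensor_algebra K A B)"
  by (rule module_cong[OF module_tensor_space]) auto

lemma linear_map_mult_left:
  "assoc_algebra K A \<Longrightarrow> linear_map K U A f \<Longrightarrow> y \<in> carrier A \<Longrightarrow> linear_map K U A (\<lambda>u. f u \<otimes>\<^bsub>A\<^esub> y)"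
  by (rule linear_map_comp[OF bilinear_map_left[OF assoc_algebra.mult_bilinear]])

lemma linear_map_mult_right:
  "assoc_algebra K A \<Longrightarrow> linear_map K U A f \<Longrightarrow> y \<in> carrier A \<Longrightarrow> linear_map K U A (\<lambda>u. y \<otimes>\<^bsub>A\<^esub> f u)"
  by (rule linear_map_comp[OF bilinear_map_right[OF assoc_algebra.mult_bilinear]])

locale algebra_pair = A: assoc_algebra K A + B: assoc_algebra K B
  for K :: "('k, 'r) ring_scheme" (structure) and A :: "('k, 'a, 'x) module_scheme"
    and B :: "('k, 'b, 'y) module_scheme"
begin

abbreviation "S \<equiv> tensor_space K A B"

lemmas modules = A.module_axioms B.module_axioms module_tensor_space[OF A.module_axioms B.module_axioms]
lemmas linear_intros = linear_map_tens_left[OF modules(1,2)] linear_map_tens_right[OF modules(1,2)]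
  linear_map_mult_left[OF A.assoc_algebra_axioms] linear_map_mult_right[OF A.assoc_algebra_axioms]
  linear_map_mult_left[OF B.assoc_algebra_axioms] linear_map_mult_right[OF B.assoc_algebra_axioms]
  linear_map_ident

lemma mult_eq: "s \<otimes>\<^bsub>tensor_algebra K A B\<^esub> t =
    tlift K S (\<lambda>a b. tlift K S (\<lambda>a' b'. tens K A B (a \<otimes>\<^bsub>A\<^esub> a') (b \<otimes>\<^bsub>B\<^esub> b')) t) s"
  by (simp add: tensor_algebra_def)

lemma mult_inner_bilinear: "a \<in> carrier A \<Longrightarrow> b \<in> carrier B \<Longrightarrow>
    bilinear_map K A B S (\<lambda>a' b'. tens K A B (a \<otimes>\<^bsub>A\<^esub> a') (b \<otimes>\<^bsub>B\<^esub> b'))"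
  by (intro bilinear_mapI linear_intros) auto

lemma mult_outer_bilinear: "t \<in> carrier S \<Longrightarrow>
    bilinear_map K A B S (\<lambda>a b. tlift K S (\<lambda>a' b'. tens K A B (a \<otimes>\<^bsub>A\<^esub> a') (b \<otimes>\<^bsub>B\<^esub> b')) t)"
  by (intro bilinear_mapI linear_map_tlift_body[OF _ modules(1,2,3)] modules linear_intros) auto

lemma mult_tens:
  "a \<in> carrier A \<Longrightarrow> b \<in> carrier B \<Longrightarrow> a' \<in> carrier A \<Longrightarrow> b' \<in> carrier B \<Longrightarrow>
    tens K A B a b \<otimes>\<^bsub>tensor_algebra K A B\<^esub> tens K A B a' b' = tens K A B (a \<otimes>\<^bsub>A\<^esub> a') (b \<otimes>\<^bsub>B\<^esub> b')"
  by (simp add: mult_eq tlift_tens modules mult_inner_bilinear mult_outer_bilinear tens_closed)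

lemma mult_bilinear: "bilinear_map K S S S (\<lambda>s t. s \<otimes>\<^bsub>tensor_algebra K A B\<^esub> t)"
  unfolding mult_eq
  by (intro bilinear_mapI linear_map_tlift_arg[OF linear_map_ident modules(1,2,3)]
      linear_map_tlift_body[OF _ modules(1,2,3)] modules mult_inner_bilinear mult_outer_bilinear)

lemmas mult_left = linear_map_comp[OF bilinear_map_left[OF mult_bilinear]]
lemmas mult_right = linear_map_comp[OF bilinear_map_right[OF mult_bilinear]]
lemmas mult_closed = bilinear_map_closed[OF mult_bilinear]

lemma one_closed: "tens K A B \<one>\<^bsub>A\<^esub> \<one>\<^bsub>B\<^esub> \<in> carrier S"
  by (simp add: tens_closed modules)

text \<open>Both sides are linear in each of the three factors, so each is replaced in turn by a
  pure tensor; there associativity holds in each component.\<close>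

lemma mult_assoc:
  assumes s: "s \<in> carrier S" and t: "t \<in> carrier S" and u: "u \<in> carrier S"
  shows "s \<otimes>\<^bsub>tensor_algebra K A B\<^esub> t \<otimes>\<^bsub>tensor_algebra K A B\<^esub> u =
    s \<otimes>\<^bsub>tensor_algebra K A B\<^esub> (t \<otimes>\<^bsub>tensor_algebra K A B\<^esub> u)"
proof (rule tensor_eqI[OF s modules(1,2)])
  fix a b assume a: "a \<in> carrier A" and b: "b \<in> carrier B"
  note ab = tens_closed[OF modules(1,2) a b]
  show "tens K A B a b \<otimes>\<^bsub>tensor_algebra K A B\<^esub> t \<otimes>\<^bsub>tensor_algebra K A B\<^esub> u =
    tens K A B a b \<otimes>\<^bsub>tensor_algebra K A B\<^esub> (t \<otimes>\<^bsub>tensor_algebra K A B\<^esub> u)"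
  proof (rule tensor_eqI[OF t modules(1,2)])
    fix a' b' assume a': "a' \<in> carrier A" and b': "b' \<in> carrier B"
    note ab' = tens_closed[OF modules(1,2) a' b']
    show "tens K A B a b \<otimes>\<^bsub>tensor_algebra K A B\<^esub> tens K A B a' b' \<otimes>\<^bsub>tensor_algebra K A B\<^esub> u =
      tens K A B a b \<otimes>\<^bsub>tensor_algebra K A B\<^esub> (tens K A B a' b' \<otimes>\<^bsub>tensor_algebra K A B\<^esub> u)"
      by (rule tensor_eqI[OF u modules(1,2)])
        (use a b a' b' ab ab' in \<open>auto intro!: mult_left mult_right mult_closed linear_map_ident
          simp: mult_tens A.m_assoc B.m_assoc tens_closed modules\<close>)
  qed (use u ab in \<open>auto intro!: mult_left mult_right mult_closed linear_map_ident\<close>)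
qed (use t u in \<open>auto intro!: mult_left mult_right mult_closed linear_map_ident\<close>)

lemma assoc_algebra_tensor: "assoc_algebra K (tensor_algebra K A B)"
proof -
  interpret T: module K "tensor_algebra K A B" by (rule module_tensor_algebra) (rule modules)+
  have monoid: "monoid (tensor_algebra K A B)"
  proof (rule monoidI)
    fix s assume s: "s \<in> carrier (tensor_algebra K A B)"
    show "\<one>\<^bsub>tensor_algebra K A B\<^esub> \<otimes>\<^bsub>tensor_algebra K A B\<^esub> s = s"
      by (rule tensor_eqI[OF _ modules(1,2), where V = S])
        (use s in \<open>auto intro!: mult_left mult_right mult_closed linear_map_ident one_closed simp: mult_tens\<close>)
    show "s \<otimes>\<^bsub>tensor_algebra K A B\<^esub> \<one>\<^bsub>tensor_algebra K A B\<^esub> = s"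
      by (rule tensor_eqI[OF _ modules(1,2), where V = S])
        (use s in \<open>auto intro!: mult_left mult_right mult_closed linear_map_ident one_closed simp: mult_tens\<close>)
  qed (auto intro: mult_closed one_closed simp: mult_assoc)
  show ?thesis
  proof (intro assoc_algebra.intro ringI assoc_algebra_axioms.intro)
    show "bilinear_map K (tensor_algebra K A B) (tensor_algebra K A B) (tensor_algebra K A B)
        (\<lambda>x y. x \<otimes>\<^bsub>tensor_algebra K A B\<^esub> y)"
      using mult_bilinear by (simp add: bilinear_map_def)
    fix s t u assume "s \<in> carrier (tensor_algebra K A B)" "t \<in> carrier (tensor_algebra K A B)"
      "u \<in> carrier (tensor_algebra K A B)"
    then have stu: "s \<in> carrier S" "t \<in> carrier S" "u \<in> carrier S" by auto
    show "(s \<oplus>\<^bsub>tensor_algebra K A B\<^esub> t) \<otimes>\<^bsub>tensor_algebra K A B\<^esub> u =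
      s \<otimes>\<^bsub>tensor_algebra K A B\<^esub> u \<oplus>\<^bsub>tensor_algebra K A B\<^esub> t \<otimes>\<^bsub>tensor_algebra K A B\<^esub> u"
      using linear_map_add[OF bilinear_map_left[OF mult_bilinear]] stu by simp
    show "u \<otimes>\<^bsub>tensor_algebra K A B\<^esub> (s \<oplus>\<^bsub>tensor_algebra K A B\<^esub> t) =
      u \<otimes>\<^bsub>tensor_algebra K A B\<^esub> s \<oplus>\<^bsub>tensor_algebra K A B\<^esub> u \<otimes>\<^bsub>tensor_algebra K A B\<^esub> t"
      using linear_map_add[OF bilinear_map_right[OF mult_bilinear]] stu by simp
  qed (use monoid T.abelian_group_axioms T.module_axioms in auto)
qed

end

lemmas assoc_algebra_tensor = algebra_pair.assoc_algebra_tensor[OF algebra_pair.intro]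
lemmas tensor_mult_tens = algebra_pair.mult_tens[OF algebra_pair.intro]

section \<open>Algebra maps out of a tensor product\<close>

definition algebra_hom ::
    "('k, 'r) ring_scheme \<Rightarrow> ('k, 'a, 'x) module_scheme \<Rightarrow> ('k, 'b, 'y) module_scheme \<Rightarrow> ('a \<Rightarrow> 'b) \<Rightarrow> bool"
  where "algebra_hom K A B f \<longleftrightarrow> linear_map K A B f \<and> f \<one>\<^bsub>A\<^esub> = \<one>\<^bsub>B\<^esub> \<and>
    (\<forall>x\<in>carrier A. \<forall>y\<in>carrier A. f (x \<otimes>\<^bsub>A\<^esub> y) = f x \<otimes>\<^bsub>B\<^esub> f y)"

lemma
  assumes "algebra_hom K A B f"
  shows algebra_hom_linear: "linear_map K A B f"
    and algebra_hom_one: "f \<one>\<^bsub>A\<^esub> = \<one>\<^bsub>B\<^esub>"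
    and algebra_hom_mult: "x \<in> carrier A \<Longrightarrow> y \<in> carrier A \<Longrightarrow> f (x \<otimes>\<^bsub>A\<^esub> y) = f x \<otimes>\<^bsub>B\<^esub> f y"
  using assms by (auto simp: algebra_hom_def)

text \<open>Multiplicativity compares two maps that are linear in each factor, so the products of
  pure tensors decide.\<close>

lemma algebra_hom_tensorI:
  assumes A: "assoc_algebra K A" and B: "assoc_algebra K B" and C: "assoc_algebra K C"
    and f: "linear_map K (tensor_space K A B) C f"
    and one: "f (tens K A B \<one>\<^bsub>A\<^esub> \<one>\<^bsub>B\<^esub>) = \<one>\<^bsub>C\<^esub>"
    and mult: "\<And>a b a' b'. a \<in> carrier A \<Longrightarrow> b \<in> carrier B \<Longrightarrow> a' \<in> carrier A \<Longrightarrow> b' \<in> carrier B \<Longrightarrow>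
      f (tens K A B (a \<otimes>\<^bsub>A\<^esub> a') (b \<otimes>\<^bsub>B\<^esub> b')) = f (tens K A B a b) \<otimes>\<^bsub>C\<^esub> f (tens K A B a' b')"
  shows "algebra_hom K (tensor_algebra K A B) C f"
proof -
  interpret P: algebra_pair K A B using A B by (rule algebra_pair.intro)
  have m: "module K A" "module K B"
    using A B by (auto simp: assoc_algebra_def)
  have "f (s \<otimes>\<^bsub>tensor_algebra K A B\<^esub> t) = f s \<otimes>\<^bsub>C\<^esub> f t"
    if s: "s \<in> carrier (tensor_space K A B)" and t: "t \<in> carrier (tensor_space K A B)" for s t
  proof (rule tensor_eqI[OF s m])
    fix a b assume a: "a \<in> carrier A" and b: "b \<in> carrier B"
    note ab = tens_closed[OF m a b]
    show "f (tens K A B a b \<otimes>\<^bsub>tensor_algebra K A B\<^esub> t) = f (tens K A B a b) \<otimes>\<^bsub>C\<^esub> f t"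
      by (rule tensor_eqI[OF t m])
        (use a b ab in \<open>auto intro!: linear_map_comp[OF f] P.mult_right linear_map_mult_right C f
          linear_map_ident linear_map_closed[OF f] simp: P.mult_tens mult\<close>)
  qed (use t in \<open>auto intro!: linear_map_comp[OF f] P.mult_left linear_map_mult_left C f linear_map_ident
      linear_map_closed[OF f]\<close>)
  then show ?thesis using f one by (simp add: algebra_hom_def)
qed

lemma tensor_id_linear:
  assumes "module K A" "module K B" "module K C" "linear_map K B C f"
  shows "bilinear_map K A B (tensor_space K A C) (\<lambda>a b. tens K A C a (f b))"
  using assms by (intro bilinear_mapI linear_map_tens_left linear_map_tens_right linear_map_ident)
    (auto intro: linear_map_closed)

lemma algebra_hom_id_tensor:
  assumes A: "assoc_algebra K A" and B: "assoc_algebra K B" and C: "assoc_algebra K C"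
    and f: "algebra_hom K B C f"
  shows "algebra_hom K (tensor_algebra K A B) (tensor_algebra K A C)
    (tlift K (tensor_space K A C) (\<lambda>a b. tens K A C a (f b)))"
proof -
  interpret A: assoc_algebra K A by fact
  interpret B: assoc_algebra K B by fact
  interpret C: assoc_algebra K C by fact
  have m: "module K A" "module K B" "module K C" "module K (tensor_space K A C)"
    by (intro module_tensor_space A.module_axioms B.module_axioms C.module_axioms)+
  note bil = tensor_id_linear[OF m(1-3) algebra_hom_linear[OF f]]
  show ?thesis
    by (rule algebra_hom_tensorI[OF A B assoc_algebra_tensor[OF A C]])
      (auto simp: tlift_tens[OF m(1,2,4) bil] tensor_mult_tens[OF A C] algebra_hom_one[OF f]
        algebra_hom_mult[OF f] linear_map_closed[OF algebra_hom_linear[OF f]]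
        intro!: linear_map_tlift_arg[OF linear_map_ident m(1,2,4) bil])
qed


text \<open>Moving the scalars out of a product is what makes a counit on one tensor factor
  multiplicative.\<close>

lemma (in assoc_algebra) smult_mult_smult:
  assumes "a \<in> carrier K" "b \<in> carrier K" "x \<in> carrier H" "y \<in> carrier H"
  shows "(a \<odot>\<^bsub>H\<^esub> x) \<otimes>\<^bsub>H\<^esub> (b \<odot>\<^bsub>H\<^esub> y) = (a \<otimes>\<^bsub>K\<^esub> b) \<odot>\<^bsub>H\<^esub> (x \<otimes>\<^bsub>H\<^esub> y)"
  using assms linear_map_smult[OF bilinear_map_left[OF mult_bilinear]]
    linear_map_smult[OF bilinear_map_right[OF mult_bilinear]]
  by (simp add: smult_assoc1[symmetric] R.m_comm)

section \<open>The counit on the legs of the reassociator\<close>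

context quasi_bialgebra
begin

abbreviation "T2 \<equiv> tensor_space K H H"
abbreviation "T3 \<equiv> tensor_space K H T2"
abbreviation "T4 \<equiv> tensor_space K H T3"
abbreviation "A2 \<equiv> tensor_algebra K H H"
abbreviation "A3 \<equiv> tensor_algebra3 K H"
abbreviation "A4 \<equiv> tensor_algebra4 K H"
abbreviation eps ("\<epsilon>") where "\<epsilon> \<equiv> counit H"
abbreviation \<Phi> where "\<Phi> \<equiv> reassoc H"
abbreviation \<Psi> where "\<Psi> \<equiv> reassoc_inv K H"

lemma mod_H [simp]: "module K H" by (rule module_axioms)

lemmas mods = mod_H module_tensor_space

lemma module_T [simp]: "module K T2" "module K T3" "module K T4"
  by (intro mods)+

sublocale HHH: tensor_triple K H H H by (rule tensor_triple.intro) simp_all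

lemma assoc_A: "assoc_algebra K H" "assoc_algebra K A2" "assoc_algebra K A3" "assoc_algebra K A4"
  by (intro assoc_algebra_tensor assoc_algebra_axioms)+

lemma counit [simp]:
  "h \<in> carrier H \<Longrightarrow> \<epsilon> h \<in> carrier K"
  "h \<in> carrier H \<Longrightarrow> k \<in> carrier H \<Longrightarrow> \<epsilon> (h \<otimes>\<^bsub>H\<^esub> k) = \<epsilon> h \<otimes>\<^bsub>K\<^esub> \<epsilon> k"
  "h \<in> carrier H \<Longrightarrow> k \<in> carrier H \<Longrightarrow> \<epsilon> (h \<oplus>\<^bsub>H\<^esub> k) = \<epsilon> h \<oplus>\<^bsub>K\<^esub> \<epsilon> k"
  "c \<in> carrier K \<Longrightarrow> h \<in> carrier H \<Longrightarrow> \<epsilon> (c \<odot>\<^bsub>H\<^esub> h) = c \<otimes>\<^bsub>K\<^esub> \<epsilon> h"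
  "\<epsilon> \<one>\<^bsub>H\<^esub> = \<one>\<^bsub>K\<^esub>"
  using counit_hom counit_linear by (auto simp: ring_hom_def)

lemma comul_closed [simp]: "h \<in> carrier H \<Longrightarrow> comul H h \<in> carrier T2"
  using linear_map_closed[OF comul_linear] .

lemma comul_one: "comul H \<one>\<^bsub>H\<^esub> = tens K H H \<one>\<^bsub>H\<^esub> \<one>\<^bsub>H\<^esub>"
  using comul_hom by (auto simp: ring_hom_def)

lemma tens_closed_H [simp]:
  "a \<in> carrier H \<Longrightarrow> b \<in> carrier H \<Longrightarrow> tens K H H a b \<in> carrier T2"
  "a \<in> carrier H \<Longrightarrow> u \<in> carrier T2 \<Longrightarrow> tens K H T2 a u \<in> carrier T3"
  "a \<in> carrier H \<Longrightarrow> v \<in> carrier T3 \<Longrightarrow> tens K H T3 a v \<in> carrier T4"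
  by (simp_all add: tens_closed)

lemma linear_map_counit:
  assumes "linear_map K U H f" "module K V" "v \<in> carrier V"
  shows "linear_map K U V (\<lambda>u. \<epsilon> (f u) \<odot>\<^bsub>V\<^esub> v)"
proof -
  interpret V: module K V by fact
  have "linear_map K H V (\<lambda>h. \<epsilon> h \<odot>\<^bsub>V\<^esub> v)"
    by (rule linear_mapI) (use assms(3) in \<open>simp_all add: V.smult_l_distr V.smult_assoc1\<close>)
  then show ?thesis by (rule linear_map_comp) fact
qed

lemmas linear_map_comul_arg = linear_map_comp[OF comul_linear]

lemmas linear_intros = bilinear_mapI trilinear_mapI linear_map_tens_left linear_map_tens_right linear_map_mult_left[OF assoc_A(1)]
  linear_map_mult_right[OF assoc_A(1)] linear_map_counit linear_map_smult_fun linear_map_ident mods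

lemma smult_tens:
  assumes "module K A" "module K B" "c \<in> carrier K" "a \<in> carrier A" "b \<in> carrier B"
  shows "tens K A B (c \<odot>\<^bsub>A\<^esub> a) b = c \<odot>\<^bsub>tensor_space K A B\<^esub> tens K A B a b"
    and "tens K A B a (c \<odot>\<^bsub>B\<^esub> b) = c \<odot>\<^bsub>tensor_space K A B\<^esub> tens K A B a b"
  using linear_map_smult[OF linear_map_tens_left[OF assms(1,2) linear_map_ident assms(5)] assms(3,4)]
    linear_map_smult[OF linear_map_tens_right[OF assms(1,2) linear_map_ident assms(4)] assms(3,5)] .

lemma \<Phi>_inverse:
  "\<Phi> \<in> carrier T3" "\<Psi> \<in> carrier T3"
  "\<Phi> \<otimes>\<^bsub>A3\<^esub> \<Psi> = \<one>\<^bsub>A3\<^esub>" "\<Psi> \<otimes>\<^bsub>A3\<^esub> \<Phi> = \<one>\<^bsub>A3\<^esub>"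
proof -
  interpret A3: assoc_algebra K A3 by (rule assoc_A)
  have "\<Phi> \<in> carrier A3" "\<Psi> \<in> carrier A3"
    using A3.Units_closed[OF reassoc_unit] A3.Units_inv_closed[OF reassoc_unit]
    by (auto simp: reassoc_inv_def)
  then show "\<Phi> \<in> carrier T3" "\<Psi> \<in> carrier T3" by auto
  show "\<Phi> \<otimes>\<^bsub>A3\<^esub> \<Psi> = \<one>\<^bsub>A3\<^esub>" "\<Psi> \<otimes>\<^bsub>A3\<^esub> \<Phi> = \<one>\<^bsub>A3\<^esub>"
    unfolding reassoc_inv_def by (rule A3.Units_r_inv A3.Units_l_inv, rule reassoc_unit)+
qed

section \<open>The counit on one tensor factor\<close>

lemma bilinear_counit_left: "module K C \<Longrightarrow> bilinear_map K H C C (\<lambda>h c. \<epsilon> h \<odot>\<^bsub>C\<^esub> c)"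
  by (intro linear_intros) auto

lemma bilinear_counit_right: "bilinear_map K H H H (\<lambda>h k. \<epsilon> k \<odot>\<^bsub>H\<^esub> h)"
  by (intro linear_intros) auto

text \<open>\<open>eps_left C\<close> is \<epsilon> \<otimes> id from H \<otimes> C to C, and
  \<open>eps_right\<close> is id \<otimes> \<epsilon> from H \<otimes> H to H, with k \<otimes> C
  and H \<otimes> k identified with C and H.\<close>

definition eps_left where "eps_left C = tlift K C (\<lambda>h c. \<epsilon> h \<odot>\<^bsub>C\<^esub> c)"
definition eps_right where "eps_right = tlift K H (\<lambda>h k. \<epsilon> k \<odot>\<^bsub>H\<^esub> h)"

lemma eps_left_hom:
  assumes C: "assoc_algebra K C"
  shows "algebra_hom K (tensor_algebra K H C) C (eps_left C)"
proof -
  interpret C: assoc_algebra K C by fact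
  have m: "module K C" by (rule C.module_axioms)
  show ?thesis unfolding eps_left_def
    by (rule algebra_hom_tensorI[OF assoc_A(1) C C])
      (auto intro: linear_map_tlift_arg linear_intros bilinear_counit_left m
        simp: tlift_tens bilinear_counit_left m C.smult_mult_smult)
qed

lemma eps_right_hom: "algebra_hom K A2 H eps_right"
  unfolding eps_right_def
  by (rule algebra_hom_tensorI[OF assoc_A(1) assoc_A(1) assoc_A(1)])
    (auto intro: linear_map_tlift_arg linear_intros bilinear_counit_right
      simp: tlift_tens bilinear_counit_right smult_mult_smult)

lemma eps_left_tens: "module K C \<Longrightarrow> h \<in> carrier H \<Longrightarrow> c \<in> carrier C \<Longrightarrow> eps_left C (tens K H C h c) = \<epsilon> h \<odot>\<^bsub>C\<^esub> c"
  by (simp add: eps_left_def tlift_tens bilinear_counit_left)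

lemma eps_right_tens: "h \<in> carrier H \<Longrightarrow> k \<in> carrier H \<Longrightarrow> eps_right (tens K H H h k) = \<epsilon> k \<odot>\<^bsub>H\<^esub> h"
  by (simp add: eps_right_def tlift_tens bilinear_counit_right)

definition id_tensor where "id_tensor C f = tlift K (tensor_space K H C) (\<lambda>h b. tens K H C h (f b))"

lemma id_tensor_tens:
  assumes "module K B" "module K C" "linear_map K B C f" "h \<in> carrier H" "b \<in> carrier B"
  shows "id_tensor C f (tens K H B h b) = tens K H C h (f b)"
  using assms by (simp add: id_tensor_def tlift_tens tensor_id_linear module_tensor_space)

lemma id_tensor_hom:
  assumes "assoc_algebra K B" "assoc_algebra K C" "algebra_hom K B C f"
  shows "algebra_hom K (tensor_algebra K H B) (tensor_algebra K H C) (id_tensor C f)"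
  unfolding id_tensor_def by (rule algebra_hom_id_tensor[OF assoc_A(1) assms])

text \<open>The counit on the first, second and third factor of H \<otimes> (H \<otimes> H). With
  this bracketing the last two are id tensored with a counit on H \<otimes> H.\<close>

definition "counit_leg1 = eps_left T2"
definition "counit_leg2 = id_tensor H (eps_left H)"
definition "counit_leg3 = id_tensor H eps_right"

lemma eps_left_tensor_algebra: "eps_left (tensor_algebra K A B) = eps_left (tensor_space K A B)"
  by (simp add: eps_left_def)

lemma id_tensor_tensor_algebra: "id_tensor (tensor_algebra K A B) f = id_tensor (tensor_space K A B) f"
  by (simp add: id_tensor_def fun_eq_iff tlift_def finsum_def finprod_def tensor_space_tensor_algebra)

lemma counit_leg_hom: "algebra_hom K A3 A2 counit_leg1" "algebra_hom K A3 A2 counit_leg2" "algebra_hom K A3 A2 counit_leg3"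
  using eps_left_hom[OF assoc_A(2)] id_tensor_hom[OF assoc_A(2,1) eps_left_hom[OF assoc_A(1)]]
    id_tensor_hom[OF assoc_A(2,1) eps_right_hom]
  by (simp_all add: counit_leg1_def counit_leg2_def counit_leg3_def eps_left_tensor_algebra)

lemma counit_leg_tens3:
  assumes "a \<in> carrier H" "b \<in> carrier H" "c \<in> carrier H"
  shows "counit_leg1 (tens3 K H H H a b c) = \<epsilon> a \<odot>\<^bsub>T2\<^esub> tens K H H b c"
    and "counit_leg2 (tens3 K H H H a b c) = tens K H H a (\<epsilon> b \<odot>\<^bsub>H\<^esub> c)"
    and "counit_leg3 (tens3 K H H H a b c) = tens K H H a (\<epsilon> c \<odot>\<^bsub>H\<^esub> b)"
  using assms algebra_hom_linear[OF eps_left_hom[OF assoc_A(1)]] algebra_hom_linear[OF eps_right_hom]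
  by (simp_all add: counit_leg1_def counit_leg2_def counit_leg3_def tens3_def eps_left_tens eps_right_tens
      id_tensor_tens[where B = T2 and C = H])


text \<open>Serves to recognise a Sweedler sum after a linear map \<open>g\<close> has been applied:
  \<open>k\<close> is the expected closed form, and pure tensors decide.\<close>

lemma push_tlift:
  assumes "t \<in> carrier T2" "module K V" "module K W" "linear_map K V W g" "bilinear_map K H H V F"
    "linear_map K T2 W k"
    "\<And>a b. a \<in> carrier H \<Longrightarrow> b \<in> carrier H \<Longrightarrow> g (F a b) = k (tens K H H a b)"
  shows "g (tlift K V F t) = k t"
  by (rule tensor_eqI[OF assms(1) mod_H mod_H linear_map_comp[OF assms(4)
        linear_map_tlift_arg[OF linear_map_ident mod_H mod_H assms(2,5)]] assms(6)])
    (simp add: assms tlift_tens)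

lemma push_tlift3:
  assumes "t \<in> carrier T3" "module K V" "module K W" "linear_map K V W g" "trilinear_map K H H H V F"
    "linear_map K T3 W k"
    "\<And>a b c. a \<in> carrier H \<Longrightarrow> b \<in> carrier H \<Longrightarrow> c \<in> carrier H \<Longrightarrow> g (F a b c) = k (tens3 K H H H a b c)"
  shows "g (tlift3 K V F t) = k t"
  by (rule HHH.tensor3_eqI[OF assms(1) linear_map_comp[OF assms(4)
        HHH.tlift3_linear[OF assms(2,5)]] assms(6)])
    (simp add: assms HHH.tlift3_tens3)

lemma counit_leg_linear: "linear_map K T3 T2 counit_leg1" "linear_map K T3 T2 counit_leg2" "linear_map K T3 T2 counit_leg3"
  using counit_leg_hom[THEN algebra_hom_linear] by auto

lemma eps_linear: "linear_map K T2 H (eps_left H)" "linear_map K T2 H eps_right"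
  using algebra_hom_linear[OF eps_left_hom[OF assoc_A(1)]] algebra_hom_linear[OF eps_right_hom] by auto

lemmas eps_closed [simp] = eps_linear[THEN linear_map_closed] counit_leg_linear[THEN linear_map_closed]

lemma eps_comul: "h \<in> carrier H \<Longrightarrow> eps_left H (comul H h) = h" "h \<in> carrier H \<Longrightarrow> eps_right (comul H h) = h"
  using counit_left counit_right by (simp_all add: eps_left_def eps_right_def)

text \<open>These are id \<otimes> \<epsilon> \<otimes> id \<otimes> id and id \<otimes> id
  \<otimes> \<epsilon> \<otimes> id, the counits on the two inner factors of a fourfold tensor, to
  be applied to the pentagon.\<close>

lemma id_tensor_counit_leg_linear: "linear_map K T4 T3 (id_tensor T2 counit_leg1)" "linear_map K T4 T3 (id_tensor T2 counit_leg2)"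
  using id_tensor_hom[OF assoc_A(3,2) counit_leg_hom(1), THEN algebra_hom_linear]
    id_tensor_hom[OF assoc_A(3,2) counit_leg_hom(2), THEN algebra_hom_linear]
  by (simp_all add: id_tensor_tensor_algebra)

lemma id_tensor_counit_leg_mult:
  assumes "s \<in> carrier T4" "t \<in> carrier T4"
  shows "id_tensor T2 counit_leg1 (s \<otimes>\<^bsub>A4\<^esub> t) = id_tensor T2 counit_leg1 s \<otimes>\<^bsub>A3\<^esub> id_tensor T2 counit_leg1 t"
    and "id_tensor T2 counit_leg2 (s \<otimes>\<^bsub>A4\<^esub> t) = id_tensor T2 counit_leg2 s \<otimes>\<^bsub>A3\<^esub> id_tensor T2 counit_leg2 t"
  using assms id_tensor_hom[OF assoc_A(3,2) counit_leg_hom(1), THEN algebra_hom_mult]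
    id_tensor_hom[OF assoc_A(3,2) counit_leg_hom(2), THEN algebra_hom_mult]
  by (simp_all add: id_tensor_tensor_algebra)

lemma id_tensor_counit_leg_tens4:
  assumes "a \<in> carrier H" "b \<in> carrier H" "c \<in> carrier H" "d \<in> carrier H"
  shows "id_tensor T2 counit_leg1 (tens4 K H a b c d) = tens K H T2 a (\<epsilon> b \<odot>\<^bsub>T2\<^esub> tens K H H c d)"
    and "id_tensor T2 counit_leg2 (tens4 K H a b c d) = tens K H T2 a (tens K H H b (\<epsilon> c \<odot>\<^bsub>H\<^esub> d))"
  using assms counit_leg_tens3[of b c d]
  by (simp_all add: tens4_def id_tensor_tens[where B = T3 and C = T2] counit_leg_linear tens3_def)

text \<open>The counit axiom on the middle leg, read through \<open>counit_leg2\<close>; the values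
  on the outer legs are derived from it.\<close>

lemma counit_leg2_reassoc: "counit_leg2 \<Phi> = tens K H H \<one>\<^bsub>H\<^esub> \<one>\<^bsub>H\<^esub>"
proof -
  have "tlift3 K T2 (\<lambda>X1 X2 X3. tens K H H X1 (\<epsilon> X2 \<odot>\<^bsub>H\<^esub> X3)) \<Phi> = counit_leg2 \<Phi>"
    by (rule push_tlift3[where g = "\<lambda>x. x" and V = T2 and W = T2])
      (auto intro!: linear_intros counit_leg_linear simp: \<Phi>_inverse counit_leg_tens3)
  then show ?thesis using reassoc_counit by simp
qed

section \<open>Counits applied to the pentagon\<close>

lemmas lin_tlift_comul = linear_map_tlift_body[OF comul_closed mod_H mod_H]
  linear_map_tlift_arg[OF linear_map_comul_arg mod_H mod_H]
lemmas lin_eps = eps_linear[THEN linear_map_comp]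

text \<open>The five factors of the pentagon in their order: 1 \<otimes> \<Phi>, (id \<otimes>
  \<Delta> \<otimes> id)(\<Phi>) and \<Phi> \<otimes> 1 on one side, (id \<otimes> id \<otimes>
  \<Delta>)(\<Phi>) and (\<Delta> \<otimes> id \<otimes> id)(\<Phi>) on the other.\<close>

abbreviation (input) "t1 \<equiv> tens K H T3 \<one>\<^bsub>H\<^esub> \<Phi>"
abbreviation (input) "t2 \<equiv> tlift3 K T4 (\<lambda>X1 X2 X3. tlift K T4 (\<lambda>u v. tens4 K H X1 u v X3) (comul H X2)) \<Phi>"
abbreviation (input) "t3 \<equiv> tlift3 K T4 (\<lambda>X1 X2 X3. tens4 K H X1 X2 X3 \<one>\<^bsub>H\<^esub>) \<Phi>"
abbreviation (input) "t4 \<equiv> tlift3 K T4 (\<lambda>X1 X2 X3. tlift K T4 (\<lambda>u v. tens4 K H X1 X2 u v) (comul H X3)) \<Phi>"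
abbreviation (input) "t5 \<equiv> tlift3 K T4 (\<lambda>X1 X2 X3. tlift K T4 (\<lambda>u v. tens4 K H u v X2 X3) (comul H X1)) \<Phi>"

lemma pentagon': "t1 \<otimes>\<^bsub>A4\<^esub> t2 \<otimes>\<^bsub>A4\<^esub> t3 = t4 \<otimes>\<^bsub>A4\<^esub> t5"
  using pentagon by simp

lemma trilinear_pentagon:
  "trilinear_map K H H H T4 (\<lambda>X1 X2 X3. tlift K T4 (\<lambda>u v. tens4 K H X1 u v X3) (comul H X2))"
  "trilinear_map K H H H T4 (\<lambda>X1 X2 X3. tens4 K H X1 X2 X3 \<one>\<^bsub>H\<^esub>)"
  "trilinear_map K H H H T4 (\<lambda>X1 X2 X3. tlift K T4 (\<lambda>u v. tens4 K H X1 X2 u v) (comul H X3))"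
  "trilinear_map K H H H T4 (\<lambda>X1 X2 X3. tlift K T4 (\<lambda>u v. tens4 K H u v X2 X3) (comul H X1))"
  unfolding tens4_def tens3_def
  by (intro linear_intros lin_tlift_comul; simp)+

lemma pentagon_closed: "t1 \<in> carrier T4" "t2 \<in> carrier T4" "t3 \<in> carrier T4" "t4 \<in> carrier T4" "t5 \<in> carrier T4"
  by (auto intro!: linear_map_closed[OF HHH.tlift3_linear] trilinear_pentagon simp: \<Phi>_inverse)

lemma tens3_closed_H [simp]:
  "a \<in> carrier H \<Longrightarrow> b \<in> carrier H \<Longrightarrow> c \<in> carrier H \<Longrightarrow> tens3 K H H H a b c \<in> carrier T3"
  by (simp add: tens3_def)

lemma bilinear_tens4:
  "a \<in> carrier H \<Longrightarrow> b \<in> carrier H \<Longrightarrow> bilinear_map K H H T4 (\<lambda>u v. tens4 K H a u v b)"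
  "a \<in> carrier H \<Longrightarrow> b \<in> carrier H \<Longrightarrow> bilinear_map K H H T4 (\<lambda>u v. tens4 K H a b u v)"
  "a \<in> carrier H \<Longrightarrow> b \<in> carrier H \<Longrightarrow> bilinear_map K H H T4 (\<lambda>u v. tens4 K H u v a b)"
  unfolding tens4_def tens3_def by (intro linear_intros; simp)+

lemmas push_\<Phi> = push_tlift3[OF \<Phi>_inverse(1) module_T(3,2)]
lemmas push_\<Delta> = push_tlift[OF comul_closed module_T(3,2)]
lemmas smult_tens_H = smult_tens[OF mod_H mod_H] smult_tens[OF mod_H module_T(1)]

text \<open>
  Apply \<open>id \<otimes> id \<otimes> \<epsilon> \<otimes> id\<close> to the pentagon: all factors become \<open>\<Phi>\<close> or \<open>1\<close>, except that \<open>\<Phi> \<otimes> 1\<close>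
  becomes \<open>(id \<otimes> id \<otimes> \<epsilon>)(\<Phi>) \<otimes> 1\<close>, and \<open>\<Phi>\<close> cancels.
\<close>

lemma counit_leg3_reassoc: "counit_leg3 \<Phi> = tens K H H \<one>\<^bsub>H\<^esub> \<one>\<^bsub>H\<^esub>"
proof -
  let ?p = "id_tensor T2 counit_leg2"
  \<comment> \<open>The image of \<Phi> \<otimes> 1: the third position holds leg 3 of \<Phi>, which
    becomes a scalar on the trailing unit. This is the factor to be shown trivial.\<close>
  let ?E = "tlift3 K T3 (\<lambda>X1 X2 X3. tens3 K H H H X1 X2 (\<epsilon> X3 \<odot>\<^bsub>H\<^esub> \<one>\<^bsub>H\<^esub>)) \<Phi>"
  have tri: "trilinear_map K H H H T3 (\<lambda>X1 X2 X3. tens3 K H H H X1 X2 (\<epsilon> X3 \<odot>\<^bsub>H\<^esub> \<one>\<^bsub>H\<^esub>))"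
    unfolding tens3_def by (intro linear_intros) auto
  interpret A3: assoc_algebra K A3 by (rule assoc_A)
  have 1: "?p t1 = \<one>\<^bsub>A3\<^esub>"
    by (simp add: id_tensor_tens[where B = T3 and C = T2] counit_leg_linear \<Phi>_inverse counit_leg2_reassoc)
  have 2: "?p t2 = \<Phi>"
  proof (rule push_\<Phi>[OF id_tensor_counit_leg_linear(2) trilinear_pentagon(1) linear_map_ident])
    fix a b c assume abc: "a \<in> carrier H" "b \<in> carrier H" "c \<in> carrier H"
    have "?p (tlift K T4 (\<lambda>u v. tens4 K H a u v c) (comul H b)) = tens3 K H H H a (eps_right (comul H b)) c"
      by (rule push_\<Delta>[OF abc(2) id_tensor_counit_leg_linear(2) bilinear_tens4(1)])
        (use abc in \<open>auto simp: tens3_def id_tensor_counit_leg_tens4 eps_right_tens smult_tens_H intro!: linear_intros lin_eps\<close>)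
    then show "?p (tlift K T4 (\<lambda>u v. tens4 K H a u v c) (comul H b)) = tens3 K H H H a b c"
      using abc by (simp add: eps_comul)
  qed
  have 3: "?p t3 = ?E"
    by (rule push_\<Phi>[OF id_tensor_counit_leg_linear(2) trilinear_pentagon(2) HHH.tlift3_linear[OF _ tri]])
      (simp_all add: id_tensor_counit_leg_tens4 HHH.tlift3_tens3 tri, simp add: tens3_def)
  have 4: "?p t4 = \<Phi>"
  proof (rule push_\<Phi>[OF id_tensor_counit_leg_linear(2) trilinear_pentagon(3) linear_map_ident])
    fix a b c assume abc: "a \<in> carrier H" "b \<in> carrier H" "c \<in> carrier H"
    have "?p (tlift K T4 (\<lambda>u v. tens4 K H a b u v) (comul H c)) = tens3 K H H H a b (eps_left H (comul H c))"
      by (rule push_\<Delta>[OF abc(3) id_tensor_counit_leg_linear(2) bilinear_tens4(2)])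
        (use abc in \<open>auto simp: tens3_def id_tensor_counit_leg_tens4 eps_left_tens smult_tens_H intro!: linear_intros lin_eps\<close>)
    then show "?p (tlift K T4 (\<lambda>u v. tens4 K H a b u v) (comul H c)) = tens3 K H H H a b c"
      using abc by (simp add: eps_comul)
  qed
  \<comment> \<open>\<open>?L\<close> is \<Delta> \<otimes> id on H \<otimes> H. In (\<Delta>
    \<otimes> id \<otimes> id)(\<Phi>) the third position holds leg 2 of \<Phi>, so the image is
    \<open>?L\<close> of a value known from the axiom to be 1 \<otimes> 1.\<close>
  let ?L = "tlift K T3 (\<lambda>p q. tlift K T3 (\<lambda>u v. tens3 K H H H u v q) (comul H p))"
  have biL: "bilinear_map K H H T3 (\<lambda>p q. tlift K T3 (\<lambda>u v. tens3 K H H H u v q) (comul H p))"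
    unfolding tens3_def by (intro linear_intros lin_tlift_comul) auto
  have bil3: "bilinear_map K H H T3 (\<lambda>u v. tens3 K H H H u v q)" if "q \<in> carrier H" for q
    unfolding tens3_def using that by (intro linear_intros) auto
  have 5: "?p t5 = ?L (counit_leg2 \<Phi>)"
  proof (rule push_\<Phi>[OF id_tensor_counit_leg_linear(2) trilinear_pentagon(4)])
    show "linear_map K T3 T3 (\<lambda>t. ?L (counit_leg2 t))"
      by (rule linear_map_tlift_arg[OF counit_leg_linear(2) mod_H mod_H module_T(2) biL])
    fix a b c assume abc: "a \<in> carrier H" "b \<in> carrier H" "c \<in> carrier H"
    have "?p (tlift K T4 (\<lambda>u v. tens4 K H u v b c) (comul H a)) =
        tlift K T3 (\<lambda>u v. tens3 K H H H u v (\<epsilon> b \<odot>\<^bsub>H\<^esub> c)) (comul H a)"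
      by (rule push_\<Delta>[OF abc(1) id_tensor_counit_leg_linear(2) bilinear_tens4(3)])
        (use abc in \<open>auto simp: id_tensor_counit_leg_tens4 tlift_tens bil3 tens3_def[symmetric]
          intro!: linear_map_tlift_arg[OF linear_map_ident mod_H mod_H module_T(2)]\<close>)
    then show "?p (tlift K T4 (\<lambda>u v. tens4 K H u v b c) (comul H a)) = ?L (counit_leg2 (tens3 K H H H a b c))"
      using abc by (simp add: counit_leg_tens3 tlift_tens biL)
  qed
  have "?L (counit_leg2 \<Phi>) = \<one>\<^bsub>A3\<^esub>"
    by (simp add: counit_leg2_reassoc tlift_tens biL comul_one bil3, simp add: tens3_def)
  then have "\<one>\<^bsub>A3\<^esub> \<otimes>\<^bsub>A3\<^esub> \<Phi> \<otimes>\<^bsub>A3\<^esub> ?E = \<Phi> \<otimes>\<^bsub>A3\<^esub> \<one>\<^bsub>A3\<^esub>"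
    using arg_cong[OF pentagon', of ?p] 1 2 3 4 5 pentagon_closed assoc_algebra.axioms(2)[OF assoc_A(4)]
    by (simp add: id_tensor_counit_leg_mult bilinear_map_closed[OF assoc_algebra.mult_bilinear[OF assoc_A(4)], simplified])
  moreover have E: "?E \<in> carrier A3"
    using linear_map_closed[OF HHH.tlift3_linear[OF _ tri]] \<Phi>_inverse by simp
  moreover have P: "\<Phi> \<in> carrier A3" "\<Psi> \<in> carrier A3" using \<Phi>_inverse by auto
  ultimately have "\<Phi> \<otimes>\<^bsub>A3\<^esub> ?E = \<Phi>" using A3.l_one A3.r_one by metis
  \<comment> \<open>The unknown factor stands to the right of \<Phi>, hence the multiplication by
    the inverse from the left.\<close>
  then have E1: "?E = \<one>\<^bsub>A3\<^esub>" using \<Phi>_inverse(4) A3.m_assoc[OF P(2,1) E] A3.l_one[OF E] by metis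
  \<comment> \<open>A second counit removes the trailing unit: since \<epsilon>(\<epsilon>(c) 1) =
    \<epsilon>(c), \<open>?E\<close> and \<Phi> have the same image under
    \<open>counit_leg3\<close>.\<close>
  have "counit_leg3 ?E = counit_leg3 \<Phi>"
    by (rule push_tlift3[OF \<Phi>_inverse(1) module_T(2,1) counit_leg_linear(3) tri counit_leg_linear(3)])
      (simp add: counit_leg_tens3 R.m_ac)
  then show ?thesis using E1 algebra_hom_one[OF counit_leg_hom(3)] by simp
qed

text \<open>The same argument with \<open>id \<otimes> \<epsilon> \<otimes> id \<otimes> id\<close>.\<close>

lemma counit_leg1_reassoc: "counit_leg1 \<Phi> = tens K H H \<one>\<^bsub>H\<^esub> \<one>\<^bsub>H\<^esub>"
proof -
  let ?p = "id_tensor T2 counit_leg1"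
  interpret A3: assoc_algebra K A3 by (rule assoc_A)
  \<comment> \<open>The second position of 1 \<otimes> \<Phi> holds leg 1 of \<Phi>, so this is the
    one factor whose image is still unknown.\<close>
  have 1: "?p t1 = tens K H T2 \<one>\<^bsub>H\<^esub> (counit_leg1 \<Phi>)"
    by (simp add: id_tensor_tens[where B = T3 and C = T2] counit_leg_linear \<Phi>_inverse)
  have 2: "?p t2 = \<Phi>"
  proof (rule push_\<Phi>[OF id_tensor_counit_leg_linear(1) trilinear_pentagon(1) linear_map_ident])
    fix a b c assume abc: "a \<in> carrier H" "b \<in> carrier H" "c \<in> carrier H"
    have "?p (tlift K T4 (\<lambda>u v. tens4 K H a u v c) (comul H b)) = tens3 K H H H a (eps_left H (comul H b)) c"
      by (rule push_\<Delta>[OF abc(2) id_tensor_counit_leg_linear(1) bilinear_tens4(1)])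
        (use abc in \<open>auto simp: tens3_def id_tensor_counit_leg_tens4 eps_left_tens smult_tens_H intro!: linear_intros lin_eps\<close>)
    then show "?p (tlift K T4 (\<lambda>u v. tens4 K H a u v c) (comul H b)) = tens3 K H H H a b c"
      using abc by (simp add: eps_comul)
  qed
  \<comment> \<open>\<open>?M\<close> appends a factor 1, and \<open>?N\<close> below is id
    \<otimes> \<Delta>. They describe the images of \<Phi> \<otimes> 1 and (id \<otimes> id
    \<otimes> \<Delta>)(\<Phi>), whose second position holds leg 2 of \<Phi>; both become
    trivial.\<close>
  let ?M = "tlift K T3 (\<lambda>p q. tens3 K H H H p q \<one>\<^bsub>H\<^esub>)"
  have biM: "bilinear_map K H H T3 (\<lambda>p q. tens3 K H H H p q \<one>\<^bsub>H\<^esub>)"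
    unfolding tens3_def by (intro linear_intros) auto
  have 3: "?p t3 = ?M (counit_leg2 \<Phi>)"
    by (rule push_\<Phi>[OF id_tensor_counit_leg_linear(1) trilinear_pentagon(2)
          linear_map_tlift_arg[OF counit_leg_linear(2) mod_H mod_H module_T(2) biM]])
      (simp add: id_tensor_counit_leg_tens4 counit_leg_tens3 tlift_tens biM, simp add: tens3_def smult_tens_H)
  have M1: "?M (counit_leg2 \<Phi>) = \<one>\<^bsub>A3\<^esub>" by (simp add: counit_leg2_reassoc tlift_tens biM, simp add: tens3_def)
  let ?N = "tlift K T3 (\<lambda>p q. tens K H T2 p (comul H q))"
  have biN: "bilinear_map K H H T3 (\<lambda>p q. tens K H T2 p (comul H q))"
    by (intro linear_intros comul_linear) auto
  have 4: "?p t4 = ?N (counit_leg2 \<Phi>)"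
  proof (rule push_\<Phi>[OF id_tensor_counit_leg_linear(1) trilinear_pentagon(3)
        linear_map_tlift_arg[OF counit_leg_linear(2) mod_H mod_H module_T(2) biN]])
    fix a b c assume abc: "a \<in> carrier H" "b \<in> carrier H" "c \<in> carrier H"
    have "?p (tlift K T4 (\<lambda>u v. tens4 K H a b u v) (comul H c)) = tens K H T2 a (\<epsilon> b \<odot>\<^bsub>T2\<^esub> comul H c)"
      by (rule push_\<Delta>[OF abc(3) id_tensor_counit_leg_linear(1) bilinear_tens4(2)])
        (use abc in \<open>auto simp: id_tensor_counit_leg_tens4 intro!: linear_intros\<close>)
    then show "?p (tlift K T4 (\<lambda>u v. tens4 K H a b u v) (comul H c)) = ?N (counit_leg2 (tens3 K H H H a b c))"
      using abc by (simp add: counit_leg_tens3 tlift_tens biN linear_map_smult[OF comul_linear])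
  qed
  have N1: "?N (counit_leg2 \<Phi>) = \<one>\<^bsub>A3\<^esub>" by (simp add: counit_leg2_reassoc tlift_tens biN comul_one)
  have 5: "?p t5 = \<Phi>"
  proof (rule push_\<Phi>[OF id_tensor_counit_leg_linear(1) trilinear_pentagon(4) linear_map_ident])
    fix a b c assume abc: "a \<in> carrier H" "b \<in> carrier H" "c \<in> carrier H"
    have "?p (tlift K T4 (\<lambda>u v. tens4 K H u v b c) (comul H a)) = tens3 K H H H (eps_right (comul H a)) b c"
      by (rule push_\<Delta>[OF abc(1) id_tensor_counit_leg_linear(1) bilinear_tens4(3)])
        (use abc in \<open>auto simp: tens3_def id_tensor_counit_leg_tens4 eps_right_tens smult_tens_H intro!: linear_intros lin_eps\<close>)
    then show "?p (tlift K T4 (\<lambda>u v. tens4 K H u v b c) (comul H a)) = tens3 K H H H a b c"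
      using abc by (simp add: eps_comul)
  qed
  let ?R = "tens K H T2 \<one>\<^bsub>H\<^esub> (counit_leg1 \<Phi>)"
  have P: "\<Phi> \<in> carrier A3" "\<Psi> \<in> carrier A3" "?R \<in> carrier A3" using \<Phi>_inverse by auto
  have "?R \<otimes>\<^bsub>A3\<^esub> \<Phi> \<otimes>\<^bsub>A3\<^esub> \<one>\<^bsub>A3\<^esub> = \<one>\<^bsub>A3\<^esub> \<otimes>\<^bsub>A3\<^esub> \<Phi>"
    using arg_cong[OF pentagon', of ?p] 1 2 3 4 5 M1 N1 pentagon_closed
    by (simp add: id_tensor_counit_leg_mult bilinear_map_closed[OF assoc_algebra.mult_bilinear[OF assoc_A(4)], simplified])
  then have "?R \<otimes>\<^bsub>A3\<^esub> \<Phi> = \<Phi>" using P A3.l_one A3.r_one A3.m_closed by metis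
  then have "?R = \<one>\<^bsub>A3\<^esub>" using \<Phi>_inverse(3) A3.m_assoc[OF P(3,1,2)] A3.r_one[OF P(3)] by metis
  \<comment> \<open>Since \<epsilon>(1) = 1, the counit on the first factor strips the leading unit
    and leaves \<open>counit_leg1 \<Phi>\<close>.\<close>
  then have "eps_left T2 ?R = eps_left T2 (tens K H T2 \<one>\<^bsub>H\<^esub> (tens K H H \<one>\<^bsub>H\<^esub> \<one>\<^bsub>H\<^esub>))" by simp
  then show ?thesis
    using \<Phi>_inverse module.smult_one[OF module_T(1)] by (simp add: eps_left_tens)
qed

text \<open>If an algebra map sends \<Phi> to 1, then the image of \<Phi> times its inverse reads 1
  times the image of the inverse, which must therefore be 1.\<close>

lemma counit_leg_reassoc_inv:
  "counit_leg1 \<Psi> = tens K H H \<one>\<^bsub>H\<^esub> \<one>\<^bsub>H\<^esub>" "counit_leg2 \<Psi> = tens K H H \<one>\<^bsub>H\<^esub> \<one>\<^bsub>H\<^esub>" "counit_leg3 \<Psi> = tens K H H \<one>\<^bsub>H\<^esub> \<one>\<^bsub>H\<^esub>"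
proof -
  interpret A2: assoc_algebra K A2 by (rule assoc_A)
  have *: "r \<Psi> = tens K H H \<one>\<^bsub>H\<^esub> \<one>\<^bsub>H\<^esub>"
    if r: "algebra_hom K A3 A2 r" and 1: "r \<Phi> = tens K H H \<one>\<^bsub>H\<^esub> \<one>\<^bsub>H\<^esub>" for r
  proof -
    have P: "\<Phi> \<in> carrier A3" "\<Psi> \<in> carrier A3" using \<Phi>_inverse by auto
    have "r \<Phi> \<otimes>\<^bsub>A2\<^esub> r \<Psi> = \<one>\<^bsub>A2\<^esub>"
      using algebra_hom_mult[OF r P] algebra_hom_one[OF r] \<Phi>_inverse(3) by simp
    moreover have "r \<Psi> \<in> carrier A2"
      using linear_map_closed[OF algebra_hom_linear[OF r] P(2)] .
    ultimately show ?thesis using A2.l_one[of "r \<Psi>"] 1 by simp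
  qed
  show "counit_leg1 \<Psi> = tens K H H \<one>\<^bsub>H\<^esub> \<one>\<^bsub>H\<^esub>" by (rule *[OF counit_leg_hom(1) counit_leg1_reassoc])
  show "counit_leg2 \<Psi> = tens K H H \<one>\<^bsub>H\<^esub> \<one>\<^bsub>H\<^esub>" by (rule *[OF counit_leg_hom(2) counit_leg2_reassoc])
  show "counit_leg3 \<Psi> = tens K H H \<one>\<^bsub>H\<^esub> \<one>\<^bsub>H\<^esub>" by (rule *[OF counit_leg_hom(3) counit_leg3_reassoc])
qed

text \<open>A summand that sees one leg only through \<epsilon> factors through the counit on that
  leg, which turns \<open>\<Psi>\<close> into 1 \<otimes> 1. The hypothesis has the shape that
  arises when a leg acts on a unit of A or B.\<close>

lemma tlift3_reassoc_inv_counit: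
  assumes V: "module K V" and f: "trilinear_map K H H H V f"
    and eps: "(\<forall>a\<in>carrier H. \<forall>b\<in>carrier H. \<forall>c\<in>carrier H. f a b c = \<epsilon> a \<odot>\<^bsub>V\<^esub> f \<one>\<^bsub>H\<^esub> b c) \<or>
      (\<forall>a\<in>carrier H. \<forall>b\<in>carrier H. \<forall>c\<in>carrier H. f a b c = \<epsilon> b \<odot>\<^bsub>V\<^esub> f a \<one>\<^bsub>H\<^esub> c) \<or>
      (\<forall>a\<in>carrier H. \<forall>b\<in>carrier H. \<forall>c\<in>carrier H. f a b c = \<epsilon> c \<odot>\<^bsub>V\<^esub> f a b \<one>\<^bsub>H\<^esub>)"
  shows "tlift3 K V f \<Psi> = f \<one>\<^bsub>H\<^esub> \<one>\<^bsub>H\<^esub> \<one>\<^bsub>H\<^esub>"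
proof -
  note f23 = trilinear_map_23[OF f one_closed]
  have f13: "bilinear_map K H H V (\<lambda>a c. f a \<one>\<^bsub>H\<^esub> c)" and f12: "bilinear_map K H H V (\<lambda>a b. f a b \<one>\<^bsub>H\<^esub>)"
    by (auto intro: bilinear_mapI trilinear_map_1[OF f] trilinear_map_2[OF f] trilinear_map_3[OF f])
  \<comment> \<open>Evaluates the sum through one counit: \<open>r\<close> is the counit on the
    chosen leg and \<open>g\<close> is what remains of \<open>f\<close> in the other two.\<close>
  have push: "tlift3 K V f \<Psi> = tlift K V g (r \<Psi>)"
    if g: "bilinear_map K H H V g" and r: "linear_map K T3 T2 r"
      and fg: "\<And>a b c. a \<in> carrier H \<Longrightarrow> b \<in> carrier H \<Longrightarrow> c \<in> carrier H \<Longrightarrow>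
        f a b c = tlift K V g (r (tens3 K H H H a b c))" for g r
    by (rule push_tlift3[OF \<Phi>_inverse(2) V V linear_map_ident f
          linear_map_tlift_arg[OF r mod_H mod_H V g]]) (rule fg)
  note tl = linear_map_smult[OF linear_map_tlift_arg[OF linear_map_ident mod_H mod_H V]]
  from eps show ?thesis
  proof (elim disjE)
    assume *: "\<forall>a\<in>carrier H. \<forall>b\<in>carrier H. \<forall>c\<in>carrier H. f a b c = \<epsilon> a \<odot>\<^bsub>V\<^esub> f \<one>\<^bsub>H\<^esub> b c"
    have "tlift3 K V f \<Psi> = tlift K V (f \<one>\<^bsub>H\<^esub>) (counit_leg1 \<Psi>)"
      by (rule push[OF f23 counit_leg_linear(1)])
        (simp add: counit_leg_tens3 tl[OF f23] tlift_tens f23 V, use * in blast)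
    then show ?thesis by (simp add: counit_leg_reassoc_inv tlift_tens f23 V)
  next
    assume *: "\<forall>a\<in>carrier H. \<forall>b\<in>carrier H. \<forall>c\<in>carrier H. f a b c = \<epsilon> b \<odot>\<^bsub>V\<^esub> f a \<one>\<^bsub>H\<^esub> c"
    have "tlift3 K V f \<Psi> = tlift K V (\<lambda>a c. f a \<one>\<^bsub>H\<^esub> c) (counit_leg2 \<Psi>)"
      by (rule push[OF f13 counit_leg_linear(2)])
        (simp add: counit_leg_tens3 tlift_tens f13 V linear_map_smult[OF bilinear_map_right[OF f13]], use * in blast)
    then show ?thesis by (simp add: counit_leg_reassoc_inv tlift_tens f13 V)
  next
    assume *: "\<forall>a\<in>carrier H. \<forall>b\<in>carrier H. \<forall>c\<in>carrier H. f a b c = \<epsilon> c \<odot>\<^bsub>V\<^esub> f a b \<one>\<^bsub>H\<^esub>"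
    have "tlift3 K V f \<Psi> = tlift K V (\<lambda>a b. f a b \<one>\<^bsub>H\<^esub>) (counit_leg3 \<Psi>)"
      by (rule push[OF f12 counit_leg_linear(3)])
        (simp add: counit_leg_tens3 tlift_tens f12 V linear_map_smult[OF bilinear_map_right[OF f12]], use * in blast)
    then show ?thesis by (simp add: counit_leg_reassoc_inv tlift_tens f12 V)
  qed
qed

text \<open>The same collapse for \<Delta>(h), now by the two counit axioms of the
  comultiplication.\<close>

lemma tlift_comul_counit:
  assumes V: "module K V" and f: "bilinear_map K H H V f" and h: "h \<in> carrier H"
  shows "(\<And>a b. a \<in> carrier H \<Longrightarrow> b \<in> carrier H \<Longrightarrow> f a b = \<epsilon> a \<odot>\<^bsub>V\<^esub> f \<one>\<^bsub>H\<^esub> b) \<Longrightarrow>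
      tlift K V f (comul H h) = f \<one>\<^bsub>H\<^esub> h"
    and "(\<And>a b. a \<in> carrier H \<Longrightarrow> b \<in> carrier H \<Longrightarrow> f a b = \<epsilon> b \<odot>\<^bsub>V\<^esub> f a \<one>\<^bsub>H\<^esub>) \<Longrightarrow>
      tlift K V f (comul H h) = f h \<one>\<^bsub>H\<^esub>"
proof -
  note fl = bilinear_map_left[OF f one_closed] and fr = bilinear_map_right[OF f one_closed]
  { assume *: "\<And>a b. a \<in> carrier H \<Longrightarrow> b \<in> carrier H \<Longrightarrow> f a b = \<epsilon> a \<odot>\<^bsub>V\<^esub> f \<one>\<^bsub>H\<^esub> b"
    have "tlift K V f (comul H h) = f \<one>\<^bsub>H\<^esub> (eps_left H (comul H h))"
      by (rule push_tlift[OF comul_closed[OF h] V V linear_map_ident f linear_map_comp[OF fr eps_linear(1)]])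
        (simp add: eps_left_tens linear_map_smult[OF fr], use * in blast)
    then show "tlift K V f (comul H h) = f \<one>\<^bsub>H\<^esub> h" using h by (simp add: eps_comul) }
  { assume *: "\<And>a b. a \<in> carrier H \<Longrightarrow> b \<in> carrier H \<Longrightarrow> f a b = \<epsilon> b \<odot>\<^bsub>V\<^esub> f a \<one>\<^bsub>H\<^esub>"
    have "tlift K V f (comul H h) = f (eps_right (comul H h)) \<one>\<^bsub>H\<^esub>"
      by (rule push_tlift[OF comul_closed[OF h] V V linear_map_ident f linear_map_comp[OF fl eps_linear(2)]])
        (simp add: eps_right_tens linear_map_smult[OF fl], use * in blast)
    then show "tlift K V f (comul H h) = f h \<one>\<^bsub>H\<^esub>" using h by (simp add: eps_comul) }
qed

lemma tlift_comul_one: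
  "module K V \<Longrightarrow> bilinear_map K H H V f \<Longrightarrow> tlift K V f (comul H \<one>\<^bsub>H\<^esub>) = f \<one>\<^bsub>H\<^esub> \<one>\<^bsub>H\<^esub>"
  by (simp add: comul_one tlift_tens)

end


section \<open>The multiplication of the two-sided smash product\<close>

locale smash_product = quasi_bialgebra K H
  for K :: "('k, 'r) ring_scheme" (structure)
    and H :: "('k, 'h, 'x) quasi_bialg_scheme" (structure) +
  fixes A :: "('k, 'h, 'a, 'y) left_mod_alg_scheme"
    and B :: "('k, 'h, 'b, 'z) right_mod_alg_scheme"
  assumes left_alg: "left_module_algebra K H A"
    and right_alg: "right_module_algebra K H B"
begin

abbreviation "S \<equiv> smash_space K H A B"
abbreviation lac (infixr "\<rightharpoonup>" 75) where "h \<rightharpoonup> a \<equiv> lact A h a"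
abbreviation rac (infixl "\<leftharpoonup>" 75) where "b \<leftharpoonup> h \<equiv> ract B b h"

lemma mod_AB [simp]: "module K A" "module K B"
  using left_alg right_alg
  by (simp_all add: left_module_algebra_def right_module_algebra_def left_module_def right_module_def)

lemma module_S [simp]: "module K S" "module K (tensor_space K H B)"
  by (intro module_tensor_space mod_AB mod_H)+

sublocale AHB: tensor_triple K A H B by (rule tensor_triple.intro) simp_all

lemma bilinear_ops:
  "bilinear_map K H A A (\<rightharpoonup>)" "bilinear_map K B H B (\<leftharpoonup>)"
  "bilinear_map K A A A (\<lambda>x y. x \<otimes>\<^bsub>A\<^esub> y)" "bilinear_map K B B B (\<lambda>x y. x \<otimes>\<^bsub>B\<^esub> y)"
  using left_alg right_alg
  by (simp_all add: left_module_algebra_def right_module_algebra_def left_module_def right_module_def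
      unital_mult_def)

lemmas ops_closed [simp] = bilinear_ops[THEN bilinear_map_closed]

lemmas lin_ops = bilinear_ops[THEN bilinear_map_left, THEN linear_map_comp]
  bilinear_ops[THEN bilinear_map_right, THEN linear_map_comp]

lemma unit_closed [simp]: "\<one>\<^bsub>A\<^esub> \<in> carrier A" "\<one>\<^bsub>B\<^esub> \<in> carrier B"
  using left_alg right_alg
  by (simp_all add: left_module_algebra_def right_module_algebra_def unital_mult_def)

lemma unit_mult [simp]:
  "a \<in> carrier A \<Longrightarrow> \<one>\<^bsub>A\<^esub> \<otimes>\<^bsub>A\<^esub> a = a" "a \<in> carrier A \<Longrightarrow> a \<otimes>\<^bsub>A\<^esub> \<one>\<^bsub>A\<^esub> = a"
  "b \<in> carrier B \<Longrightarrow> \<one>\<^bsub>B\<^esub> \<otimes>\<^bsub>B\<^esub> b = b" "b \<in> carrier B \<Longrightarrow> b \<otimes>\<^bsub>B\<^esub> \<one>\<^bsub>B\<^esub> = b"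
  using left_alg right_alg
  by (simp_all add: left_module_algebra_def right_module_algebra_def unital_mult_def)

lemma act_one [simp]:
  "a \<in> carrier A \<Longrightarrow> \<one>\<^bsub>H\<^esub> \<rightharpoonup> a = a" "b \<in> carrier B \<Longrightarrow> b \<leftharpoonup> \<one>\<^bsub>H\<^esub> = b"
  using left_alg right_alg
  by (simp_all add: left_module_algebra_def right_module_algebra_def left_module_def right_module_def)

lemma act_mult:
  "h \<in> carrier H \<Longrightarrow> k \<in> carrier H \<Longrightarrow> a \<in> carrier A \<Longrightarrow> (h \<otimes>\<^bsub>H\<^esub> k) \<rightharpoonup> a = h \<rightharpoonup> (k \<rightharpoonup> a)"
  "h \<in> carrier H \<Longrightarrow> k \<in> carrier H \<Longrightarrow> b \<in> carrier B \<Longrightarrow> b \<leftharpoonup> (h \<otimes>\<^bsub>H\<^esub> k) = b \<leftharpoonup> h \<leftharpoonup> k"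
  using left_alg right_alg
  by (simp_all add: left_module_algebra_def right_module_algebra_def left_module_def right_module_def)

lemma act_unit:
  "h \<in> carrier H \<Longrightarrow> h \<rightharpoonup> \<one>\<^bsub>A\<^esub> = \<epsilon> h \<odot>\<^bsub>A\<^esub> \<one>\<^bsub>A\<^esub>"
  "h \<in> carrier H \<Longrightarrow> \<one>\<^bsub>B\<^esub> \<leftharpoonup> h = \<epsilon> h \<odot>\<^bsub>B\<^esub> \<one>\<^bsub>B\<^esub>"
  using left_alg right_alg by (simp_all add: left_module_algebra_def right_module_algebra_def)

lemmas lin_\<Psi> = HHH.linear_map_tlift3_body[OF \<Phi>_inverse(2)]
lemmas smash_linear_intros = linear_intros lin_ops lin_tlift_comul lin_\<Psi>

text \<open>
  The sums that arise from \<open>a \<cdot> (h \<triangleright> (a' \<cdot> n))\<close> and from \<open>b \<cdot> (h \<triangleright> (b' \<cdot> m))\<close>; the smash product is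
  assembled from one of each and a further copy of \<open>\<Phi>\<^sup>-\<^sup>1\<close>.
\<close>

definition left_sum where "left_sum V a h a' t = tlift3 K V (\<lambda>x1 x2 x3. tlift K V (\<lambda>h1 h2.
    t ((x1 \<rightharpoonup> a) \<otimes>\<^bsub>A\<^esub> ((x2 \<otimes>\<^bsub>H\<^esub> h1) \<rightharpoonup> a')) (x3 \<otimes>\<^bsub>H\<^esub> h2)) (comul H h)) \<Psi>"

definition right_sum where "right_sum V h b b' t = tlift3 K V (\<lambda>z1 z2 z3. tlift K V (\<lambda>h1 h2.
    t (h1 \<otimes>\<^bsub>H\<^esub> z1) ((b \<leftharpoonup> (h2 \<otimes>\<^bsub>H\<^esub> z2)) \<otimes>\<^bsub>B\<^esub> (b' \<leftharpoonup> z3))) (comul H h)) \<Psi>"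

context
  fixes V :: "('k, 'v, 'w) module_scheme"
  assumes V [simp]: "module K V"
begin

lemma bilinear_comp:
  assumes "bilinear_map K C D V t"
  shows "linear_map K U C f \<Longrightarrow> d \<in> carrier D \<Longrightarrow> linear_map K U V (\<lambda>u. t (f u) d)"
    and "linear_map K U D g \<Longrightarrow> c \<in> carrier C \<Longrightarrow> linear_map K U V (\<lambda>u. t c (g u))"
  by (rule linear_map_comp[OF bilinear_map_left[OF assms]]; assumption)
    (rule linear_map_comp[OF bilinear_map_right[OF assms]]; assumption)

lemma left_sum_bilinear:
  assumes t: "bilinear_map K A H V t" and a: "a \<in> carrier A" and a': "a' \<in> carrier A"
    and x: "x1 \<in> carrier H" "x2 \<in> carrier H" "x3 \<in> carrier H"
  shows "bilinear_map K H H V (\<lambda>h1 h2. t ((x1 \<rightharpoonup> a) \<otimes>\<^bsub>A\<^esub> ((x2 \<otimes>\<^bsub>H\<^esub> h1) \<rightharpoonup> a')) (x3 \<otimes>\<^bsub>H\<^esub> h2))"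
  using assms by (intro smash_linear_intros bilinear_comp[OF t]) simp_all

lemma left_sum_trilinear:
  assumes t: "bilinear_map K A H V t" and a: "a \<in> carrier A" and a': "a' \<in> carrier A" and h: "h \<in> carrier H"
  shows "trilinear_map K H H H V (\<lambda>x1 x2 x3. tlift K V (\<lambda>h1 h2.
    t ((x1 \<rightharpoonup> a) \<otimes>\<^bsub>A\<^esub> ((x2 \<otimes>\<^bsub>H\<^esub> h1) \<rightharpoonup> a')) (x3 \<otimes>\<^bsub>H\<^esub> h2)) (comul H h))"
  using assms by (intro smash_linear_intros left_sum_bilinear[OF t] bilinear_comp[OF t]) simp_all

lemma right_sum_bilinear:
  assumes t: "bilinear_map K H B V t" and b: "b \<in> carrier B" and b': "b' \<in> carrier B"
    and z: "z1 \<in> carrier H" "z2 \<in> carrier H" "z3 \<in> carrier H"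
  shows "bilinear_map K H H V (\<lambda>h1 h2. t (h1 \<otimes>\<^bsub>H\<^esub> z1) ((b \<leftharpoonup> (h2 \<otimes>\<^bsub>H\<^esub> z2)) \<otimes>\<^bsub>B\<^esub> (b' \<leftharpoonup> z3)))"
  using assms by (intro smash_linear_intros bilinear_comp[OF t]) simp_all

lemma right_sum_trilinear:
  assumes t: "bilinear_map K H B V t" and b: "b \<in> carrier B" and b': "b' \<in> carrier B" and h: "h \<in> carrier H"
  shows "trilinear_map K H H H V (\<lambda>z1 z2 z3. tlift K V (\<lambda>h1 h2.
    t (h1 \<otimes>\<^bsub>H\<^esub> z1) ((b \<leftharpoonup> (h2 \<otimes>\<^bsub>H\<^esub> z2)) \<otimes>\<^bsub>B\<^esub> (b' \<leftharpoonup> z3))) (comul H h))"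
  using assms by (intro smash_linear_intros right_sum_bilinear[OF t] bilinear_comp[OF t]) simp_all

lemma left_sum_linear:
  assumes t: "bilinear_map K A H V t"
  shows "linear_map K U A f \<Longrightarrow> module K U \<Longrightarrow> h \<in> carrier H \<Longrightarrow> a' \<in> carrier A \<Longrightarrow>
      linear_map K U V (\<lambda>u. left_sum V (f u) h a' t)"
    and "linear_map K U H g \<Longrightarrow> module K U \<Longrightarrow> a \<in> carrier A \<Longrightarrow> a' \<in> carrier A \<Longrightarrow>
      linear_map K U V (\<lambda>u. left_sum V a (g u) a' t)"
    and "linear_map K U A f \<Longrightarrow> module K U \<Longrightarrow> a \<in> carrier A \<Longrightarrow> h \<in> carrier H \<Longrightarrow>
      linear_map K U V (\<lambda>u. left_sum V a h (f u) t)"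
  unfolding left_sum_def
  by (intro lin_\<Psi> left_sum_trilinear[OF t] lin_tlift_comul left_sum_bilinear[OF t] smash_linear_intros bilinear_comp[OF t];
      simp add: linear_map_closed)+

lemma right_sum_linear:
  assumes t: "bilinear_map K H B V t"
  shows "linear_map K U H g \<Longrightarrow> module K U \<Longrightarrow> b \<in> carrier B \<Longrightarrow> b' \<in> carrier B \<Longrightarrow>
      linear_map K U V (\<lambda>u. right_sum V (g u) b b' t)"
    and "linear_map K U B f \<Longrightarrow> module K U \<Longrightarrow> h \<in> carrier H \<Longrightarrow> b' \<in> carrier B \<Longrightarrow>
      linear_map K U V (\<lambda>u. right_sum V h (f u) b' t)"
    and "linear_map K U B f \<Longrightarrow> module K U \<Longrightarrow> h \<in> carrier H \<Longrightarrow> b \<in> carrier B \<Longrightarrow>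
      linear_map K U V (\<lambda>u. right_sum V h b (f u) t)"
  unfolding right_sum_def
  by (intro lin_\<Psi> right_sum_trilinear[OF t] lin_tlift_comul right_sum_bilinear[OF t] smash_linear_intros bilinear_comp[OF t];
      simp add: linear_map_closed)+

text \<open>Covers a variable that occurs only in the continuation \<open>t\<close>. In
  \<open>smash_sum\<close> the right-hand sum sits inside that continuation, so that
  \<open>y2\<close>, \<open>y3\<close> and \<open>b\<close> enter this way.\<close>

lemma left_sum_param_linear:
  assumes "a \<in> carrier A" "h \<in> carrier H" "a' \<in> carrier A" "module K U"
    "\<And>u. u \<in> carrier U \<Longrightarrow> bilinear_map K A H V (t u)"
    "\<And>p q. p \<in> carrier A \<Longrightarrow> q \<in> carrier H \<Longrightarrow> linear_map K U V (\<lambda>u. t u p q)"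
  shows "linear_map K U V (\<lambda>u. left_sum V a h a' (t u))"
  unfolding left_sum_def using assms by (intro lin_\<Psi> left_sum_trilinear lin_tlift_comul(1) left_sum_bilinear) simp_all

lemma right_sum_param_linear:
  assumes "h \<in> carrier H" "b \<in> carrier B" "b' \<in> carrier B" "module K U"
    "\<And>u. u \<in> carrier U \<Longrightarrow> bilinear_map K H B V (t u)"
    "\<And>p q. p \<in> carrier H \<Longrightarrow> q \<in> carrier B \<Longrightarrow> linear_map K U V (\<lambda>u. t u p q)"
  shows "linear_map K U V (\<lambda>u. right_sum V h b b' (t u))"
  unfolding right_sum_def using assms by (intro lin_\<Psi> right_sum_trilinear lin_tlift_comul(1) right_sum_bilinear) simp_all

lemma left_sum_push:
  assumes t: "bilinear_map K A H V t" and W: "module K W" and g: "linear_map K V W g"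
    and ah: "a \<in> carrier A" "h \<in> carrier H" "a' \<in> carrier A"
  shows "g (left_sum V a h a' t) = left_sum W a h a' (\<lambda>p q. g (t p q))"
proof -
  note tri = left_sum_trilinear[OF t ah(1,3,2)]
  show ?thesis
    unfolding left_sum_def HHH.linear_map_tlift3[OF \<Phi>_inverse(2) V W g tri]
    by (rule HHH.tlift3_cong[OF \<Phi>_inverse(2) W trilinear_map_comp[OF g tri]])
      (rule linear_map_tlift[OF comul_closed[OF ah(2)] mod_H mod_H V W g left_sum_bilinear[OF t ah(1,3)]])
qed

lemma right_sum_push:
  assumes t: "bilinear_map K H B V t" and W: "module K W" and g: "linear_map K V W g"
    and ah: "h \<in> carrier H" "b \<in> carrier B" "b' \<in> carrier B"
  shows "g (right_sum V h b b' t) = right_sum W h b b' (\<lambda>p q. g (t p q))"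
proof -
  note tri = right_sum_trilinear[OF t ah(2,3,1)]
  show ?thesis
    unfolding right_sum_def HHH.linear_map_tlift3[OF \<Phi>_inverse(2) V W g tri]
    by (rule HHH.tlift3_cong[OF \<Phi>_inverse(2) W trilinear_map_comp[OF g tri]])
      (rule linear_map_tlift[OF comul_closed[OF ah(1)] mod_H mod_H V W g right_sum_bilinear[OF t ah(2,3)]])
qed

lemma left_sum_cong:
  assumes t: "bilinear_map K A H V t" and ah: "a \<in> carrier A" "h \<in> carrier H" "a' \<in> carrier A"
    and eq: "\<And>p q. p \<in> carrier A \<Longrightarrow> q \<in> carrier H \<Longrightarrow> t p q = t' p q"
  shows "left_sum V a h a' t = left_sum V a h a' t'"
  unfolding left_sum_def
  by (rule HHH.tlift3_cong[OF \<Phi>_inverse(2) V left_sum_trilinear[OF t ah(1,3,2)]],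
      rule tlift_cong[OF comul_closed[OF ah(2)] mod_H mod_H V left_sum_bilinear[OF t ah(1,3)]])
    (use ah eq in auto)

lemma right_sum_cong:
  assumes t: "bilinear_map K H B V t" and ah: "h \<in> carrier H" "b \<in> carrier B" "b' \<in> carrier B"
    and eq: "\<And>p q. p \<in> carrier H \<Longrightarrow> q \<in> carrier B \<Longrightarrow> t p q = t' p q"
  shows "right_sum V h b b' t = right_sum V h b b' t'"
  unfolding right_sum_def
  by (rule HHH.tlift3_cong[OF \<Phi>_inverse(2) V right_sum_trilinear[OF t ah(2,3,1)]],
      rule tlift_cong[OF comul_closed[OF ah(1)] mod_H mod_H V right_sum_bilinear[OF t ah(2,3)]])
    (use ah eq in auto)

end


text \<open>
  The nesting of the sums is the one produced by the weak actions; it differs from the one in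
  \<open>smash_mult_pure\<close>, so that Fubini is needed below.  The parameter \<open>\<tau>\<close> is \<open>tens3\<close> for the product
  itself and \<open>a \<cdot> (h \<triangleright> (b \<cdot> m))\<close> on a module.
\<close>

definition smash_sum where "smash_sum V \<tau> a h b a' h' b' = tlift3 K V (\<lambda>y1 y2 y3.
  left_sum V a h (y1 \<rightharpoonup> a') (\<lambda>p q. right_sum V h' (b \<leftharpoonup> y3) b' (\<lambda>r s. \<tau> p (q \<otimes>\<^bsub>H\<^esub> y2 \<otimes>\<^bsub>H\<^esub> r) s))) \<Psi>"

context
  fixes V :: "('k, 'v, 'w) module_scheme" and \<tau>
  assumes V [simp]: "module K V" and \<tau>: "trilinear_map K A H B V \<tau>"
begin

lemma \<tau>_linear:
  "linear_map K U A f \<Longrightarrow> q \<in> carrier H \<Longrightarrow> r \<in> carrier B \<Longrightarrow> linear_map K U V (\<lambda>u. \<tau> (f u) q r)"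
  "linear_map K U H g \<Longrightarrow> p \<in> carrier A \<Longrightarrow> r \<in> carrier B \<Longrightarrow> linear_map K U V (\<lambda>u. \<tau> p (g u) r)"
  "linear_map K U B k \<Longrightarrow> p \<in> carrier A \<Longrightarrow> q \<in> carrier H \<Longrightarrow> linear_map K U V (\<lambda>u. \<tau> p q (k u))"
  by (rule linear_map_comp[OF trilinear_map_1[OF \<tau>]] linear_map_comp[OF trilinear_map_2[OF \<tau>]]
      linear_map_comp[OF trilinear_map_3[OF \<tau>]]; assumption)+

lemma smash_sum_inner:
  assumes "p \<in> carrier A" "q \<in> carrier H"
  shows "bilinear_map K H B V (\<lambda>r s. \<tau> p (q \<otimes>\<^bsub>H\<^esub> r) s)"
  using assms by (intro smash_linear_intros \<tau>_linear) simp_all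

lemma smash_sum_mid:
  assumes "h' \<in> carrier H" "b \<in> carrier B" "b' \<in> carrier B" "y \<in> carrier H"
  shows "bilinear_map K A H V (\<lambda>p q. right_sum V h' b b' (\<lambda>r s. \<tau> p (q \<otimes>\<^bsub>H\<^esub> y \<otimes>\<^bsub>H\<^esub> r) s))"
  using assms by (intro bilinear_mapI right_sum_param_linear smash_sum_inner) (simp_all, (intro smash_linear_intros \<tau>_linear; simp)+)

lemma smash_sum_trilinear:
  assumes "a \<in> carrier A" "h \<in> carrier H" "b \<in> carrier B" "a' \<in> carrier A" "h' \<in> carrier H" "b' \<in> carrier B"
  shows "trilinear_map K H H H V (\<lambda>y1 y2 y3.
    left_sum V a h (y1 \<rightharpoonup> a') (\<lambda>p q. right_sum V h' (b \<leftharpoonup> y3) b' (\<lambda>r s. \<tau> p (q \<otimes>\<^bsub>H\<^esub> y2 \<otimes>\<^bsub>H\<^esub> r) s)))"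
  using assms
  by (intro trilinear_mapI left_sum_linear left_sum_param_linear smash_sum_mid right_sum_linear right_sum_param_linear smash_sum_inner smash_linear_intros \<tau>_linear)
    simp_all

lemma smash_sum_linear_left:
  assumes "a' \<in> carrier A" "h' \<in> carrier H" "b' \<in> carrier B"
  shows "trilinear_map K A H B V (\<lambda>a h b. smash_sum V \<tau> a h b a' h' b')"
  unfolding smash_sum_def using assms
  by (intro trilinear_mapI lin_\<Psi> smash_sum_trilinear left_sum_linear left_sum_param_linear smash_sum_mid right_sum_linear right_sum_param_linear
      smash_sum_inner smash_linear_intros \<tau>_linear) simp_all

lemma smash_sum_linear_right:
  assumes "a \<in> carrier A" "h \<in> carrier H" "b \<in> carrier B"
  shows "trilinear_map K A H B V (\<lambda>a' h' b'. smash_sum V \<tau> a h b a' h' b')"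
  unfolding smash_sum_def using assms
  by (intro trilinear_mapI lin_\<Psi> smash_sum_trilinear left_sum_linear left_sum_param_linear smash_sum_mid right_sum_linear right_sum_param_linear
      smash_sum_inner smash_linear_intros \<tau>_linear) simp_all

lemma smash_sum_cong:
  assumes c: "a \<in> carrier A" "h \<in> carrier H" "b \<in> carrier B" "a' \<in> carrier A" "h' \<in> carrier H" "b' \<in> carrier B"
    and eq: "\<And>p q r. p \<in> carrier A \<Longrightarrow> q \<in> carrier H \<Longrightarrow> r \<in> carrier B \<Longrightarrow> \<tau> p q r = \<tau>' p q r"
  shows "smash_sum V \<tau> a h b a' h' b' = smash_sum V \<tau>' a h b a' h' b'"
  unfolding smash_sum_def
  by (rule HHH.tlift3_cong[OF \<Phi>_inverse(2) V smash_sum_trilinear[OF c]], rule left_sum_cong[OF V smash_sum_mid], simp_all add: c,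
      rule right_sum_cong[OF V smash_sum_inner], simp_all add: c eq)

text \<open>The bridge between algebra and module: with \<open>tens3\<close> for \<tau> and the
  action on a fixed m for \<open>g\<close>, a product in the smash product acting on m becomes a sum
  formed in the module itself.\<close>

lemma smash_sum_push:
  assumes W: "module K W" and g: "linear_map K V W g"
    and c: "a \<in> carrier A" "h \<in> carrier H" "b \<in> carrier B" "a' \<in> carrier A" "h' \<in> carrier H" "b' \<in> carrier B"
  shows "g (smash_sum V \<tau> a h b a' h' b') = smash_sum W (\<lambda>p q r. g (\<tau> p q r)) a h b a' h' b'"
proof -
  note tri = smash_sum_trilinear[OF c]
  show ?thesis
    unfolding smash_sum_def HHH.linear_map_tlift3[OF \<Phi>_inverse(2) V W g tri]
  proof (rule HHH.tlift3_cong[OF \<Phi>_inverse(2) W trilinear_map_comp[OF g tri]])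
    fix y1 y2 y3 assume y: "y1 \<in> carrier H" "y2 \<in> carrier H" "y3 \<in> carrier H"
    have mid: "bilinear_map K A H V (\<lambda>p q. right_sum V h' (b \<leftharpoonup> y3) b' (\<lambda>r s. \<tau> p (q \<otimes>\<^bsub>H\<^esub> y2 \<otimes>\<^bsub>H\<^esub> r) s))"
      using y c by (intro smash_sum_mid) simp_all
    have "g (left_sum V a h (y1 \<rightharpoonup> a') (\<lambda>p q. right_sum V h' (b \<leftharpoonup> y3) b' (\<lambda>r s. \<tau> p (q \<otimes>\<^bsub>H\<^esub> y2 \<otimes>\<^bsub>H\<^esub> r) s))) =
      left_sum W a h (y1 \<rightharpoonup> a') (\<lambda>p q. g (right_sum V h' (b \<leftharpoonup> y3) b' (\<lambda>r s. \<tau> p (q \<otimes>\<^bsub>H\<^esub> y2 \<otimes>\<^bsub>H\<^esub> r) s)))"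
      by (rule left_sum_push[OF V mid W g]) (use y c in auto)
    also have "\<dots> = left_sum W a h (y1 \<rightharpoonup> a')
        (\<lambda>p q. right_sum W h' (b \<leftharpoonup> y3) b' (\<lambda>r s. g (\<tau> p (q \<otimes>\<^bsub>H\<^esub> y2 \<otimes>\<^bsub>H\<^esub> r) s)))"
      by (rule left_sum_cong[OF W bilinear_map_comp[OF g mid]], simp_all add: c y,
          rule right_sum_push[OF V smash_sum_inner W g], simp_all add: c y)
    finally show "g (left_sum V a h (y1 \<rightharpoonup> a') (\<lambda>p q. right_sum V h' (b \<leftharpoonup> y3) b' (\<lambda>r s. \<tau> p (q \<otimes>\<^bsub>H\<^esub> y2 \<otimes>\<^bsub>H\<^esub> r) s))) =
      left_sum W a h (y1 \<rightharpoonup> a') (\<lambda>p q. right_sum W h' (b \<leftharpoonup> y3) b' (\<lambda>r s. g (\<tau> p (q \<otimes>\<^bsub>H\<^esub> y2 \<otimes>\<^bsub>H\<^esub> r) s)))" .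
  qed
qed

text \<open>The weak actions nest the sums as y, x, h, z, h', the definition of the product as x, y,
  z, h, h'. Exchanging y with x and h with z reconciles them; what remains is bracketing of products
  in H and of its actions.\<close>

lemma smash_sum_eq_nested:
  assumes c [simp]: "a \<in> carrier A" "h \<in> carrier H" "b \<in> carrier B"
    "a' \<in> carrier A" "h' \<in> carrier H" "b' \<in> carrier B"
  shows "smash_sum V \<tau> a h b a' h' b' =
    tlift3 K V (\<lambda>x1 x2 x3. tlift3 K V (\<lambda>y1 y2 y3. tlift3 K V (\<lambda>z1 z2 z3.
    tlift K V (\<lambda>h1 h2. tlift K V (\<lambda>h1' h2'.
      \<tau> ((x1 \<rightharpoonup> a) \<otimes>\<^bsub>A\<^esub> ((x2 \<otimes>\<^bsub>H\<^esub> h1 \<otimes>\<^bsub>H\<^esub> y1) \<rightharpoonup> a'))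
        (x3 \<otimes>\<^bsub>H\<^esub> h2 \<otimes>\<^bsub>H\<^esub> y2 \<otimes>\<^bsub>H\<^esub> h1' \<otimes>\<^bsub>H\<^esub> z1)
        ((b \<leftharpoonup> (y3 \<otimes>\<^bsub>H\<^esub> h2' \<otimes>\<^bsub>H\<^esub> z2)) \<otimes>\<^bsub>B\<^esub> (b' \<leftharpoonup> z3)))
      (comul H h')) (comul H h)) \<Psi>) \<Psi>) \<Psi>"
    (is "_ = tlift3 K V (\<lambda>x1 x2 x3. tlift3 K V (\<lambda>y1 y2 y3. tlift3 K V (\<lambda>z1 z2 z3.
      tlift K V (\<lambda>h1 h2. ?N x1 x2 x3 y1 y2 y3 z1 z2 z3 h1 h2) _) _) _) _")
proof -
  \<comment> \<open>\<open>?R\<close> keeps the right-hand sum closed, \<open>?S\<close> adds the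
    sum over \<Delta>(h), and \<open>?Z\<close> is the target, with the sum over z outside the one
    over \<Delta>(h).\<close>
  let ?R = "\<lambda>x1 x2 x3 y1 y2 y3 h1 h2. right_sum V h' (b \<leftharpoonup> y3) b' (\<lambda>r s.
      \<tau> ((x1 \<rightharpoonup> a) \<otimes>\<^bsub>A\<^esub> ((x2 \<otimes>\<^bsub>H\<^esub> h1) \<rightharpoonup> (y1 \<rightharpoonup> a'))) (x3 \<otimes>\<^bsub>H\<^esub> h2 \<otimes>\<^bsub>H\<^esub> y2 \<otimes>\<^bsub>H\<^esub> r) s)"
  let ?S = "\<lambda>x1 x2 x3 y1 y2 y3. tlift K V (?R x1 x2 x3 y1 y2 y3) (comul H h)"
  let ?Z = "\<lambda>x1 x2 x3 y1 y2 y3. tlift3 K V (\<lambda>z1 z2 z3.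
      tlift K V (?N x1 x2 x3 y1 y2 y3 z1 z2 z3) (comul H h)) \<Psi>"
  note rules = lin_\<Psi> lin_tlift_comul(1) right_sum_linear right_sum_param_linear smash_sum_inner smash_linear_intros \<tau>_linear
  have R_bil: "bilinear_map K H H V (?R x1 x2 x3 y1 y2 y3)"
    if "x1 \<in> carrier H" "x2 \<in> carrier H" "x3 \<in> carrier H" "y1 \<in> carrier H" "y2 \<in> carrier H" "y3 \<in> carrier H"
    for x1 x2 x3 y1 y2 y3
    using that by (intro rules) simp_all
  have S_tri: "trilinear_map K H H H V (?S x1 x2 x3)"
    if "x1 \<in> carrier H" "x2 \<in> carrier H" "x3 \<in> carrier H" for x1 x2 x3
    using that by (intro R_bil rules) simp_all
  have S_tri': "trilinear_map K H H H V (\<lambda>x1 x2 x3. ?S x1 x2 x3 y1 y2 y3)"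
    if "y1 \<in> carrier H" "y2 \<in> carrier H" "y3 \<in> carrier H" for y1 y2 y3
    using that by (intro R_bil rules) simp_all
  have S_eq: "?S x1 x2 x3 y1 y2 y3 = ?Z x1 x2 x3 y1 y2 y3"
    if [simp]: "x1 \<in> carrier H" "x2 \<in> carrier H" "x3 \<in> carrier H"
      "y1 \<in> carrier H" "y2 \<in> carrier H" "y3 \<in> carrier H" for x1 x2 x3 y1 y2 y3
  proof -
    let ?t = "\<lambda>z1 z2 z3 h1 h2 h1' h2'.
      \<tau> ((x1 \<rightharpoonup> a) \<otimes>\<^bsub>A\<^esub> ((x2 \<otimes>\<^bsub>H\<^esub> h1) \<rightharpoonup> (y1 \<rightharpoonup> a')))
        (x3 \<otimes>\<^bsub>H\<^esub> h2 \<otimes>\<^bsub>H\<^esub> y2 \<otimes>\<^bsub>H\<^esub> (h1' \<otimes>\<^bsub>H\<^esub> z1))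
        ((b \<leftharpoonup> y3 \<leftharpoonup> (h2' \<otimes>\<^bsub>H\<^esub> z2)) \<otimes>\<^bsub>B\<^esub> (b' \<leftharpoonup> z3))"
    let ?G = "\<lambda>z1 z2 z3 h1 h2. tlift K V (?t z1 z2 z3 h1 h2) (comul H h')"
    have G_bil: "bilinear_map K H H V (?G z1 z2 z3)"
      if "z1 \<in> carrier H" "z2 \<in> carrier H" "z3 \<in> carrier H" for z1 z2 z3
      using that by (intro rules) simp_all
    have G_tri: "trilinear_map K H H H V (\<lambda>z1 z2 z3. ?G z1 z2 z3 h1 h2)"
      if "h1 \<in> carrier H" "h2 \<in> carrier H" for h1 h2
      using that by (intro rules) simp_all
    \<comment> \<open>The exchange of h with z: opening the right-hand sum exposes its copy of
      \<open>\<Psi>\<close>, which moves outside \<Delta>(h).\<close>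
    have "?S x1 x2 x3 y1 y2 y3 = tlift3 K V (\<lambda>z1 z2 z3. tlift K V (?G z1 z2 z3) (comul H h)) \<Psi>"
      unfolding right_sum_def
      by (rule HHH.tlift3_swap[OF \<Phi>_inverse(2) comul_closed mod_H mod_H V G_bil G_tri, symmetric]) simp_all
    also have "\<dots> = ?Z x1 x2 x3 y1 y2 y3"
    proof (rule HHH.tlift3_cong[OF \<Phi>_inverse(2) V])
      show "trilinear_map K H H H V (\<lambda>z1 z2 z3. tlift K V (?G z1 z2 z3) (comul H h))"
        by (intro rules) simp_all
      fix z1 z2 z3 assume z [simp]: "z1 \<in> carrier H" "z2 \<in> carrier H" "z3 \<in> carrier H"
      show "tlift K V (?G z1 z2 z3) (comul H h) = tlift K V (?N x1 x2 x3 y1 y2 y3 z1 z2 z3) (comul H h)"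
      proof (rule tlift_cong[OF comul_closed mod_H mod_H V G_bil], simp_all)
        fix h1 h2 assume h [simp]: "h1 \<in> carrier H" "h2 \<in> carrier H"
        show "?G z1 z2 z3 h1 h2 = ?N x1 x2 x3 y1 y2 y3 z1 z2 z3 h1 h2"
        proof (rule tlift_cong[OF comul_closed mod_H mod_H V])
          show "bilinear_map K H H V (?t z1 z2 z3 h1 h2)"
            by (intro rules) simp_all
        qed (simp_all add: act_mult m_assoc)
      qed
    qed
    finally show ?thesis .
  qed
  have "smash_sum V \<tau> a h b a' h' b' = tlift3 K V (\<lambda>y1 y2 y3. tlift3 K V (\<lambda>x1 x2 x3. ?S x1 x2 x3 y1 y2 y3) \<Psi>) \<Psi>"
    by (simp only: smash_sum_def left_sum_def)
  also have "\<dots> = tlift3 K V (\<lambda>x1 x2 x3. tlift3 K V (?S x1 x2 x3) \<Psi>) \<Psi>"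
    by (rule HHH.tlift3_swap3[OF \<Phi>_inverse(2) \<Phi>_inverse(2) mod_H mod_H mod_H V S_tri' S_tri])
  also have "\<dots> = tlift3 K V (\<lambda>x1 x2 x3. tlift3 K V (?Z x1 x2 x3) \<Psi>) \<Psi>"
  proof (rule HHH.tlift3_cong[OF \<Phi>_inverse(2) V])
    show "trilinear_map K H H H V (\<lambda>x1 x2 x3. tlift3 K V (?S x1 x2 x3) \<Psi>)"
      by (intro R_bil rules) simp_all
    fix x1 x2 x3 assume x: "x1 \<in> carrier H" "x2 \<in> carrier H" "x3 \<in> carrier H"
    show "tlift3 K V (?S x1 x2 x3) \<Psi> = tlift3 K V (?Z x1 x2 x3) \<Psi>"
      by (rule HHH.tlift3_cong[OF \<Phi>_inverse(2) V S_tri[OF x]]) (rule S_eq[OF x])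
  qed
  finally show ?thesis .
qed

end

lemma smash_mult_pure_eq:
  assumes "a \<in> carrier A" "h \<in> carrier H" "b \<in> carrier B" "a' \<in> carrier A" "h' \<in> carrier H" "b' \<in> carrier B"
  shows "smash_mult_pure K H A B a h b a' h' b' = smash_sum S (tens3 K A H B) a h b a' h' b'"
  unfolding smash_mult_pure_def by (rule smash_sum_eq_nested[OF module_S(1) AHB.tens3_trilinear assms, symmetric])


section \<open>Products of arbitrary elements of the smash product\<close>

lemma smash_simps [simp]:
  "carrier (smash K H A B) = carrier S"
  "add (smash K H A B) = add S"
  "zero (smash K H A B) = zero S"
  "smult (smash K H A B) = smult S"
  "one (smash K H A B) = tens3 K A H B \<one>\<^bsub>A\<^esub> \<one>\<^bsub>H\<^esub> \<one>\<^bsub>B\<^esub>"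
  by (simp_all add: smash_def)

lemma linear_map_smash [simp]: "linear_map K (smash K H A B) V = linear_map K S V"
  by (simp add: fun_eq_iff linear_map_def)

lemma tens3_closed [simp]:
  "a \<in> carrier A \<Longrightarrow> h \<in> carrier H \<Longrightarrow> b \<in> carrier B \<Longrightarrow> tens3 K A H B a h b \<in> carrier S"
  by (rule trilinear_map_closed[OF AHB.tens3_trilinear])

abbreviation "smash_sum_tens \<equiv> smash_sum S (tens3 K A H B)"

lemmas smash_sum_tens_left = smash_sum_linear_left[OF module_S(1) AHB.tens3_trilinear]
lemmas smash_sum_tens_right = smash_sum_linear_right[OF module_S(1) AHB.tens3_trilinear]

text \<open>Carries the reordering of sums from pure tensors to all elements, so that products are
  computed in the nesting that the weak actions produce.\<close>

lemma smash_mult: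
  assumes s: "s \<in> carrier S" and t: "t \<in> carrier S"
  shows "s \<otimes>\<^bsub>smash K H A B\<^esub> t =
    tlift3 K S (\<lambda>a h b. tlift3 K S (\<lambda>a' h' b'. smash_sum_tens a h b a' h' b') t) s"
proof -
  have "tlift3 K S (\<lambda>a h b. tlift3 K S (\<lambda>a' h' b'. smash_sum_tens a h b a' h' b') t) s =
    tlift3 K S (\<lambda>a h b. tlift3 K S (\<lambda>a' h' b'. smash_mult_pure K H A B a h b a' h' b') t) s"
  proof (rule AHB.tlift3_cong[OF s module_S(1)])
    show "trilinear_map K A H B S (\<lambda>a h b. tlift3 K S (\<lambda>a' h' b'. smash_sum_tens a h b a' h' b') t)"
      by (intro trilinear_mapI AHB.linear_map_tlift3_body[OF t module_S(1)] smash_sum_tens_right)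
        (auto intro: trilinear_map_1[OF smash_sum_tens_left] trilinear_map_2[OF smash_sum_tens_left] trilinear_map_3[OF smash_sum_tens_left])
    fix a h b assume "a \<in> carrier A" "h \<in> carrier H" "b \<in> carrier B"
    then show "tlift3 K S (\<lambda>a' h' b'. smash_sum_tens a h b a' h' b') t =
      tlift3 K S (\<lambda>a' h' b'. smash_mult_pure K H A B a h b a' h' b') t"
      by (intro AHB.tlift3_cong[OF t module_S(1)] smash_sum_tens_right) (simp_all add: smash_mult_pure_eq)
  qed
  then show ?thesis by (simp add: smash_def)
qed

lemma smash_mult_trilinear:
  assumes t: "t \<in> carrier S"
  shows "trilinear_map K A H B S (\<lambda>a h b. tlift3 K S (\<lambda>a' h' b'. smash_sum_tens a h b a' h' b') t)"
  by (intro trilinear_mapI AHB.linear_map_tlift3_body[OF t module_S(1)] smash_sum_tens_right)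
    (auto intro: trilinear_map_1[OF smash_sum_tens_left] trilinear_map_2[OF smash_sum_tens_left] trilinear_map_3[OF smash_sum_tens_left])

lemma smash_mult_tens3:
  assumes c: "a \<in> carrier A" "h \<in> carrier H" "b \<in> carrier B" "a' \<in> carrier A" "h' \<in> carrier H" "b' \<in> carrier B"
  shows "tens3 K A H B a h b \<otimes>\<^bsub>smash K H A B\<^esub> tens3 K A H B a' h' b' = smash_sum_tens a h b a' h' b'"
  using c by (simp add: smash_mult AHB.tlift3_tens3 smash_mult_trilinear smash_sum_tens_right)

lemma smash_mult_linear:
  assumes s: "s \<in> carrier S"
  shows "linear_map K S S (\<lambda>t. t \<otimes>\<^bsub>smash K H A B\<^esub> s)" "linear_map K S S (\<lambda>t. s \<otimes>\<^bsub>smash K H A B\<^esub> t)"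
proof -
  show "linear_map K S S (\<lambda>t. t \<otimes>\<^bsub>smash K H A B\<^esub> s)"
    by (rule linear_map_cong[OF AHB.tlift3_linear[OF module_S(1) smash_mult_trilinear[OF s]] module_S(1)])
      (simp add: smash_mult s)
  have "linear_map K S S (\<lambda>t. tlift3 K S (\<lambda>a h b. tlift3 K S (\<lambda>a' h' b'. smash_sum_tens a h b a' h' b') t) s)"
    by (intro AHB.linear_map_tlift3_body[OF s module_S(1)] smash_mult_trilinear module_S AHB.tlift3_linear smash_sum_tens_right)
  then show "linear_map K S S (\<lambda>t. s \<otimes>\<^bsub>smash K H A B\<^esub> t)"
    by (rule linear_map_cong[OF _ module_S(1)]) (simp add: smash_mult s)
qed

lemma smash_mult_closed [simp]:
  "s \<in> carrier S \<Longrightarrow> t \<in> carrier S \<Longrightarrow> s \<otimes>\<^bsub>smash K H A B\<^esub> t \<in> carrier S"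
  by (rule linear_map_closed[OF smash_mult_linear(1)])

text \<open>The axiom for the action on the unit in the shape demanded by the collapse of sums: the
  action of the unit of H is left unsimplified, so that the right-hand side is literally
  \<epsilon>(h) times the summand with 1 in that leg.\<close>

lemma linear_unit_act:
  assumes "linear_map K A V f" "h \<in> carrier H"
  shows "f (h \<rightharpoonup> \<one>\<^bsub>A\<^esub>) = \<epsilon> h \<odot>\<^bsub>V\<^esub> f (\<one>\<^bsub>H\<^esub> \<rightharpoonup> \<one>\<^bsub>A\<^esub>)"
  using assms by (simp add: act_unit(1)[of h] linear_map_smult[OF assms(1)])

lemma linear_act_unit:
  assumes "linear_map K B V f" "h \<in> carrier H"
  shows "f (\<one>\<^bsub>B\<^esub> \<leftharpoonup> h) = \<epsilon> h \<odot>\<^bsub>V\<^esub> f (\<one>\<^bsub>B\<^esub> \<leftharpoonup> \<one>\<^bsub>H\<^esub>)"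
  using assms by (simp add: act_unit(2)[of h] linear_map_smult[OF assms(1)])

section \<open>Sums and products with a unit in some argument\<close>

context
  fixes V :: "('k, 'v, 'w) module_scheme"
  assumes V [simp]: "module K V"
begin

context
  fixes t
  assumes t: "bilinear_map K A H V t"
begin

text \<open>Leg 1 of \<open>\<Psi>\<close> acts on the unit, so the copy of \<open>\<Psi>\<close>
  collapses and only the sum over \<Delta>(h) remains.\<close>

lemma left_sum_unit_left:
  assumes [simp]: "h \<in> carrier H" "a' \<in> carrier A"
  shows "left_sum V \<one>\<^bsub>A\<^esub> h a' t = tlift K V (\<lambda>h1 h2. t (h1 \<rightharpoonup> a') h2) (comul H h)"
proof -
  let ?f = "\<lambda>p x2 x3. tlift K V (\<lambda>h1 h2. t (p \<otimes>\<^bsub>A\<^esub> ((x2 \<otimes>\<^bsub>H\<^esub> h1) \<rightharpoonup> a')) (x3 \<otimes>\<^bsub>H\<^esub> h2)) (comul H h)"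
  have "left_sum V \<one>\<^bsub>A\<^esub> h a' t = ?f (\<one>\<^bsub>H\<^esub> \<rightharpoonup> \<one>\<^bsub>A\<^esub>) \<one>\<^bsub>H\<^esub> \<one>\<^bsub>H\<^esub>"
    unfolding left_sum_def
  proof (rule tlift3_reassoc_inv_counit[OF V left_sum_trilinear[OF V t]], simp_all only: assms unit_closed,
      rule disjI1, intro ballI)
    fix x1 x2 x3 assume [simp]: "x1 \<in> carrier H" "x2 \<in> carrier H" "x3 \<in> carrier H"
    have "linear_map K A V (\<lambda>p. ?f p x2 x3)" by (intro smash_linear_intros bilinear_comp[OF V t]) simp_all
    then show "?f (x1 \<rightharpoonup> \<one>\<^bsub>A\<^esub>) x2 x3 = \<epsilon> x1 \<odot>\<^bsub>V\<^esub> ?f (\<one>\<^bsub>H\<^esub> \<rightharpoonup> \<one>\<^bsub>A\<^esub>) x2 x3"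
      by (rule linear_unit_act) simp
  qed
  also have "\<dots> = tlift K V (\<lambda>h1 h2. t (h1 \<rightharpoonup> a') h2) (comul H h)"
    by (rule tlift_cong[OF comul_closed mod_H mod_H V left_sum_bilinear[OF V t]]) simp_all
  finally show ?thesis .
qed

text \<open>The product of x2 and h1 acts on the unit. The part h1 turns into \<epsilon>(h1), which
  reduces \<Delta>(h) to h; then x2 turns into \<epsilon>(x2), and \<open>\<Psi>\<close> collapses
  through leg 2.\<close>

lemma left_sum_unit_right:
  assumes [simp]: "h \<in> carrier H" "a \<in> carrier A"
  shows "left_sum V a h \<one>\<^bsub>A\<^esub> t = t a h"
proof -
  let ?g = "\<lambda>x1 x2 x3. t ((x1 \<rightharpoonup> a) \<otimes>\<^bsub>A\<^esub> (x2 \<rightharpoonup> \<one>\<^bsub>A\<^esub>)) (x3 \<otimes>\<^bsub>H\<^esub> h)"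
  have lin: "linear_map K A V (\<lambda>p. t ((x1 \<rightharpoonup> a) \<otimes>\<^bsub>A\<^esub> p) q)"
    if "x1 \<in> carrier H" "q \<in> carrier H" for x1 q
    using that by (intro smash_linear_intros bilinear_comp[OF V t]) simp_all
  have "left_sum V a h \<one>\<^bsub>A\<^esub> t = tlift3 K V ?g \<Psi>"
    unfolding left_sum_def
  proof (rule HHH.tlift3_cong[OF \<Phi>_inverse(2) V left_sum_trilinear[OF V t]], simp_all only: assms unit_closed)
    fix x1 x2 x3 assume x [simp]: "x1 \<in> carrier H" "x2 \<in> carrier H" "x3 \<in> carrier H"
    let ?F = "\<lambda>h1 h2. t ((x1 \<rightharpoonup> a) \<otimes>\<^bsub>A\<^esub> ((x2 \<otimes>\<^bsub>H\<^esub> h1) \<rightharpoonup> \<one>\<^bsub>A\<^esub>)) (x3 \<otimes>\<^bsub>H\<^esub> h2)"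
    have "tlift K V ?F (comul H h) = ?F \<one>\<^bsub>H\<^esub> h"
    proof (rule tlift_comul_counit(1)[OF V left_sum_bilinear[OF V t]], simp_all only: assms x unit_closed)
      fix h1 h2 assume [simp]: "h1 \<in> carrier H" "h2 \<in> carrier H"
      have "linear_map K A V (\<lambda>p. t ((x1 \<rightharpoonup> a) \<otimes>\<^bsub>A\<^esub> (x2 \<rightharpoonup> p)) (x3 \<otimes>\<^bsub>H\<^esub> h2))"
        by (intro smash_linear_intros bilinear_comp[OF V t]) simp_all
      from linear_unit_act[OF this, of h1] show "?F h1 h2 = \<epsilon> h1 \<odot>\<^bsub>V\<^esub> ?F \<one>\<^bsub>H\<^esub> h2"
        by (simp add: act_mult)
    qed
    then show "tlift K V ?F (comul H h) = ?g x1 x2 x3" by simp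
  qed
  also have "\<dots> = ?g \<one>\<^bsub>H\<^esub> \<one>\<^bsub>H\<^esub> \<one>\<^bsub>H\<^esub>"
  proof (rule tlift3_reassoc_inv_counit[OF V])
    show "trilinear_map K H H H V ?g" by (intro smash_linear_intros bilinear_comp[OF V t]) simp_all
  qed (rule disjI2, rule disjI1, intro ballI linear_unit_act[OF lin], simp_all)
  finally show ?thesis by simp
qed

lemma left_sum_one:
  assumes [simp]: "a \<in> carrier A" "a' \<in> carrier A"
  shows "left_sum V a \<one>\<^bsub>H\<^esub> a' t = tlift3 K V (\<lambda>x1 x2 x3. t ((x1 \<rightharpoonup> a) \<otimes>\<^bsub>A\<^esub> (x2 \<rightharpoonup> a')) x3) \<Psi>"
  unfolding left_sum_def
  by (rule HHH.tlift3_cong[OF \<Phi>_inverse(2) V left_sum_trilinear[OF V t]])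
    (simp_all add: tlift_comul_one left_sum_bilinear[OF V t])

lemma left_sum_unit_one:
  assumes [simp]: "a' \<in> carrier A"
  shows "left_sum V \<one>\<^bsub>A\<^esub> \<one>\<^bsub>H\<^esub> a' t = t a' \<one>\<^bsub>H\<^esub>"
proof -
  have "bilinear_map K H H V (\<lambda>h1 h2. t (h1 \<rightharpoonup> a') h2)" by (intro smash_linear_intros bilinear_comp[OF V t]) simp_all
  then show ?thesis by (simp add: left_sum_unit_left tlift_comul_one)
qed

end

context
  fixes t
  assumes t: "bilinear_map K H B V t"
begin

text \<open>Here the product of h2 and z2 acts on the unit: \<Delta>(h) collapses through its right
  factor, then \<open>\<Psi>\<close> through leg 2.\<close>

lemma right_sum_unit_left:
  assumes [simp]: "h \<in> carrier H" "b' \<in> carrier B"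
  shows "right_sum V h \<one>\<^bsub>B\<^esub> b' t = t h b'"
proof -
  let ?g = "\<lambda>z1 z2 z3. t (h \<otimes>\<^bsub>H\<^esub> z1) ((\<one>\<^bsub>B\<^esub> \<leftharpoonup> z2) \<otimes>\<^bsub>B\<^esub> (b' \<leftharpoonup> z3))"
  have lin: "linear_map K B V (\<lambda>p. t q (p \<otimes>\<^bsub>B\<^esub> (b' \<leftharpoonup> z3)))"
    if "z3 \<in> carrier H" "q \<in> carrier H" for z3 q
    using that by (intro smash_linear_intros bilinear_comp[OF V t]) simp_all
  have "right_sum V h \<one>\<^bsub>B\<^esub> b' t = tlift3 K V ?g \<Psi>"
    unfolding right_sum_def
  proof (rule HHH.tlift3_cong[OF \<Phi>_inverse(2) V right_sum_trilinear[OF V t]], simp_all only: assms unit_closed)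
    fix z1 z2 z3 assume z [simp]: "z1 \<in> carrier H" "z2 \<in> carrier H" "z3 \<in> carrier H"
    let ?F = "\<lambda>h1 h2. t (h1 \<otimes>\<^bsub>H\<^esub> z1) ((\<one>\<^bsub>B\<^esub> \<leftharpoonup> (h2 \<otimes>\<^bsub>H\<^esub> z2)) \<otimes>\<^bsub>B\<^esub> (b' \<leftharpoonup> z3))"
    have "tlift K V ?F (comul H h) = ?F h \<one>\<^bsub>H\<^esub>"
    proof (rule tlift_comul_counit(2)[OF V right_sum_bilinear[OF V t]], simp_all only: assms z unit_closed)
      fix h1 h2 assume [simp]: "h1 \<in> carrier H" "h2 \<in> carrier H"
      have "linear_map K B V (\<lambda>p. t (h1 \<otimes>\<^bsub>H\<^esub> z1) ((p \<leftharpoonup> z2) \<otimes>\<^bsub>B\<^esub> (b' \<leftharpoonup> z3)))"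
        by (intro smash_linear_intros bilinear_comp[OF V t]) simp_all
      from linear_act_unit[OF this, of h2] show "?F h1 h2 = \<epsilon> h2 \<odot>\<^bsub>V\<^esub> ?F h1 \<one>\<^bsub>H\<^esub>"
        by (simp add: act_mult)
    qed
    then show "tlift K V ?F (comul H h) = ?g z1 z2 z3" by simp
  qed
  also have "\<dots> = ?g \<one>\<^bsub>H\<^esub> \<one>\<^bsub>H\<^esub> \<one>\<^bsub>H\<^esub>"
  proof (rule tlift3_reassoc_inv_counit[OF V])
    show "trilinear_map K H H H V ?g" by (intro smash_linear_intros bilinear_comp[OF V t]) simp_all
  qed (rule disjI2, rule disjI1, intro ballI linear_act_unit[OF lin], simp_all)
  finally show ?thesis by simp
qed

text \<open>Only leg 3 of \<open>\<Psi>\<close> meets the unit, so \<open>\<Psi>\<close> disappears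
  while \<Delta>(h) stays.\<close>

lemma right_sum_unit_right:
  assumes [simp]: "h \<in> carrier H" "b \<in> carrier B"
  shows "right_sum V h b \<one>\<^bsub>B\<^esub> t = tlift K V (\<lambda>h1 h2. t h1 (b \<leftharpoonup> h2)) (comul H h)"
proof -
  let ?f = "\<lambda>z1 z2 p. tlift K V (\<lambda>h1 h2. t (h1 \<otimes>\<^bsub>H\<^esub> z1) ((b \<leftharpoonup> (h2 \<otimes>\<^bsub>H\<^esub> z2)) \<otimes>\<^bsub>B\<^esub> p)) (comul H h)"
  have "right_sum V h b \<one>\<^bsub>B\<^esub> t = ?f \<one>\<^bsub>H\<^esub> \<one>\<^bsub>H\<^esub> (\<one>\<^bsub>B\<^esub> \<leftharpoonup> \<one>\<^bsub>H\<^esub>)"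
    unfolding right_sum_def
  proof (rule tlift3_reassoc_inv_counit[OF V right_sum_trilinear[OF V t]], simp_all only: assms unit_closed,
      rule disjI2, rule disjI2, intro ballI)
    fix z1 z2 z3 assume [simp]: "z1 \<in> carrier H" "z2 \<in> carrier H" "z3 \<in> carrier H"
    have "linear_map K B V (\<lambda>p. ?f z1 z2 p)" by (intro smash_linear_intros bilinear_comp[OF V t]) simp_all
    then show "?f z1 z2 (\<one>\<^bsub>B\<^esub> \<leftharpoonup> z3) = \<epsilon> z3 \<odot>\<^bsub>V\<^esub> ?f z1 z2 (\<one>\<^bsub>B\<^esub> \<leftharpoonup> \<one>\<^bsub>H\<^esub>)"
      by (rule linear_act_unit) simp
  qed
  also have "\<dots> = tlift K V (\<lambda>h1 h2. t h1 (b \<leftharpoonup> h2)) (comul H h)"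
    by (rule tlift_cong[OF comul_closed mod_H mod_H V right_sum_bilinear[OF V t]]) simp_all
  finally show ?thesis .
qed

lemma right_sum_one:
  assumes [simp]: "b \<in> carrier B" "b' \<in> carrier B"
  shows "right_sum V \<one>\<^bsub>H\<^esub> b b' t = tlift3 K V (\<lambda>z1 z2 z3. t z1 ((b \<leftharpoonup> z2) \<otimes>\<^bsub>B\<^esub> (b' \<leftharpoonup> z3))) \<Psi>"
  unfolding right_sum_def
  by (rule HHH.tlift3_cong[OF \<Phi>_inverse(2) V right_sum_trilinear[OF V t]])
    (simp_all add: tlift_comul_one right_sum_bilinear[OF V t])

lemma right_sum_unit_one:
  assumes [simp]: "b \<in> carrier B"
  shows "right_sum V \<one>\<^bsub>H\<^esub> b \<one>\<^bsub>B\<^esub> t = t \<one>\<^bsub>H\<^esub> b"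
proof -
  have "bilinear_map K H H V (\<lambda>h1 h2. t h1 (b \<leftharpoonup> h2))" by (intro smash_linear_intros bilinear_comp[OF V t]) simp_all
  then show ?thesis by (simp add: right_sum_unit_right tlift_comul_one)
qed

end

context
  fixes \<tau>
  assumes \<tau>: "trilinear_map K A H B V \<tau>"
begin

text \<open>The component y1 acts on the unit of A, so the copy of \<open>\<Psi>\<close> with
  variable y collapses through leg 1. The left-hand sum then has a unit as its second element of A
  and becomes a single evaluation.\<close>

lemma smash_sum_unit_right:
  assumes [simp]: "a \<in> carrier A" "h \<in> carrier H" "b \<in> carrier B" "h' \<in> carrier H" "b' \<in> carrier B"
  shows "smash_sum V \<tau> a h b \<one>\<^bsub>A\<^esub> h' b' = right_sum V h' b b' (\<lambda>r s. \<tau> a (h \<otimes>\<^bsub>H\<^esub> r) s)"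
proof -
  let ?f = "\<lambda>p y2 y3. left_sum V a h p (\<lambda>p q. right_sum V h' (b \<leftharpoonup> y3) b' (\<lambda>r s. \<tau> p (q \<otimes>\<^bsub>H\<^esub> y2 \<otimes>\<^bsub>H\<^esub> r) s))"
  have mid: "bilinear_map K A H V (\<lambda>p q. right_sum V h' (b \<leftharpoonup> y3) b' (\<lambda>r s. \<tau> p (q \<otimes>\<^bsub>H\<^esub> y2 \<otimes>\<^bsub>H\<^esub> r) s))"
    if "y2 \<in> carrier H" "y3 \<in> carrier H" for y2 y3
    using that by (intro smash_sum_mid[OF V \<tau>]) simp_all
  have "smash_sum V \<tau> a h b \<one>\<^bsub>A\<^esub> h' b' = ?f (\<one>\<^bsub>H\<^esub> \<rightharpoonup> \<one>\<^bsub>A\<^esub>) \<one>\<^bsub>H\<^esub> \<one>\<^bsub>H\<^esub>"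
    unfolding smash_sum_def
  proof (rule tlift3_reassoc_inv_counit[OF V smash_sum_trilinear[OF V \<tau>]], simp_all only: assms unit_closed,
      rule disjI1, intro ballI)
    fix y1 y2 y3 assume [simp]: "y1 \<in> carrier H" "y2 \<in> carrier H" "y3 \<in> carrier H"
    have "linear_map K A V (\<lambda>p. ?f p y2 y3)"
      by (intro left_sum_linear(3)[OF V mid] linear_map_ident) simp_all
    then show "?f (y1 \<rightharpoonup> \<one>\<^bsub>A\<^esub>) y2 y3 = \<epsilon> y1 \<odot>\<^bsub>V\<^esub> ?f (\<one>\<^bsub>H\<^esub> \<rightharpoonup> \<one>\<^bsub>A\<^esub>) y2 y3"
      by (rule linear_unit_act) simp
  qed
  then show ?thesis using left_sum_unit_right[OF mid, of "\<one>\<^bsub>H\<^esub>" "\<one>\<^bsub>H\<^esub>" h a] by simp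
qed

text \<open>Now y3 acts on the unit of B and the copy with variable y collapses through leg 3. The
  right-hand sum then starts with a unit and becomes a single evaluation.\<close>

lemma smash_sum_unit_left:
  assumes [simp]: "a \<in> carrier A" "h \<in> carrier H" "a' \<in> carrier A" "h' \<in> carrier H" "b' \<in> carrier B"
  shows "smash_sum V \<tau> a h \<one>\<^bsub>B\<^esub> a' h' b' = left_sum V a h a' (\<lambda>p q. \<tau> p (q \<otimes>\<^bsub>H\<^esub> h') b')"
proof -
  let ?f = "\<lambda>y1 y2 s. left_sum V a h (y1 \<rightharpoonup> a') (\<lambda>p q. right_sum V h' s b' (\<lambda>r s. \<tau> p (q \<otimes>\<^bsub>H\<^esub> y2 \<otimes>\<^bsub>H\<^esub> r) s))"
  have "smash_sum V \<tau> a h \<one>\<^bsub>B\<^esub> a' h' b' = ?f \<one>\<^bsub>H\<^esub> \<one>\<^bsub>H\<^esub> (\<one>\<^bsub>B\<^esub> \<leftharpoonup> \<one>\<^bsub>H\<^esub>)"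
    unfolding smash_sum_def
  proof (rule tlift3_reassoc_inv_counit[OF V smash_sum_trilinear[OF V \<tau>]], simp_all only: assms unit_closed,
      rule disjI2, rule disjI2, intro ballI)
    fix y1 y2 y3 assume [simp]: "y1 \<in> carrier H" "y2 \<in> carrier H" "y3 \<in> carrier H"
    have "linear_map K B V (\<lambda>s. ?f y1 y2 s)"
      by (intro left_sum_param_linear[OF V] smash_sum_mid[OF V \<tau>] right_sum_linear(2)[OF V] smash_sum_inner[OF V \<tau>] linear_map_ident)
        simp_all
    then show "?f y1 y2 (\<one>\<^bsub>B\<^esub> \<leftharpoonup> y3) = \<epsilon> y3 \<odot>\<^bsub>V\<^esub> ?f y1 y2 (\<one>\<^bsub>B\<^esub> \<leftharpoonup> \<one>\<^bsub>H\<^esub>)"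
      by (rule linear_act_unit) simp
  qed
  also have "\<dots> = left_sum V a h a' (\<lambda>p q. right_sum V h' \<one>\<^bsub>B\<^esub> b' (\<lambda>r s. \<tau> p (q \<otimes>\<^bsub>H\<^esub> \<one>\<^bsub>H\<^esub> \<otimes>\<^bsub>H\<^esub> r) s))" by simp
  also have "\<dots> = left_sum V a h a' (\<lambda>p q. \<tau> p (q \<otimes>\<^bsub>H\<^esub> h') b')"
    by (rule left_sum_cong[OF V smash_sum_mid[OF V \<tau>]]) (simp_all add: right_sum_unit_left[OF smash_sum_inner[OF V \<tau>]])
  finally show ?thesis .
qed

lemma smash_sum_inner_left:
  "h \<in> carrier H \<Longrightarrow> b \<in> carrier B \<Longrightarrow> bilinear_map K A H V (\<lambda>p q. \<tau> p (q \<otimes>\<^bsub>H\<^esub> h) b)"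
  by (intro smash_linear_intros \<tau>_linear[OF V \<tau>]) simp_all

text \<open>The source of the factorisation of a # h # b: the two units in the middle remove all
  three copies of \<open>\<Psi>\<close> and both coproducts.\<close>

lemma smash_sum_AHB:
  "a \<in> carrier A \<Longrightarrow> h \<in> carrier H \<Longrightarrow> h' \<in> carrier H \<Longrightarrow> b' \<in> carrier B \<Longrightarrow>
    smash_sum V \<tau> a h \<one>\<^bsub>B\<^esub> \<one>\<^bsub>A\<^esub> h' b' = \<tau> a (h \<otimes>\<^bsub>H\<^esub> h') b'"
  by (simp add: smash_sum_unit_left left_sum_unit_right smash_sum_inner_left)

text \<open>With the action on m for \<tau>, this and the next four products are the right-hand
  sides of the five relations in \<open>ahb_object\<close>; each shows the one copy of
  \<open>\<Psi>\<close> or \<Delta> that meets no unit.\<close>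

lemma smash_sum_AA:
  "a \<in> carrier A \<Longrightarrow> a' \<in> carrier A \<Longrightarrow> smash_sum V \<tau> a \<one>\<^bsub>H\<^esub> \<one>\<^bsub>B\<^esub> a' \<one>\<^bsub>H\<^esub> \<one>\<^bsub>B\<^esub> =
    tlift3 K V (\<lambda>x1 x2 x3. \<tau> ((x1 \<rightharpoonup> a) \<otimes>\<^bsub>A\<^esub> (x2 \<rightharpoonup> a')) (x3 \<otimes>\<^bsub>H\<^esub> \<one>\<^bsub>H\<^esub>) \<one>\<^bsub>B\<^esub>) \<Psi>"
  by (simp add: smash_sum_unit_left left_sum_one smash_sum_inner_left)

lemma smash_sum_HA:
  "h \<in> carrier H \<Longrightarrow> a' \<in> carrier A \<Longrightarrow> smash_sum V \<tau> \<one>\<^bsub>A\<^esub> h \<one>\<^bsub>B\<^esub> a' \<one>\<^bsub>H\<^esub> \<one>\<^bsub>B\<^esub> =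
    tlift K V (\<lambda>h1 h2. \<tau> (h1 \<rightharpoonup> a') (h2 \<otimes>\<^bsub>H\<^esub> \<one>\<^bsub>H\<^esub>) \<one>\<^bsub>B\<^esub>) (comul H h)"
  by (simp add: smash_sum_unit_left left_sum_unit_left smash_sum_inner_left)

lemma smash_sum_BB:
  "b \<in> carrier B \<Longrightarrow> b' \<in> carrier B \<Longrightarrow> smash_sum V \<tau> \<one>\<^bsub>A\<^esub> \<one>\<^bsub>H\<^esub> b \<one>\<^bsub>A\<^esub> \<one>\<^bsub>H\<^esub> b' =
    tlift3 K V (\<lambda>z1 z2 z3. \<tau> \<one>\<^bsub>A\<^esub> (\<one>\<^bsub>H\<^esub> \<otimes>\<^bsub>H\<^esub> z1) ((b \<leftharpoonup> z2) \<otimes>\<^bsub>B\<^esub> (b' \<leftharpoonup> z3))) \<Psi>"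
  by (simp add: smash_sum_unit_right right_sum_one smash_sum_inner[OF V \<tau>])

lemma smash_sum_BH:
  "b \<in> carrier B \<Longrightarrow> h \<in> carrier H \<Longrightarrow> smash_sum V \<tau> \<one>\<^bsub>A\<^esub> \<one>\<^bsub>H\<^esub> b \<one>\<^bsub>A\<^esub> h \<one>\<^bsub>B\<^esub> =
    tlift K V (\<lambda>h1 h2. \<tau> \<one>\<^bsub>A\<^esub> (\<one>\<^bsub>H\<^esub> \<otimes>\<^bsub>H\<^esub> h1) (b \<leftharpoonup> h2)) (comul H h)"
  by (simp add: smash_sum_unit_right right_sum_unit_right smash_sum_inner[OF V \<tau>])

text \<open>The units sit on the outer sides, so the left-hand and right-hand sums are trivial. The
  copy of \<open>\<Psi>\<close> with variable y, which takes b past a, survives whole.\<close>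

lemma smash_sum_BA:
  assumes [simp]: "b \<in> carrier B" "a \<in> carrier A"
  shows "smash_sum V \<tau> \<one>\<^bsub>A\<^esub> \<one>\<^bsub>H\<^esub> b a \<one>\<^bsub>H\<^esub> \<one>\<^bsub>B\<^esub> = tlift3 K V (\<lambda>y1 y2 y3. \<tau> (y1 \<rightharpoonup> a) y2 (b \<leftharpoonup> y3)) \<Psi>"
  unfolding smash_sum_def
  by (rule HHH.tlift3_cong[OF \<Phi>_inverse(2) V smash_sum_trilinear[OF V \<tau>]])
    (simp_all add: left_sum_unit_one smash_sum_mid[OF V \<tau>] right_sum_unit_one smash_sum_inner[OF V \<tau>])

end

end

end


section \<open>From compatible weak actions to modules over the smash product\<close>

text \<open>The relations as rules for bare functions, free of the record and of extensionality. It
  serves both for given objects and for the actions constructed from a module over the smash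
  product.\<close>

locale ahb_module = smash_product K H A B
  for K :: "('k, 'r) ring_scheme" (structure)
    and H :: "('k, 'h, 'x) quasi_bialg_scheme" (structure)
    and A :: "('k, 'h, 'a, 'y) left_mod_alg_scheme"
    and B :: "('k, 'h, 'b, 'z) right_mod_alg_scheme" +
  fixes V :: "('k, 'v, 'w) module_scheme" and \<alpha> \<eta> \<beta>
  assumes act_H: "left_module K H V \<eta>"
    and act_A: "bilinear_map K A V V \<alpha>" and act_B: "bilinear_map K B V V \<beta>"
    and act_units: "m \<in> carrier V \<Longrightarrow> \<alpha> \<one>\<^bsub>A\<^esub> m = m" "m \<in> carrier V \<Longrightarrow> \<beta> \<one>\<^bsub>B\<^esub> m = m"
    and rel_AA: "a \<in> carrier A \<Longrightarrow> a' \<in> carrier A \<Longrightarrow> m \<in> carrier V \<Longrightarrow>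
      \<alpha> a (\<alpha> a' m) = tlift3 K V (\<lambda>x1 x2 x3. \<alpha> ((x1 \<rightharpoonup> a) \<otimes>\<^bsub>A\<^esub> (x2 \<rightharpoonup> a')) (\<eta> x3 m)) \<Psi>"
    and rel_HA: "h \<in> carrier H \<Longrightarrow> a \<in> carrier A \<Longrightarrow> m \<in> carrier V \<Longrightarrow>
      \<eta> h (\<alpha> a m) = tlift K V (\<lambda>h1 h2. \<alpha> (h1 \<rightharpoonup> a) (\<eta> h2 m)) (comul H h)"
    and rel_BB: "b \<in> carrier B \<Longrightarrow> b' \<in> carrier B \<Longrightarrow> m \<in> carrier V \<Longrightarrow>
      \<beta> b (\<beta> b' m) = tlift3 K V (\<lambda>x1 x2 x3. \<eta> x1 (\<beta> ((b \<leftharpoonup> x2) \<otimes>\<^bsub>B\<^esub> (b' \<leftharpoonup> x3)) m)) \<Psi>"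
    and rel_BH: "b \<in> carrier B \<Longrightarrow> h \<in> carrier H \<Longrightarrow> m \<in> carrier V \<Longrightarrow>
      \<beta> b (\<eta> h m) = tlift K V (\<lambda>h1 h2. \<eta> h1 (\<beta> (b \<leftharpoonup> h2) m)) (comul H h)"
    and rel_BA: "b \<in> carrier B \<Longrightarrow> a \<in> carrier A \<Longrightarrow> m \<in> carrier V \<Longrightarrow>
      \<beta> b (\<alpha> a m) = tlift3 K V (\<lambda>y1 y2 y3. \<alpha> (y1 \<rightharpoonup> a) (\<eta> y2 (\<beta> (b \<leftharpoonup> y3) m))) \<Psi>"
begin

lemma module_V [simp]: "module K V"
  using act_H by (simp add: left_module_def)

lemma bilinear_acts: "bilinear_map K A V V \<alpha>" "bilinear_map K H V V \<eta>" "bilinear_map K B V V \<beta>"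
  using act_A act_B act_H by (simp_all add: left_module_def)

lemmas acts_closed [simp] = bilinear_acts[THEN bilinear_map_closed]
lemmas lin_acts = bilinear_acts[THEN bilinear_map_left, THEN linear_map_comp]
  bilinear_acts[THEN bilinear_map_right, THEN linear_map_comp]

lemma \<eta>_mult: "h \<in> carrier H \<Longrightarrow> k \<in> carrier H \<Longrightarrow> m \<in> carrier V \<Longrightarrow> \<eta> (h \<otimes>\<^bsub>H\<^esub> k) m = \<eta> h (\<eta> k m)"
  and \<eta>_one: "m \<in> carrier V \<Longrightarrow> \<eta> \<one>\<^bsub>H\<^esub> m = m"
  using act_H by (simp_all add: left_module_def)

text \<open>By \<open>rel_HA\<close> the element h passes a' and is split by \<Delta>; by
  \<open>rel_AA\<close> the element a merges with the action of h1 on a'. This leaves the sum over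
  \<Delta>(h) outside the one over \<open>\<Psi>\<close>, the reverse of \<open>left_sum\<close>,
  hence the exchange at the end.\<close>

lemma act_AHA:
  assumes [simp]: "a \<in> carrier A" "h \<in> carrier H" "a' \<in> carrier A" "n \<in> carrier V"
  shows "\<alpha> a (\<eta> h (\<alpha> a' n)) = left_sum V a h a' (\<lambda>p q. \<alpha> p (\<eta> q n))"
proof -
  let ?F = "\<lambda>h1 h2 x1 x2 x3. \<alpha> ((x1 \<rightharpoonup> a) \<otimes>\<^bsub>A\<^esub> ((x2 \<otimes>\<^bsub>H\<^esub> h1) \<rightharpoonup> a')) (\<eta> (x3 \<otimes>\<^bsub>H\<^esub> h2) n)"
  note rules = smash_linear_intros lin_acts
  have bil: "bilinear_map K H H V (\<lambda>h1 h2. \<alpha> (h1 \<rightharpoonup> a') (\<eta> h2 n))"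
    by (intro rules) simp_all
  have lin: "linear_map K V V (\<alpha> a)" by (rule bilinear_map_right[OF act_A]) simp
  have "\<alpha> a (\<eta> h (\<alpha> a' n)) = tlift K V (\<lambda>h1 h2. \<alpha> a (\<alpha> (h1 \<rightharpoonup> a') (\<eta> h2 n))) (comul H h)"
    by (simp add: rel_HA linear_map_tlift[OF comul_closed mod_H mod_H module_V module_V lin bil])
  also have "\<dots> = tlift K V (\<lambda>h1 h2. tlift3 K V (?F h1 h2) \<Psi>) (comul H h)"
  proof (rule tlift_cong[OF comul_closed mod_H mod_H module_V bilinear_map_comp[OF lin bil]], simp_all)
    fix h1 h2 assume [simp]: "h1 \<in> carrier H" "h2 \<in> carrier H"
    have "\<alpha> a (\<alpha> (h1 \<rightharpoonup> a') (\<eta> h2 n)) =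
      tlift3 K V (\<lambda>x1 x2 x3. \<alpha> ((x1 \<rightharpoonup> a) \<otimes>\<^bsub>A\<^esub> (x2 \<rightharpoonup> (h1 \<rightharpoonup> a'))) (\<eta> x3 (\<eta> h2 n))) \<Psi>"
      by (simp add: rel_AA)
    also have "\<dots> = tlift3 K V (?F h1 h2) \<Psi>"
    proof (rule HHH.tlift3_cong[OF \<Phi>_inverse(2) module_V])
      show "trilinear_map K H H H V (\<lambda>x1 x2 x3. \<alpha> ((x1 \<rightharpoonup> a) \<otimes>\<^bsub>A\<^esub> (x2 \<rightharpoonup> (h1 \<rightharpoonup> a'))) (\<eta> x3 (\<eta> h2 n)))"
        by (intro rules) simp_all
    qed (simp add: act_mult \<eta>_mult)
    finally show "\<alpha> a (\<alpha> (h1 \<rightharpoonup> a') (\<eta> h2 n)) = tlift3 K V (?F h1 h2) \<Psi>" .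
  qed
  also have "\<dots> = left_sum V a h a' (\<lambda>p q. \<alpha> p (\<eta> q n))"
    unfolding left_sum_def
    by (rule HHH.tlift3_swap[OF \<Phi>_inverse(2) comul_closed mod_H mod_H module_V, symmetric], simp)
      (intro rules; simp)+
  finally show ?thesis .
qed

text \<open>By \<open>rel_BH\<close> the element b passes h, and by \<open>rel_BB\<close> its
  translate by h2 merges with b'. As before, the two sums come out in the reverse order and are
  exchanged.\<close>

lemma act_BHB:
  assumes [simp]: "b \<in> carrier B" "h \<in> carrier H" "b' \<in> carrier B" "m \<in> carrier V"
  shows "\<beta> b (\<eta> h (\<beta> b' m)) = right_sum V h b b' (\<lambda>r s. \<eta> r (\<beta> s m))"
proof -
  let ?F = "\<lambda>h1 h2 z1 z2 z3. \<eta> (h1 \<otimes>\<^bsub>H\<^esub> z1) (\<beta> ((b \<leftharpoonup> (h2 \<otimes>\<^bsub>H\<^esub> z2)) \<otimes>\<^bsub>B\<^esub> (b' \<leftharpoonup> z3)) m)"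
  note rules = smash_linear_intros lin_acts
  have "\<beta> b (\<eta> h (\<beta> b' m)) = tlift K V (\<lambda>h1 h2. \<eta> h1 (\<beta> (b \<leftharpoonup> h2) (\<beta> b' m))) (comul H h)"
    by (simp add: rel_BH)
  also have "\<dots> = tlift K V (\<lambda>h1 h2. tlift3 K V (?F h1 h2) \<Psi>) (comul H h)"
  proof (rule tlift_cong[OF comul_closed mod_H mod_H module_V], simp)
    show "bilinear_map K H H V (\<lambda>h1 h2. \<eta> h1 (\<beta> (b \<leftharpoonup> h2) (\<beta> b' m)))"
      by (intro rules) simp_all
    fix h1 h2 assume [simp]: "h1 \<in> carrier H" "h2 \<in> carrier H"
    have lin: "linear_map K V V (\<eta> h1)" by (rule bilinear_map_right[OF bilinear_acts(2)]) simp
    have tri: "trilinear_map K H H H V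
        (\<lambda>z1 z2 z3. \<eta> z1 (\<beta> ((b \<leftharpoonup> h2 \<leftharpoonup> z2) \<otimes>\<^bsub>B\<^esub> (b' \<leftharpoonup> z3)) m))"
      by (intro rules) simp_all
    have "\<eta> h1 (\<beta> (b \<leftharpoonup> h2) (\<beta> b' m)) =
      tlift3 K V (\<lambda>z1 z2 z3. \<eta> h1 (\<eta> z1 (\<beta> ((b \<leftharpoonup> h2 \<leftharpoonup> z2) \<otimes>\<^bsub>B\<^esub> (b' \<leftharpoonup> z3)) m))) \<Psi>"
      by (simp add: rel_BB HHH.linear_map_tlift3[OF \<Phi>_inverse(2) module_V module_V lin tri])
    also have "\<dots> = tlift3 K V (?F h1 h2) \<Psi>"
      by (rule HHH.tlift3_cong[OF \<Phi>_inverse(2) module_V trilinear_map_comp[OF lin tri]])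
        (simp add: act_mult \<eta>_mult)
    finally show "\<eta> h1 (\<beta> (b \<leftharpoonup> h2) (\<beta> b' m)) = tlift3 K V (?F h1 h2) \<Psi>" .
  qed
  also have "\<dots> = right_sum V h b b' (\<lambda>r s. \<eta> r (\<beta> s m))"
    unfolding right_sum_def
    by (rule HHH.tlift3_swap[OF \<Phi>_inverse(2) comul_closed mod_H mod_H module_V, symmetric], simp)
      (intro rules; simp)+
  finally show ?thesis .
qed

lemma act_trilinear: "m \<in> carrier V \<Longrightarrow> trilinear_map K A H B V (\<lambda>a h b. \<alpha> a (\<eta> h (\<beta> b m)))"
  by (intro smash_linear_intros lin_acts) simp_all

text \<open>Moving b past a' by \<open>rel_BA\<close> produces the sum over y and separates an
  A-part, evaluated by \<open>act_AHA\<close>, from a B-part, evaluated by \<open>act_BHB\<close>.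
  The three elements of H left between them multiply to the middle component of the product.\<close>

lemma act_AHBAHB:
  assumes [simp]: "a \<in> carrier A" "h \<in> carrier H" "b \<in> carrier B"
    "a' \<in> carrier A" "h' \<in> carrier H" "b' \<in> carrier B" "m \<in> carrier V"
  shows "\<alpha> a (\<eta> h (\<beta> b (\<alpha> a' (\<eta> h' (\<beta> b' m))))) =
    smash_sum V (\<lambda>a h b. \<alpha> a (\<eta> h (\<beta> b m))) a h b a' h' b'"
proof -
  let ?n = "\<eta> h' (\<beta> b' m)"
  note rules = smash_linear_intros lin_acts
  have lin: "linear_map K V V (\<lambda>v. \<alpha> a (\<eta> h v))"
    by (intro lin_acts linear_map_ident) simp_all
  have tri: "trilinear_map K H H H V (\<lambda>y1 y2 y3. \<alpha> (y1 \<rightharpoonup> a') (\<eta> y2 (\<beta> (b \<leftharpoonup> y3) ?n)))"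
    by (intro rules) simp_all
  have "\<alpha> a (\<eta> h (\<beta> b (\<alpha> a' ?n))) =
      tlift3 K V (\<lambda>y1 y2 y3. \<alpha> a (\<eta> h (\<alpha> (y1 \<rightharpoonup> a') (\<eta> y2 (\<beta> (b \<leftharpoonup> y3) ?n))))) \<Psi>"
    by (simp add: rel_BA HHH.linear_map_tlift3[OF \<Phi>_inverse(2) module_V module_V lin tri])
  also have "\<dots> = smash_sum V (\<lambda>a h b. \<alpha> a (\<eta> h (\<beta> b m))) a h b a' h' b'"
    unfolding smash_sum_def
  proof (rule HHH.tlift3_cong[OF \<Phi>_inverse(2) module_V trilinear_map_comp[OF lin tri]])
    fix y1 y2 y3 assume [simp]: "y1 \<in> carrier H" "y2 \<in> carrier H" "y3 \<in> carrier H"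
    have bil: "bilinear_map K A H V (\<lambda>p q. \<alpha> p (\<eta> q (\<eta> y2 (\<beta> (b \<leftharpoonup> y3) ?n))))"
      by (intro rules) simp_all
    have "\<alpha> a (\<eta> h (\<alpha> (y1 \<rightharpoonup> a') (\<eta> y2 (\<beta> (b \<leftharpoonup> y3) ?n)))) =
        left_sum V a h (y1 \<rightharpoonup> a') (\<lambda>p q. \<alpha> p (\<eta> q (\<eta> y2 (\<beta> (b \<leftharpoonup> y3) ?n))))"
      by (simp add: act_AHA)
    also have "\<dots> = left_sum V a h (y1 \<rightharpoonup> a') (\<lambda>p q. right_sum V h' (b \<leftharpoonup> y3) b'
        (\<lambda>r s. \<alpha> p (\<eta> (q \<otimes>\<^bsub>H\<^esub> y2 \<otimes>\<^bsub>H\<^esub> r) (\<beta> s m))))"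
    proof (rule left_sum_cong[OF module_V bil], simp_all)
      fix p q assume [simp]: "p \<in> carrier A" "q \<in> carrier H"
      have lin': "linear_map K V V (\<lambda>v. \<alpha> p (\<eta> q (\<eta> y2 v)))"
        by (intro lin_acts linear_map_ident) simp_all
      have bil': "bilinear_map K H B V (\<lambda>r s. \<eta> r (\<beta> s m))" by (intro rules) simp_all
      have "\<alpha> p (\<eta> q (\<eta> y2 (\<beta> (b \<leftharpoonup> y3) ?n))) = right_sum V h' (b \<leftharpoonup> y3) b' (\<lambda>r s. \<alpha> p (\<eta> q (\<eta> y2 (\<eta> r (\<beta> s m)))))"
        by (simp add: act_BHB right_sum_push[OF module_V bil' module_V lin'])
      also have "\<dots> = right_sum V h' (b \<leftharpoonup> y3) b' (\<lambda>r s. \<alpha> p (\<eta> (q \<otimes>\<^bsub>H\<^esub> y2 \<otimes>\<^bsub>H\<^esub> r) (\<beta> s m)))"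
        by (rule right_sum_cong[OF module_V bilinear_map_comp[OF lin' bil']]) (simp_all add: \<eta>_mult)
      finally show "\<alpha> p (\<eta> q (\<eta> y2 (\<beta> (b \<leftharpoonup> y3) ?n))) =
        right_sum V h' (b \<leftharpoonup> y3) b' (\<lambda>r s. \<alpha> p (\<eta> (q \<otimes>\<^bsub>H\<^esub> y2 \<otimes>\<^bsub>H\<^esub> r) (\<beta> s m)))" .
    qed
    finally show "\<alpha> a (\<eta> h (\<alpha> (y1 \<rightharpoonup> a') (\<eta> y2 (\<beta> (b \<leftharpoonup> y3) ?n)))) =
      left_sum V a h (y1 \<rightharpoonup> a') (\<lambda>p q. right_sum V h' (b \<leftharpoonup> y3) b'
        (\<lambda>r s. \<alpha> p (\<eta> (q \<otimes>\<^bsub>H\<^esub> y2 \<otimes>\<^bsub>H\<^esub> r) (\<beta> s m))))" .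
  qed
  finally show ?thesis .
qed

definition act where "act s m = tlift3 K V (\<lambda>a h b. \<alpha> a (\<eta> h (\<beta> b m))) s"

lemma act_tens3:
  "a \<in> carrier A \<Longrightarrow> h \<in> carrier H \<Longrightarrow> b \<in> carrier B \<Longrightarrow> m \<in> carrier V \<Longrightarrow>
    act (tens3 K A H B a h b) m = \<alpha> a (\<eta> h (\<beta> b m))"
  by (simp add: act_def AHB.tlift3_tens3 act_trilinear)

lemma act_bilinear: "bilinear_map K S V V act"
  unfolding act_def
  by (intro bilinear_mapI AHB.tlift3_linear AHB.linear_map_tlift3_body act_trilinear module_V
      lin_acts linear_map_ident)

text \<open>Both sides are linear in \<open>s\<close> and in \<open>t\<close>. On pure tensors the
  left side is carried into V by \<open>smash_sum_push\<close>, and \<open>act_AHBAHB\<close> shows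
  that the right side is the same sum.\<close>

lemma act_smash_mult:
  assumes s: "s \<in> carrier S" and t: "t \<in> carrier S" and m: "m \<in> carrier V"
  shows "act (s \<otimes>\<^bsub>smash K H A B\<^esub> t) m = act s (act t m)"
proof -
  note act_linear = bilinear_map_left[OF act_bilinear] bilinear_map_right[OF act_bilinear]
  note act_closed = bilinear_map_closed[OF act_bilinear]
  show ?thesis
  proof (rule AHB.tensor3_eqI[OF s linear_map_comp[OF act_linear(1)[OF m] smash_mult_linear(1)[OF t]]
        act_linear(1)[OF act_closed[OF t m]]])
    fix a h b assume c: "a \<in> carrier A" "h \<in> carrier H" "b \<in> carrier B"
    let ?s = "tens3 K A H B a h b"
    have s: "?s \<in> carrier S" using c by simp
    show "act (?s \<otimes>\<^bsub>smash K H A B\<^esub> t) m = act ?s (act t m)"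
    proof (rule AHB.tensor3_eqI[OF t linear_map_comp[OF act_linear(1)[OF m] smash_mult_linear(2)[OF s]]
          linear_map_comp[OF act_linear(2)[OF s] act_linear(1)[OF m]]])
      fix a' h' b' assume c': "a' \<in> carrier A" "h' \<in> carrier H" "b' \<in> carrier B"
      have "act (?s \<otimes>\<^bsub>smash K H A B\<^esub> tens3 K A H B a' h' b') m =
          smash_sum V (\<lambda>p q r. act (tens3 K A H B p q r) m) a h b a' h' b'"
        using c c' by (simp add: smash_mult_tens3
            smash_sum_push[OF module_S(1) AHB.tens3_trilinear module_V act_linear(1)[OF m]])
      also have "\<dots> = smash_sum V (\<lambda>a h b. \<alpha> a (\<eta> h (\<beta> b m))) a h b a' h' b'"
        by (rule smash_sum_cong[OF module_V act_trilinear[OF m] c c', symmetric]) (simp add: act_tens3 m)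
      also have "\<dots> = act ?s (act (tens3 K A H B a' h' b') m)"
        using c c' m by (simp add: act_tens3 act_AHBAHB)
      finally show "act (?s \<otimes>\<^bsub>smash K H A B\<^esub> tens3 K A H B a' h' b') m =
        act ?s (act (tens3 K A H B a' h' b') m)" .
    qed
  qed
qed

lemma left_module_act: "left_module K (smash K H A B) V act"
  unfolding left_module_def
  using act_bilinear
  by (auto simp: bilinear_map_def act_smash_mult act_tens3 act_units \<eta>_one)

end


section \<open>From modules over the smash product to compatible weak actions\<close>

locale smash_module = smash_product K H A B
  for K :: "('k, 'r) ring_scheme" (structure)
    and H :: "('k, 'h, 'x) quasi_bialg_scheme" (structure)
    and A :: "('k, 'h, 'a, 'y) left_mod_alg_scheme"
    and B :: "('k, 'h, 'b, 'z) right_mod_alg_scheme" +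
  fixes V :: "('k, 'v, 'w) module_scheme" and f
  assumes left_module: "left_module K (smash K H A B) V f"
begin

abbreviation "F a h b m \<equiv> f (tens3 K A H B a h b) m"

text \<open>Restricted to the carriers in exactly the way of \<open>smash_to_ahb\<close>, so that
  these functions are the fields of the record built there.\<close>

definition "\<alpha> = (\<lambda>a\<in>carrier A. \<lambda>m\<in>carrier V. F a \<one>\<^bsub>H\<^esub> \<one>\<^bsub>B\<^esub> m)"
definition "\<eta> = (\<lambda>h\<in>carrier H. \<lambda>m\<in>carrier V. F \<one>\<^bsub>A\<^esub> h \<one>\<^bsub>B\<^esub> m)"
definition "\<beta> = (\<lambda>b\<in>carrier B. \<lambda>m\<in>carrier V. F \<one>\<^bsub>A\<^esub> \<one>\<^bsub>H\<^esub> b m)"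

lemma module_V [simp]: "module K V"
  using left_module by (simp add: left_module_def)

lemma f_bilinear: "bilinear_map K S V V f"
  using left_module by (simp add: left_module_def bilinear_map_def)

lemma F_closed [simp]:
  "a \<in> carrier A \<Longrightarrow> h \<in> carrier H \<Longrightarrow> b \<in> carrier B \<Longrightarrow> m \<in> carrier V \<Longrightarrow> F a h b m \<in> carrier V"
  by (rule bilinear_map_closed[OF f_bilinear]) simp_all

lemma F_trilinear:
  assumes "m \<in> carrier V" shows "trilinear_map K A H B V (\<lambda>a h b. F a h b m)"
  by (rule trilinear_map_comp[OF bilinear_map_left[OF f_bilinear assms] AHB.tens3_trilinear])

lemma F_bilinear:
  "bilinear_map K A V V (\<lambda>a m. F a \<one>\<^bsub>H\<^esub> \<one>\<^bsub>B\<^esub> m)"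
  "bilinear_map K H V V (\<lambda>h m. F \<one>\<^bsub>A\<^esub> h \<one>\<^bsub>B\<^esub> m)"
  "bilinear_map K B V V (\<lambda>b m. F \<one>\<^bsub>A\<^esub> \<one>\<^bsub>H\<^esub> b m)"
  by (auto intro!: bilinear_mapI bilinear_map_right[OF f_bilinear] trilinear_map_1[OF F_trilinear]
      trilinear_map_2[OF F_trilinear] trilinear_map_3[OF F_trilinear])

text \<open>The module law moves the computation into the smash product, and linearity of the action
  brings the resulting sum back to V.\<close>

lemma F_mult:
  assumes c: "a \<in> carrier A" "h \<in> carrier H" "b \<in> carrier B" "a' \<in> carrier A" "h' \<in> carrier H" "b' \<in> carrier B"
    and m: "m \<in> carrier V"
  shows "F a h b (F a' h' b' m) = smash_sum V (\<lambda>p q r. F p q r m) a h b a' h' b'"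
proof -
  have "F a h b (F a' h' b' m) = f (tens3 K A H B a h b \<otimes>\<^bsub>smash K H A B\<^esub> tens3 K A H B a' h' b') m"
    using left_module c m by (simp add: left_module_def)
  then show ?thesis
    using c by (simp add: smash_mult_tens3
        smash_sum_push[OF module_S(1) AHB.tens3_trilinear module_V bilinear_map_left[OF f_bilinear m]])
qed

lemma F_one: "m \<in> carrier V \<Longrightarrow> F \<one>\<^bsub>A\<^esub> \<one>\<^bsub>H\<^esub> \<one>\<^bsub>B\<^esub> m = m"
  using left_module by (simp add: left_module_def)

lemma F_AHB:
  assumes "a \<in> carrier A" "h \<in> carrier H" "h' \<in> carrier H" "b' \<in> carrier B" "m \<in> carrier V"
  shows "F a h \<one>\<^bsub>B\<^esub> (F \<one>\<^bsub>A\<^esub> h' b' m) = F a (h \<otimes>\<^bsub>H\<^esub> h') b' m"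
  using assms by (simp add: F_mult smash_sum_AHB[OF module_V F_trilinear])

lemma act_simps:
  "a \<in> carrier A \<Longrightarrow> m \<in> carrier V \<Longrightarrow> \<alpha> a m = F a \<one>\<^bsub>H\<^esub> \<one>\<^bsub>B\<^esub> m"
  "h \<in> carrier H \<Longrightarrow> m \<in> carrier V \<Longrightarrow> \<eta> h m = F \<one>\<^bsub>A\<^esub> h \<one>\<^bsub>B\<^esub> m"
  "b \<in> carrier B \<Longrightarrow> m \<in> carrier V \<Longrightarrow> \<beta> b m = F \<one>\<^bsub>A\<^esub> \<one>\<^bsub>H\<^esub> b m"
  by (simp_all add: \<alpha>_def \<eta>_def \<beta>_def)

lemma F_eq:
  assumes "a \<in> carrier A" "h \<in> carrier H" "b \<in> carrier B" "m \<in> carrier V"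
  shows "\<alpha> a (\<eta> h (\<beta> b m)) = F a h b m"
  using assms by (simp add: act_simps F_AHB)

text \<open>The left-hand side of each of the five relations is a product of two generators acting
  on m, evaluated by the matching formula with units. Each summand on the right is folded into the
  action of a single a # h # b by \<open>F_AHB\<close> or \<open>F_eq\<close>.\<close>

lemma ahb_module: "ahb_module K H A B V \<alpha> \<eta> \<beta>"
proof
  note rules = smash_linear_intros \<tau>_linear[OF module_V F_trilinear]
  show bil: "bilinear_map K A V V \<alpha>" "bilinear_map K B V V \<beta>"
    by (rule bilinear_map_cong[OF F_bilinear(1)] bilinear_map_cong[OF F_bilinear(3)]; simp add: act_simps)+
  have "bilinear_map K H V V \<eta>"
    by (rule bilinear_map_cong[OF F_bilinear(2)]) (simp_all add: act_simps)
  then show "left_module K H V \<eta>"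
    by (simp add: left_module_def act_simps F_one F_AHB)
  show "\<alpha> \<one>\<^bsub>A\<^esub> m = m" "\<beta> \<one>\<^bsub>B\<^esub> m = m" if "m \<in> carrier V" for m
    using that by (simp_all add: act_simps F_one)
  show "\<alpha> a (\<alpha> a' m) = tlift3 K V (\<lambda>x1 x2 x3. \<alpha> ((x1 \<rightharpoonup> a) \<otimes>\<^bsub>A\<^esub> (x2 \<rightharpoonup> a')) (\<eta> x3 m)) \<Psi>"
    if [simp]: "a \<in> carrier A" "a' \<in> carrier A" "m \<in> carrier V" for a a' m
  proof -
    have "\<alpha> a (\<alpha> a' m) =
        tlift3 K V (\<lambda>x1 x2 x3. F ((x1 \<rightharpoonup> a) \<otimes>\<^bsub>A\<^esub> (x2 \<rightharpoonup> a')) (x3 \<otimes>\<^bsub>H\<^esub> \<one>\<^bsub>H\<^esub>) \<one>\<^bsub>B\<^esub> m) \<Psi>"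
      by (simp add: act_simps F_mult smash_sum_AA[OF module_V F_trilinear])
    also have "\<dots> = tlift3 K V (\<lambda>x1 x2 x3. \<alpha> ((x1 \<rightharpoonup> a) \<otimes>\<^bsub>A\<^esub> (x2 \<rightharpoonup> a')) (\<eta> x3 m)) \<Psi>"
      by (rule HHH.tlift3_cong[OF \<Phi>_inverse(2) module_V], intro rules)
        (simp_all add: act_simps F_AHB)
    finally show ?thesis .
  qed
  show "\<eta> h (\<alpha> a m) = tlift K V (\<lambda>h1 h2. \<alpha> (h1 \<rightharpoonup> a) (\<eta> h2 m)) (comul H h)"
    if [simp]: "h \<in> carrier H" "a \<in> carrier A" "m \<in> carrier V" for h a m
  proof -
    have "\<eta> h (\<alpha> a m) = tlift K V (\<lambda>h1 h2. F (h1 \<rightharpoonup> a) (h2 \<otimes>\<^bsub>H\<^esub> \<one>\<^bsub>H\<^esub>) \<one>\<^bsub>B\<^esub> m) (comul H h)"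
      by (simp add: act_simps F_mult smash_sum_HA[OF module_V F_trilinear])
    also have "\<dots> = tlift K V (\<lambda>h1 h2. \<alpha> (h1 \<rightharpoonup> a) (\<eta> h2 m)) (comul H h)"
      by (rule tlift_cong[OF comul_closed mod_H mod_H module_V], simp, intro rules)
        (simp_all add: act_simps F_AHB)
    finally show ?thesis .
  qed
  show "\<beta> b (\<beta> b' m) = tlift3 K V (\<lambda>x1 x2 x3. \<eta> x1 (\<beta> ((b \<leftharpoonup> x2) \<otimes>\<^bsub>B\<^esub> (b' \<leftharpoonup> x3)) m)) \<Psi>"
    if [simp]: "b \<in> carrier B" "b' \<in> carrier B" "m \<in> carrier V" for b b' m
  proof -
    have "\<beta> b (\<beta> b' m) =
        tlift3 K V (\<lambda>z1 z2 z3. F \<one>\<^bsub>A\<^esub> (\<one>\<^bsub>H\<^esub> \<otimes>\<^bsub>H\<^esub> z1) ((b \<leftharpoonup> z2) \<otimes>\<^bsub>B\<^esub> (b' \<leftharpoonup> z3)) m) \<Psi>"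
      by (simp add: act_simps F_mult smash_sum_BB[OF module_V F_trilinear])
    also have "\<dots> = tlift3 K V (\<lambda>x1 x2 x3. \<eta> x1 (\<beta> ((b \<leftharpoonup> x2) \<otimes>\<^bsub>B\<^esub> (b' \<leftharpoonup> x3)) m)) \<Psi>"
      by (rule HHH.tlift3_cong[OF \<Phi>_inverse(2) module_V], intro rules)
        (simp_all add: act_simps F_AHB)
    finally show ?thesis .
  qed
  show "\<beta> b (\<eta> h m) = tlift K V (\<lambda>h1 h2. \<eta> h1 (\<beta> (b \<leftharpoonup> h2) m)) (comul H h)"
    if [simp]: "b \<in> carrier B" "h \<in> carrier H" "m \<in> carrier V" for b h m
  proof -
    have "\<beta> b (\<eta> h m) = tlift K V (\<lambda>h1 h2. F \<one>\<^bsub>A\<^esub> (\<one>\<^bsub>H\<^esub> \<otimes>\<^bsub>H\<^esub> h1) (b \<leftharpoonup> h2) m) (comul H h)"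
      by (simp add: act_simps F_mult smash_sum_BH[OF module_V F_trilinear])
    also have "\<dots> = tlift K V (\<lambda>h1 h2. \<eta> h1 (\<beta> (b \<leftharpoonup> h2) m)) (comul H h)"
      by (rule tlift_cong[OF comul_closed mod_H mod_H module_V], simp, intro rules)
        (simp_all add: act_simps F_AHB)
    finally show ?thesis .
  qed
  show "\<beta> b (\<alpha> a m) = tlift3 K V (\<lambda>y1 y2 y3. \<alpha> (y1 \<rightharpoonup> a) (\<eta> y2 (\<beta> (b \<leftharpoonup> y3) m))) \<Psi>"
    if [simp]: "b \<in> carrier B" "a \<in> carrier A" "m \<in> carrier V" for b a m
  proof -
    have "\<beta> b (\<alpha> a m) = tlift3 K V (\<lambda>y1 y2 y3. F (y1 \<rightharpoonup> a) y2 (b \<leftharpoonup> y3) m) \<Psi>"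
      by (simp add: act_simps F_mult smash_sum_BA[OF module_V F_trilinear])
    also have "\<dots> = tlift3 K V (\<lambda>y1 y2 y3. \<alpha> (y1 \<rightharpoonup> a) (\<eta> y2 (\<beta> (b \<leftharpoonup> y3) m))) \<Psi>"
      by (rule HHH.tlift3_cong[OF \<Phi>_inverse(2) module_V], intro rules)
        (simp_all add: F_eq)
    finally show ?thesis .
  qed
qed

end


section \<open>The isomorphism of categories\<close>

text \<open>Morphisms here are extensional functions on underlying sets and composition is that of
  functions, so the category laws come for free. What depends on the structure is that identities
  and composites are morphisms.\<close>

lemma categoryI_concrete:
  assumes hom: "\<And>X Y f. X \<in> Ob C \<Longrightarrow> Y \<in> Ob C \<Longrightarrow> f \<in> Hom C X Y \<Longrightarrow> f \<in> extensional (U X) \<and> f \<in> U X \<rightarrow> U Y"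
    and ident: "\<And>X. X \<in> Ob C \<Longrightarrow> Ident C X = (\<lambda>m\<in>U X. m)"
    and ident_hom: "\<And>X. X \<in> Ob C \<Longrightarrow> (\<lambda>m\<in>U X. m) \<in> Hom C X X"
    and comp: "\<And>X Y Z g f. Comp C X Y Z g f = compose (U X) g f"
    and comp_hom: "\<And>X Y Z f g. X \<in> Ob C \<Longrightarrow> Y \<in> Ob C \<Longrightarrow> Z \<in> Ob C \<Longrightarrow> f \<in> Hom C X Y \<Longrightarrow> g \<in> Hom C Y Z \<Longrightarrow>
      compose (U X) g f \<in> Hom C X Z"
  shows "category C"
  unfolding category_def comp
proof (intro conjI ballI)
  fix X Y f assume "X \<in> Ob C" "Y \<in> Ob C" and f: "f \<in> Hom C X Y"
  then show "compose (U X) (Ident C Y) f = f" "compose (U X) f (Ident C X) = f"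
    using hom[of X Y f] by (auto simp: ident Id_compose compose_Id)
next
  fix W X Y Z f g h
  assume "W \<in> Ob C" "X \<in> Ob C" "Y \<in> Ob C" "Z \<in> Ob C" "f \<in> Hom C W X" "g \<in> Hom C X Y" "h \<in> Hom C Y Z"
  then show "compose (U W) (compose (U X) h g) f = compose (U W) h (compose (U W) g f)"
    using hom[of W X f] by (auto simp: compose_def fun_eq_iff Pi_iff)
qed (simp_all add: ident ident_hom comp_hom)

lemma linear_map_restrict_ident: "module K V \<Longrightarrow> linear_map K V V (\<lambda>m\<in>carrier V. m)"
  by (rule linear_map_cong[OF linear_map_ident]) simp_all

lemma linear_map_compose:
  assumes "module K U" "linear_map K U V f" "linear_map K V W g"
  shows "linear_map K U W (compose (carrier U) g f)"
  by (rule linear_map_cong[OF linear_map_comp[OF assms(3,2)] assms(1)]) (simp add: compose_def)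

lemma category_lmod: "category (lmod_cat K S)"
proof (rule categoryI_concrete[where U = "\<lambda>M. carrier (lm_space M)"])
  fix X assume X: "X \<in> Ob (lmod_cat K S)"
  then have "module K (lm_space X)" "bilinear_map K S (lm_space X) (lm_space X) (lm_act X)"
    by (auto simp: lmod_cat_def lmod_object_def left_module_def)
  then show "(\<lambda>m\<in>carrier (lm_space X). m) \<in> Hom (lmod_cat K S) X X"
    by (auto simp: lmod_cat_def lmod_hom_def linear_map_restrict_ident bilinear_map_closed)
next
  fix X Y Z f g
  assume X: "X \<in> Ob (lmod_cat K S)" and f: "f \<in> Hom (lmod_cat K S) X Y" and g: "g \<in> Hom (lmod_cat K S) Y Z"
  from X have m: "module K (lm_space X)" "bilinear_map K S (lm_space X) (lm_space X) (lm_act X)"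
    by (auto simp: lmod_cat_def lmod_object_def left_module_def)
  have lin: "linear_map K (lm_space X) (lm_space Y) f" "linear_map K (lm_space Y) (lm_space Z) g"
    using f g by (auto simp: lmod_cat_def lmod_hom_def)
  show "compose (carrier (lm_space X)) g f \<in> Hom (lmod_cat K S) X Z"
    using f g linear_map_compose[OF m(1) lin] bilinear_map_closed[OF m(2)] linear_map_closed[OF lin(1)]
    by (auto simp: lmod_cat_def lmod_hom_def compose_eq)
qed (auto simp: lmod_cat_def lmod_hom_def linear_map_closed)

lemma category_ahb: "category (ahb_cat K H A B)"
proof (rule categoryI_concrete[where U = "\<lambda>M. carrier (ahb_space M)"])
  fix X assume X: "X \<in> Ob (ahb_cat K H A B)"
  then have "module K (ahb_space X)" "bilinear_map K H (ahb_space X) (ahb_space X) (ahb_H X)"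
    "bilinear_map K A (ahb_space X) (ahb_space X) (ahb_A X)" "bilinear_map K B (ahb_space X) (ahb_space X) (ahb_B X)"
    by (auto simp: ahb_cat_def ahb_object_def left_module_def Let_def)
  then show "(\<lambda>m\<in>carrier (ahb_space X). m) \<in> Hom (ahb_cat K H A B) X X"
    by (auto simp: ahb_cat_def ahb_hom_def linear_map_restrict_ident bilinear_map_closed)
next
  fix X Y Z f g
  assume X: "X \<in> Ob (ahb_cat K H A B)" and f: "f \<in> Hom (ahb_cat K H A B) X Y"
    and g: "g \<in> Hom (ahb_cat K H A B) Y Z"
  from X have m: "module K (ahb_space X)" "bilinear_map K H (ahb_space X) (ahb_space X) (ahb_H X)"
    "bilinear_map K A (ahb_space X) (ahb_space X) (ahb_A X)" "bilinear_map K B (ahb_space X) (ahb_space X) (ahb_B X)"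
    by (auto simp: ahb_cat_def ahb_object_def left_module_def Let_def)
  have lin: "linear_map K (ahb_space X) (ahb_space Y) f" "linear_map K (ahb_space Y) (ahb_space Z) g"
    using f g by (auto simp: ahb_cat_def ahb_hom_def)
  show "compose (carrier (ahb_space X)) g f \<in> Hom (ahb_cat K H A B) X Z"
    using f g linear_map_compose[OF m(1) lin] m(2-)[THEN bilinear_map_closed] linear_map_closed[OF lin(1)]
    by (auto simp: ahb_cat_def ahb_hom_def compose_eq)
qed (auto simp: ahb_cat_def ahb_hom_def linear_map_closed)

lemma extensional2_restrict: "(\<lambda>x\<in>X. \<lambda>y\<in>Y. f x y) \<in> extensional2 X Y"
  by (auto simp: extensional2_def fun_eq_iff restrict_def)

context smash_product
begin

section \<open>The constructions on objects are well defined and mutually inverse\<close>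

lemma smash_module_of_object:
  "lmod_object K (smash K H A B) M \<Longrightarrow> smash_module K H A B (lm_space M) (lm_act M)"
  by unfold_locales (simp add: lmod_object_def)

lemma ahb_module_of_object:
  assumes "ahb_object K H A B N"
  shows "ahb_module K H A B (ahb_space N) (ahb_A N) (ahb_H N) (ahb_B N)"
  using assms by unfold_locales (auto simp: ahb_object_def Let_def)

lemma ahb_objectI:
  assumes "vector_space_object K V" "\<alpha> \<in> extensional2 (carrier A) (carrier V)"
    "\<eta> \<in> extensional2 (carrier H) (carrier V)" "\<beta> \<in> extensional2 (carrier B) (carrier V)"
    and "ahb_module K H A B V \<alpha> \<eta> \<beta>"
  shows "ahb_object K H A B \<lparr>ahb_space = V, ahb_A = \<alpha>, ahb_H = \<eta>, ahb_B = \<beta>\<rparr>"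
proof -
  interpret N: ahb_module K H A B V \<alpha> \<eta> \<beta> by fact
  show ?thesis unfolding ahb_object_def Let_def
    by (simp add: assms(1-4) N.act_H N.act_A N.act_B N.act_units,
        intro conjI ballI N.rel_AA N.rel_HA N.rel_BB N.rel_BH N.rel_BA)
qed

lemma smash_to_ahb_object:
  assumes M: "lmod_object K (smash K H A B) M"
  shows "ahb_object K H A B (smash_to_ahb K H A B M)"
proof -
  interpret M: smash_module K H A B "lm_space M" "lm_act M" by (rule smash_module_of_object[OF M])
  have "vector_space_object K (lm_space M)" using M by (simp add: lmod_object_def)
  from ahb_objectI[OF this _ _ _ M.ahb_module] show ?thesis
    by (simp add: smash_to_ahb_def M.\<alpha>_def M.\<eta>_def M.\<beta>_def extensional2_restrict)
qed

lemma ahb_to_smash_act: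
  assumes N: "ahb_object K H A B N" and s: "s \<in> carrier S" and m: "m \<in> carrier (ahb_space N)"
  shows "lm_act (ahb_to_smash K H A B N) s m =
    ahb_module.act K (ahb_space N) (ahb_A N) (ahb_H N) (ahb_B N) s m"
proof -
  interpret N: ahb_module K H A B "ahb_space N" "ahb_A N" "ahb_H N" "ahb_B N"
    by (rule ahb_module_of_object[OF N])
  show ?thesis using s m by (simp add: ahb_to_smash_def N.act_def)
qed

lemma ahb_to_smash_tens3:
  assumes N: "ahb_object K H A B N" and c: "a \<in> carrier A" "h \<in> carrier H" "b \<in> carrier B" "m \<in> carrier (ahb_space N)"
  shows "lm_act (ahb_to_smash K H A B N) (tens3 K A H B a h b) m = ahb_A N a (ahb_H N h (ahb_B N b m))"
proof -
  interpret N: ahb_module K H A B "ahb_space N" "ahb_A N" "ahb_H N" "ahb_B N"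
    by (rule ahb_module_of_object[OF N])
  show ?thesis using c by (simp add: ahb_to_smash_act[OF N] N.act_tens3)
qed

lemma ahb_to_smash_object:
  assumes N: "ahb_object K H A B N"
  shows "lmod_object K (smash K H A B) (ahb_to_smash K H A B N)"
proof -
  interpret N: ahb_module K H A B "ahb_space N" "ahb_A N" "ahb_H N" "ahb_B N"
    by (rule ahb_module_of_object[OF N])
  have space: "lm_space (ahb_to_smash K H A B N) = ahb_space N" by (simp add: ahb_to_smash_def)
  have vs: "vector_space_object K (ahb_space N)" using N by (simp add: ahb_object_def Let_def)
  have bil: "bilinear_map K S (ahb_space N) (ahb_space N) (lm_act (ahb_to_smash K H A B N))"
    by (rule bilinear_map_cong[OF N.act_bilinear]) (simp_all add: ahb_to_smash_act[OF N])
  then have "left_module K (smash K H A B) (ahb_space N) (lm_act (ahb_to_smash K H A B N))"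
    using N.left_module_act bilinear_map_closed[OF bil]
    by (simp add: left_module_def bilinear_map_def ahb_to_smash_act[OF N])
  then show ?thesis
    by (simp add: lmod_object_def space vs) (simp add: ahb_to_smash_def extensional2_restrict)
qed

text \<open>Both actions are linear in the element of the smash product and agree on pure tensors by
  the factorisation in \<open>M.F_eq\<close>.\<close>

lemma ahb_to_smash_to_ahb:
  assumes M: "lmod_object K (smash K H A B) M"
  shows "ahb_to_smash K H A B (smash_to_ahb K H A B M) = M"
proof -
  interpret M: smash_module K H A B "lm_space M" "lm_act M" by (rule smash_module_of_object[OF M])
  interpret N: ahb_module K H A B "lm_space M" M.\<alpha> M.\<eta> M.\<beta> by (rule M.ahb_module)
  have act: "tlift3 K (lm_space M) (\<lambda>a h b. M.\<alpha> a (M.\<eta> h (M.\<beta> b m))) s = lm_act M s m"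
    if s: "s \<in> carrier S" and m: "m \<in> carrier (lm_space M)" for s m
    by (rule AHB.tensor3_eqI[OF s AHB.tlift3_linear[OF M.module_V N.act_trilinear[OF m]]
          bilinear_map_left[OF M.f_bilinear m]])
      (simp add: AHB.tlift3_tens3 N.act_trilinear m M.F_eq)
  \<comment> \<open>Agreement on the carriers yields equality of records because the action of an
    object is undefined elsewhere.\<close>
  have ext: "lm_act M = (\<lambda>s\<in>carrier S. \<lambda>m\<in>carrier (lm_space M). lm_act M s m)"
    using M by (simp add: lmod_object_def extensional2_def)
  have "(\<lambda>s\<in>carrier S. \<lambda>m\<in>carrier (lm_space M).
      tlift3 K (lm_space M) (\<lambda>a h b. M.\<alpha> a (M.\<eta> h (M.\<beta> b m))) s) = lm_act M"
    by (subst ext, intro restrict_ext act)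
  then show ?thesis
    by (simp add: ahb_to_smash_def smash_to_ahb_def M.\<alpha>_def M.\<eta>_def M.\<beta>_def)
qed

text \<open>On a # 1 # 1 and its two analogues, two of the three weak actions are by units and hence
  trivial, which recovers the third on the carriers; extensionality settles the rest.\<close>

lemma smash_to_ahb_to_smash:
  assumes N: "ahb_object K H A B N"
  shows "smash_to_ahb K H A B (ahb_to_smash K H A B N) = N"
proof -
  interpret N: ahb_module K H A B "ahb_space N" "ahb_A N" "ahb_H N" "ahb_B N"
    by (rule ahb_module_of_object[OF N])
  have space: "lm_space (ahb_to_smash K H A B N) = ahb_space N" by (simp add: ahb_to_smash_def)
  have ext: "ahb_A N = (\<lambda>a\<in>carrier A. \<lambda>m\<in>carrier (ahb_space N). ahb_A N a m)"
    "ahb_H N = (\<lambda>h\<in>carrier H. \<lambda>m\<in>carrier (ahb_space N). ahb_H N h m)"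
    "ahb_B N = (\<lambda>b\<in>carrier B. \<lambda>m\<in>carrier (ahb_space N). ahb_B N b m)"
    using N by (simp_all add: ahb_object_def Let_def extensional2_def)
  let ?f = "lm_act (ahb_to_smash K H A B N)"
  have "(\<lambda>a\<in>carrier A. \<lambda>m\<in>carrier (ahb_space N). ?f (tens3 K A H B a \<one>\<^bsub>H\<^esub> \<one>\<^bsub>B\<^esub>) m) = ahb_A N"
    by (subst ext(1), intro restrict_ext) (simp add: ahb_to_smash_tens3[OF N] N.act_units N.\<eta>_one)
  moreover have "(\<lambda>h\<in>carrier H. \<lambda>m\<in>carrier (ahb_space N). ?f (tens3 K A H B \<one>\<^bsub>A\<^esub> h \<one>\<^bsub>B\<^esub>) m) = ahb_H N"
    by (subst ext(2), intro restrict_ext) (simp add: ahb_to_smash_tens3[OF N] N.act_units N.\<eta>_one)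
  moreover have "(\<lambda>b\<in>carrier B. \<lambda>m\<in>carrier (ahb_space N). ?f (tens3 K A H B \<one>\<^bsub>A\<^esub> \<one>\<^bsub>H\<^esub> b) m) = ahb_B N"
    by (subst ext(3), intro restrict_ext) (simp add: ahb_to_smash_tens3[OF N] N.act_units N.\<eta>_one)
  ultimately show ?thesis by (simp add: smash_to_ahb_def space)
qed

section \<open>Morphisms\<close>

lemma lmod_hom_imp_ahb_hom:
  assumes M: "lmod_object K (smash K H A B) M" and N: "lmod_object K (smash K H A B) N"
    and f: "f \<in> lmod_hom K (smash K H A B) M N"
  shows "f \<in> ahb_hom K H A B (smash_to_ahb K H A B M) (smash_to_ahb K H A B N)"
  using f linear_map_closed[of K "lm_space M" "lm_space N" f]
  by (auto simp: lmod_hom_def ahb_hom_def smash_to_ahb_def)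

text \<open>For fixed m both sides of compatibility are linear in the element of the smash product;
  on a pure tensor f passes through the three weak actions one after another.\<close>

lemma ahb_hom_imp_lmod_hom:
  assumes M: "ahb_object K H A B M" and N: "ahb_object K H A B N"
    and f: "f \<in> ahb_hom K H A B M N"
  shows "f \<in> lmod_hom K (smash K H A B) (ahb_to_smash K H A B M) (ahb_to_smash K H A B N)"
proof -
  interpret M: ahb_module K H A B "ahb_space M" "ahb_A M" "ahb_H M" "ahb_B M"
    by (rule ahb_module_of_object[OF M])
  interpret N: ahb_module K H A B "ahb_space N" "ahb_A N" "ahb_H N" "ahb_B N"
    by (rule ahb_module_of_object[OF N])
  have lin: "linear_map K (ahb_space M) (ahb_space N) f" using f by (simp add: ahb_hom_def)
  have space: "lm_space (ahb_to_smash K H A B L) = ahb_space L" for L by (simp add: ahb_to_smash_def)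
  have "f (M.act s m) = N.act s (f m)" if s: "s \<in> carrier S" and m: "m \<in> carrier (ahb_space M)" for s m
    by (rule AHB.tensor3_eqI[OF s linear_map_comp[OF lin bilinear_map_left[OF M.act_bilinear m]]
          bilinear_map_left[OF N.act_bilinear linear_map_closed[OF lin m]]])
      (use f m in \<open>simp add: M.act_tens3 N.act_tens3 linear_map_closed[OF lin] ahb_hom_def\<close>)
  then show ?thesis
    using f lin linear_map_closed[OF lin]
    by (simp add: lmod_hom_def space ahb_to_smash_act[OF M] ahb_to_smash_act[OF N])
      (simp add: ahb_hom_def)
qed

text \<open>Both functors leave the underlying function of a morphism alone, so functoriality
  reduces to the transport of objects and of morphism sets, and mutual inverseness to
  objects.\<close>

lemma inverse_functors_smash_ahb:
  "inverse_functors (lmod_cat K (smash K H A B)) (ahb_cat K H A B)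
    (smash_to_ahb K H A B) (\<lambda>M N f. f) (ahb_to_smash K H A B) (\<lambda>M N f. f)"
proof -
  let ?C = "lmod_cat K (smash K H A B)" and ?D = "ahb_cat K H A B"
  have "is_functor ?C ?D (smash_to_ahb K H A B) (\<lambda>M N f. f)"
    unfolding is_functor_def lmod_cat_def ahb_cat_def
    by (auto intro: smash_to_ahb_object lmod_hom_imp_ahb_hom) (simp_all add: smash_to_ahb_def)
  moreover have "is_functor ?D ?C (ahb_to_smash K H A B) (\<lambda>M N f. f)"
    unfolding is_functor_def lmod_cat_def ahb_cat_def
    by (auto intro: ahb_to_smash_object ahb_hom_imp_lmod_hom) (simp_all add: ahb_to_smash_def)
  ultimately show ?thesis
    unfolding inverse_functors_def
    by (simp add: lmod_cat_def ahb_cat_def ahb_to_smash_to_ahb smash_to_ahb_to_smash)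
qed

end

theorem proposition9p6:
  fixes K :: "('k, 'r) ring_scheme"
    and H :: "('k, 'h, 'x) quasi_bialg_scheme"
    and A :: "('k, 'h, 'a, 'y) left_mod_alg_scheme"
    and B :: "('k, 'h, 'b, 'z) right_mod_alg_scheme"
    and C :: "(('k, ('a \<times> ('h \<times> 'b \<Rightarrow> 'k) set \<Rightarrow> 'k) set, 'm) lmod, 'm \<Rightarrow> 'm) cat"
    and D :: "(('k, 'h, 'a, 'b, 'm) ahb_mod, 'm \<Rightarrow> 'm) cat"
  assumes "field K"
    and "quasi_bialgebra K H"
    and "left_module_algebra K H A"
    and "right_module_algebra K H B"
    and "C = lmod_cat K (smash K H A B)"
    and "D = ahb_cat K H A B"
  shows "category C \<and> category D \<and>
         inverse_functors C D
           (smash_to_ahb K H A B) (\<lambda>M N f. f)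
           (ahb_to_smash K H A B) (\<lambda>M N f. f) \<and>
         (\<forall>M\<in>Ob D. \<forall>a\<in>carrier A. \<forall>h\<in>carrier H. \<forall>b\<in>carrier B. \<forall>m\<in>carrier (ahb_space M).
           lm_act (ahb_to_smash K H A B M) (tens3 K A H B a h b) m =
           ahb_A M a (ahb_H M h (ahb_B M b m)))"
proof -
  interpret smash_product K H A B
    using assms(2-4) by (simp add: smash_product_def smash_product_axioms_def)
  have "lm_act (ahb_to_smash K H A B M) (tens3 K A H B a h b) m = ahb_A M a (ahb_H M h (ahb_B M b m))"
    if "M \<in> Ob D" "a \<in> carrier A" "h \<in> carrier H" "b \<in> carrier B" "m \<in> carrier (ahb_space M)" for M a h b m
    using that by (intro ahb_to_smash_tens3) (simp_all add: assms(6) ahb_cat_def)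
  then show ?thesis
    using category_lmod category_ahb inverse_functors_smash_ahb unfolding assms(5,6) by blast
qed

end
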